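(* Suppose that $X$ is transient. For $i\in C$ let $\beta_i=\mathbb P_i(X\text{ never hits }0)$ and set $\Delta=\sum_{j\in C}\frac{q_{0,j}\beta_j}{q_0}$. Define $$p_{(0,0)}=p_0=\frac{(1-e^{-q_0})\Delta}{e^{-q_0}+(1-e^{-q_0})\Delta},\qquad p_{(0,u)}=\frac{1-e^{-q_0(1-u)}}{1-e^{-q_0}}\,p_0\quad(u\in[0,1)),$$ $$p_i=\beta_i+(1-\beta_i)p_0\quad (i\in C).$$ Then $s_i(t)\to p_i$ as $t\to\infty$ for all $i\in\hat S$. Hence, if we condition $X$ on $\tau=\infty$ we obtain a new Markov process $X^\infty$ on $\hat S$ with honest semigroup $P^\infty$ given by $$P^\infty_{i,j}(t)=\frac{p_j}{p_i}\hat P_{i,j}(t)\ \text{ for } j\in C,\qquad P^\infty_i((0,du);t)=\frac{p_{(0,u)}}{p_i}\hat P_i((0,du);t),$$ so that $X^\infty$ looks like a Markov chain with $Q$-matrix given by $q^\infty_{i,j}=\frac{p_j}{p_i}q_{i,j}$ on $C$, whilst $X^\infty$ has a holding time in $0$ with density $d$ given by $$d(t)=\frac{e^{-q_0t}}{\int_0^1e^{-q_0s}ds}\,1_{(t<1)}$$ and a time-homogeneous jump probability out of state $0$ to state $j$ of $\frac{q_{0,j}p_j}{q_0p_0}$.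
   Context: $X=(X_t)_{t\ge 0}$ is an irreducible, non-explosive continuous-time Markov chain on $S=\mathbb Z^+=\{0,1,2,\dots\}$ or $S=\{0,\dots,K\}$, with distinguished state $0$; $C=S\setminus\{0\}$. Its $Q$-matrix is $(q_{i,j})$ and $q_i=-q_{i,i}$ (so $q_0$ is the rate of leaving $0$). The current holding time $H_t$ is the time elapsed since the most recent entry of $X$ into $0$ if $X_t=0$, and $H_t=\emptyset$ if $X_t\ne0$. Let $\tau=\inf\{t: H_t\ge1\}$, the first time $X$ has waited in $0$ for time $1$. Let $\hat S=C\cup(\{0\}\times[0,1))$; $\hat X$ denotes the process $(X_t,H_t)$ killed at time $\tau$, viewed as a process on $\hat S$: it is in state $i\in C$ when $X_t=i$ and in state $(0,u)$ when $X_t=0$, $H_t=u$. The state $0$ is identified with $(0,0)$. $\mathbb P_i$ is the law started from $i\in\hat S$ (starting from $(0,u)$ means that $X_0=0$ and the chain has already been at $0$ for time $u$). $(\hat P(t))_{t\ge0}$ is the substochastic transition semigroup of $\hat X$, with $\hat P_{i,j}(t)=\mathbb P_i(\hat X_t=j,\ t<\tau)$ for $j\in C$ and $\hat P_i((0,du);t)=\mathbb P_i(\hat X_t\in\{0\}\times du,\ t<\tau)$. For $i\in\hat S$, $s_i(t)=\mathbb P_i(\tau>t)=\hat P(i,\hat S;t)$. A semigroup is honest if its transition kernels have total mass $1$.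
   Formalization: The printed jump probabilities out of 0, q_{0,j}p_j/(q_0p_0), sum to 1/(1-e^{-q_0}) > 1; the formal statement multiplies them by 1-e^{-q_0}, so that they are the true jump probabilities of X^∞ out of 0. *)

theory Defs
  imports "HOL-Probability.Probability"
begin

section \<open>Markov processes in continuous time\<close>

definition history :: "'w set \<Rightarrow> 's measure \<Rightarrow> (real \<Rightarrow> 'w \<Rightarrow> 's) \<Rightarrow> real \<Rightarrow> 'w measure" where
  "history \<Omega> E Z t = sigma \<Omega> (\<Union>s\<in>{0..t}. {Z s -` B \<inter> \<Omega> | B. B \<in> sets E})"

definition markov_from ::
  "'w measure \<Rightarrow> 's measure \<Rightarrow> (real \<Rightarrow> 'w \<Rightarrow> 's) \<Rightarrow> (real \<Rightarrow> 's \<Rightarrow> 's measure) \<Rightarrow> 's \<Rightarrow> bool" where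
  "markov_from N E Z K z \<longleftrightarrow>
     prob_space N \<and>
     (\<forall>t\<ge>0. Z t \<in> measurable N E) \<and>
     (AE \<omega> in N. Z 0 \<omega> = z) \<and>
     (\<forall>t\<ge>0. \<forall>h\<ge>0. \<forall>A\<in>sets (history (space N) E Z t). \<forall>B\<in>sets E.
        emeasure N {\<omega>\<in>A. Z (t + h) \<omega> \<in> B} = (\<integral>\<^sup>+\<omega>\<in>A. emeasure (K h (Z t \<omega>)) B \<partial>N))"

definition honest_semigroup :: "'s measure \<Rightarrow> (real \<Rightarrow> 's \<Rightarrow> 's measure) \<Rightarrow> bool" where
  "honest_semigroup E K \<longleftrightarrow>
     (\<forall>t\<ge>0. K t \<in> measurable E (prob_algebra E)) \<and>
     (\<forall>z\<in>space E. K 0 z = return E z) \<and>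
     (\<forall>s\<ge>0. \<forall>t\<ge>0. \<forall>z\<in>space E. K (s + t) z = K s z \<bind> K t)"


section \<open>Jump times of a path\<close>

text \<open>After the last jump of a path all later jump times are \<open>\<infinity>\<close>.  The value of
  \<open>visited x n\<close> is meaningful only if \<open>jump_time x n < \<infinity>\<close>; if \<open>holding x n\<close> is finite then
  so are \<open>jump_time x n\<close> and \<open>jump_time x (Suc n)\<close>, since \<open>\<infinity> - \<infinity> = \<infinity>\<close> in \<open>ereal\<close>.\<close>

primrec jump_time :: "(real \<Rightarrow> nat) \<Rightarrow> nat \<Rightarrow> ereal" where
  "jump_time x 0 = 0"
| "jump_time x (Suc n) =
     Inf {ereal s | s. jump_time x n \<le> ereal s \<and> x s \<noteq> x (real_of_ereal (jump_time x n))}"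

definition visited :: "(real \<Rightarrow> nat) \<Rightarrow> nat \<Rightarrow> nat" where
  "visited x n = x (real_of_ereal (jump_time x n))"

definition holding :: "(real \<Rightarrow> nat) \<Rightarrow> nat \<Rightarrow> ereal" where
  "holding x n = jump_time x (Suc n) - jump_time x n"


section \<open>Continuous-time Markov chains\<close>

text \<open>\<open>P i\<close> is the law of the chain started from \<open>i\<close>.  All laws live on one measurable space,
  on which \<open>X\<close> has right-continuous paths whose explosion time \<open>sup J\<^sub>n\<close> is infinite.  The
  transition function is \<open>p\<^sub>i\<^sub>j(t) = P i (X t = j)\<close> and \<open>q\<close> is its derivative at \<open>0\<close>,
  with rows summing to \<open>0\<close> (\<open>q\<close> is conservative).\<close>

locale nonexplosive_ctmc =
  fixes S :: "nat set" and P :: "nat \<Rightarrow> 'w measure" and X :: "real \<Rightarrow> 'w \<Rightarrow> nat"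
    and q :: "nat \<Rightarrow> nat \<Rightarrow> real"
  assumes state_space: "S = UNIV \<or> (\<exists>K. S = {0..K})"
    and sets_P: "\<And>i. i \<in> S \<Longrightarrow> sets (P i) = sets (P 0)"
    and markov: "\<And>i. i \<in> S \<Longrightarrow>
      markov_from (P i) (count_space S) X (\<lambda>t j. distr (P j) (count_space S) (X t)) i"
    and right_continuous: "\<And>\<omega> t. \<omega> \<in> space (P 0) \<Longrightarrow> 0 \<le> t \<Longrightarrow>
      continuous (at_right t) (\<lambda>s. X s \<omega>)"
    and nonexplosive: "\<And>\<omega>. \<omega> \<in> space (P 0) \<Longrightarrow> (SUP n. jump_time (\<lambda>s. X s \<omega>) n) = \<infinity>"
    and q_deriv: "\<And>i j. i \<in> S \<Longrightarrow> j \<in> S \<Longrightarrow>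
      ((\<lambda>t. measure (P i) {\<omega>\<in>space (P i). X t \<omega> = j}) has_real_derivative q i j) (at_right 0)"
    and q_conservative: "\<And>i. i \<in> S \<Longrightarrow> (q i has_sum 0) S"

definition irreducible_chain :: "nat set \<Rightarrow> (nat \<Rightarrow> 'w measure) \<Rightarrow> (real \<Rightarrow> 'w \<Rightarrow> nat) \<Rightarrow> bool" where
  "irreducible_chain S P X \<longleftrightarrow>
     (\<forall>i\<in>S. \<forall>j\<in>S. \<exists>t\<ge>0. measure (P i) {\<omega>\<in>space (P i). X t \<omega> = j} > 0)"

definition transient_chain :: "nat set \<Rightarrow> (nat \<Rightarrow> 'w measure) \<Rightarrow> (real \<Rightarrow> 'w \<Rightarrow> nat) \<Rightarrow> bool" where
  "transient_chain S P X \<longleftrightarrow> (\<forall>i\<in>S. AE \<omega> in P i. bounded {t. 0 \<le> t \<and> X t \<omega> = i})"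


section \<open>Waiting in state 0\<close>

text \<open>\<open>u\<close> is the time already spent in \<open>0\<close> when the clock starts; it matters only for
  paths with \<open>x 0 = 0\<close>.  \<open>None\<close> stands for \<open>H\<^sub>t = \<emptyset>\<close>.\<close>

definition current_holding :: "real \<Rightarrow> (real \<Rightarrow> nat) \<Rightarrow> real \<Rightarrow> real option" where
  "current_holding u x t =
     (if x t \<noteq> 0 then None
      else if \<forall>s\<in>{0..t}. x s = 0 then Some (u + t)
      else Some (t - Inf {r\<in>{0..t}. \<forall>s\<in>{r..t}. x s = 0}))"

definition tau :: "real \<Rightarrow> (real \<Rightarrow> nat) \<Rightarrow> ereal" where
  "tau u x = Inf {ereal t | t. 0 \<le> t \<and> (\<exists>h. current_holding u x t = Some h \<and> 1 \<le> h)}"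

text \<open>A state \<open>i \<in> C\<close> is encoded as \<open>(i, 0)\<close>, so that \<open>(i, 0)\<close> represents \<open>i\<close> for every
  \<open>i \<in> S\<close>.  A chain started from \<open>z\<close> has law \<open>P (fst z)\<close> and initial age \<open>snd z\<close>.\<close>

definition Shat :: "nat set \<Rightarrow> (nat \<times> real) set" where
  "Shat S = {(i, u). i \<in> S \<and> (if i = 0 then 0 \<le> u \<and> u < 1 else u = 0)}"

definition Shat_algebra :: "nat set \<Rightarrow> (nat \<times> real) measure" where
  "Shat_algebra S = restrict_space (count_space UNIV \<Otimes>\<^sub>M borel) (Shat S)"

definition Xhat :: "real \<Rightarrow> (real \<Rightarrow> nat) \<Rightarrow> real \<Rightarrow> nat \<times> real" where
  "Xhat u x t = (x t, case current_holding u x t of None \<Rightarrow> 0 | Some h \<Rightarrow> h)"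

definition Phat ::
  "nat set \<Rightarrow> (nat \<Rightarrow> 'w measure) \<Rightarrow> (real \<Rightarrow> 'w \<Rightarrow> nat) \<Rightarrow> real \<Rightarrow> nat \<times> real \<Rightarrow> (nat \<times> real) measure" where
  "Phat S P X t z =
     distr (restrict_space (P (fst z)) {\<omega>\<in>space (P (fst z)). ereal t < tau (snd z) (\<lambda>s. X s \<omega>)})
       (Shat_algebra S) (\<lambda>\<omega>. Xhat (snd z) (\<lambda>s. X s \<omega>) t)"

definition survival :: "(nat \<Rightarrow> 'w measure) \<Rightarrow> (real \<Rightarrow> 'w \<Rightarrow> nat) \<Rightarrow> nat \<times> real \<Rightarrow> real \<Rightarrow> real" where
  "survival P X z t =
     measure (P (fst z)) {\<omega>\<in>space (P (fst z)). tau (snd z) (\<lambda>s. X s \<omega>) > ereal t}"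

text \<open>The law from \<open>z\<close> conditioned on \<open>\<tau> = \<infinity>\<close>, as a measure on that event; off the event
  \<open>Xhat\<close> may leave \<open>Shat S\<close>.\<close>

definition conditioned_law ::
  "(nat \<Rightarrow> 'w measure) \<Rightarrow> (real \<Rightarrow> 'w \<Rightarrow> nat) \<Rightarrow> nat \<times> real \<Rightarrow> 'w measure" where
  "conditioned_law P X z =
     (let E = {\<omega>\<in>space (P (fst z)). tau (snd z) (\<lambda>s. X s \<omega>) = \<infinity>}
      in restrict_space (uniform_measure (P (fst z)) E) E)"

text \<open>Joint law of the first \<open>n\<close> holding times and jumps of a path starting in \<open>i\<close>:
  each holding time in \<open>k\<close> has density \<open>f k\<close> and, independently of its length, is
  followed by a jump to \<open>l\<close> with probability \<open>r k l\<close>.  In state \<open>0\<close> the weights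
  \<open>q\<^sub>0\<^sub>j p\<^sub>j / (q\<^sub>0 p\<^sub>0)\<close> add up to \<open>1 / (1 - exp (- q\<^sub>0))\<close> and become such probabilities after
  multiplication by \<open>1 - exp (- q\<^sub>0)\<close>.\<close>

definition jump_holding_law ::
  "'w measure \<Rightarrow> (real \<Rightarrow> 'w \<Rightarrow> nat) \<Rightarrow> nat set \<Rightarrow> (nat \<Rightarrow> real \<Rightarrow> real) \<Rightarrow> (nat \<Rightarrow> nat \<Rightarrow> real) \<Rightarrow> nat \<Rightarrow> bool" where
  "jump_holding_law N X S f r i \<longleftrightarrow>
     (\<forall>n. \<forall>y A. y 0 = i \<longrightarrow> (\<forall>k\<le>n. y k \<in> S) \<longrightarrow> (\<forall>k<n. y (Suc k) \<noteq> y k \<and> A k \<in> sets borel) \<longrightarrow>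
        measure N {\<omega>\<in>space N. (\<forall>k\<le>n. visited (\<lambda>s. X s \<omega>) k = y k) \<and>
                               (\<forall>k<n. holding (\<lambda>s. X s \<omega>) k \<in> ereal ` A k)}
        = (\<Prod>k<n. (LINT t:A k|lborel. f (y k) t) * r (y k) (y (Suc k))))"

end

theory Submission
  imports Defs
begin

text \<open>
  The chain is transferred to the space of right-continuous paths, where the Markov property
  extends from finite-dimensional cylinders to all path events. Sampling a path on a grid and
  refining the grid gives the strong Markov property at the hitting time of a set, and with the
  derivatives \<open>q\<close> the exponential law of the first jump. Conditioning on the first jump out of \<open>0\<close>
  and on the first visit to \<open>0\<close> turns the probability of \<open>\<tau> = \<infinity>\<close> into the solution \<open>p\<close> of a linear
  equation. Transience forces \<open>\<Delta> > 0\<close>: by non-explosion a path with finitely many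
  visits to \<open>0\<close> has a last exit from \<open>0\<close>, after which it never returns. Finally \<open>\<tau> = \<infinity>\<close> holds iff
  \<open>\<tau> > t\<close> and the path after time \<open>t\<close>, started with its current age, survives forever; hence
  conditioning on \<open>\<tau> = \<infinity>\<close> is the Doob transform by \<open>p\<close>.
\<close>

section \<open>Path space\<close>

text \<open>The laws \<open>P i\<close> live on an abstract space without shift maps, and their
  Markov property speaks about one future time only; path space supplies the shift needed for "the
  path after time t". Constancy to the right of every time is the regularity that does the work: a
  rational or grid time slightly after a random time sees the same state, which settles
  measurability and the strong Markov property alike. The killing depends on the age in 0 and not on
  the state alone, so statements carry an initial age \<open>u\<close>, and every jump resets it to
  0. With e = exp (- q0), a wait in 0 ends in time with probability 1 - e, and the jump either
  leaves 0 for good (probability \<Delta>) or is followed by a return, so p0 = (1 - e) (\<Delta> +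
  (1 - \<Delta>) p0); its solution is the stated fraction. In the law of an itinerary the factors
  p_l / p_k telescope to p_end / p_start, which is the effect of the conditioning. In 0 the
  truncation of the wait at 1 has mass 1 - e, and this mass reappears as the normalisation of
  \<open>d\<close> and as the factor that turns the weights out of 0 into probabilities.\<close>

definition paths :: "nat set \<Rightarrow> (real \<Rightarrow> nat) set" where
  "paths S = {x. \<forall>t\<ge>0. x t \<in> S \<and> continuous (at_right t) x}"

text \<open>Only coordinates at nonnegative times generate: the values of a path at negative times
  are unconstrained, and no event sees them.\<close>

definition path_algebra :: "nat set \<Rightarrow> (real \<Rightarrow> nat) measure" where
  "path_algebra S = sigma (paths S) {{x\<in>paths S. x t = j} | t j. 0 \<le> t}"

definition time_shift :: "real \<Rightarrow> (real \<Rightarrow> nat) \<Rightarrow> real \<Rightarrow> nat" where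
  "time_shift t x = (\<lambda>s. x (t + s))"

definition stop :: "real \<Rightarrow> (real \<Rightarrow> nat) \<Rightarrow> real \<Rightarrow> nat" where
  "stop t x = (\<lambda>s. x (min s t))"

text \<open>\<open>nat\<close> is discrete, so convergence is eventual equality and right continuity
  becomes local constancy to the right. All approximations from the right below rest on this
  form.\<close>

lemma continuous_at_right_nat_iff:
  fixes x :: "real \<Rightarrow> nat"
  shows "continuous (at_right t) x \<longleftrightarrow> (\<exists>e>0. \<forall>s\<in>{t..<t+e}. x s = x t)"
proof -
  have "continuous (at_right t) x \<longleftrightarrow> (x \<longlongrightarrow> x t) (at_right t)"
    by (simp add: continuous_within)
  also have "\<dots> \<longleftrightarrow> eventually (\<lambda>s. x s = x t) (at_right t)"
    by (simp add: tendsto_discrete)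
  also have "\<dots> \<longleftrightarrow> (\<exists>b>t. \<forall>s>t. s < b \<longrightarrow> x s = x t)"
    by (simp add: eventually_at_right_field)
  also have "\<dots> \<longleftrightarrow> (\<exists>e>0. \<forall>s\<in>{t..<t+e}. x s = x t)"
  proof
    assume "\<exists>b>t. \<forall>s>t. s < b \<longrightarrow> x s = x t"
    then obtain b where "b > t" "\<forall>s>t. s < b \<longrightarrow> x s = x t" by auto
    then show "\<exists>e>0. \<forall>s\<in>{t..<t+e}. x s = x t"
      by (intro exI[of _ "b - t"]) (auto simp: le_less)
  next
    assume "\<exists>e>0. \<forall>s\<in>{t..<t+e}. x s = x t"
    then obtain e where "e > 0" "\<forall>s\<in>{t..<t+e}. x s = x t" by blast
    then show "\<exists>b>t. \<forall>s>t. s < b \<longrightarrow> x s = x t"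
      by (intro exI[of _ "t + e"]) (meson atLeastLessThan_iff less_add_same_cancel1 less_imp_le)
  qed
  finally show ?thesis .
qed

lemma paths_iff:
  "x \<in> paths S \<longleftrightarrow> (\<forall>t\<ge>0. x t \<in> S) \<and> (\<forall>t\<ge>0. \<exists>e>0. \<forall>s\<in>{t..<t+e}. x s = x t)"
  by (auto simp: paths_def continuous_at_right_nat_iff)

lemma paths_in: "x \<in> paths S \<Longrightarrow> 0 \<le> t \<Longrightarrow> x t \<in> S"
  by (auto simp: paths_def)

lemma paths_right_constant:
  assumes "x \<in> paths S" "0 \<le> t"
  obtains e where "e > 0" "\<And>s. t \<le> s \<Longrightarrow> s < t + e \<Longrightarrow> x s = x t"
proof -
  from assms obtain e where e: "e > 0" "\<forall>s\<in>{t..<t+e}. x s = x t"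
    unfolding paths_iff by blast
  then have "x s = x t" if "t \<le> s" "s < t + e" for s
    using that by (meson atLeastLessThan_iff)
  with e(1) show thesis by (rule that)
qed

lemma pathsI:
  assumes "\<And>t. 0 \<le> t \<Longrightarrow> x t \<in> S"
    and "\<And>t. 0 \<le> t \<Longrightarrow> \<exists>e>0. \<forall>s. t \<le> s \<longrightarrow> s < t + e \<longrightarrow> x s = x t"
  shows "x \<in> paths S"
  unfolding paths_iff using assms by (meson atLeastLessThan_iff)

lemma time_shift_apply: "time_shift t x s = x (t + s)"
  by (simp add: time_shift_def)

lemma time_shift_time_shift: "time_shift s (time_shift t x) = time_shift (t + s) x"
  by (auto simp: time_shift_def add.assoc)

lemma time_shift_0 [simp]: "time_shift 0 x = x"
  by (simp add: time_shift_def)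

lemma time_shift_paths:
  assumes x: "x \<in> paths S" and t: "0 \<le> t"
  shows "time_shift t x \<in> paths S"
proof (rule pathsI)
  fix s :: real assume "0 \<le> s"
  then have ts: "0 \<le> t + s" using t by simp
  obtain e where e: "e > 0" "\<And>r. t + s \<le> r \<Longrightarrow> r < t + s + e \<Longrightarrow> x r = x (t + s)"
    using paths_right_constant[OF x ts] by blast
  show "\<exists>e>0. \<forall>r. s \<le> r \<longrightarrow> r < s + e \<longrightarrow> time_shift t x r = time_shift t x s"
  proof (intro exI[of _ e] conjI allI impI)
    fix r assume "s \<le> r" "r < s + e"
    then show "time_shift t x r = time_shift t x s" using e(2)[of "t + r"] by (simp add: time_shift_apply)
  qed (rule e(1))
qed (use assms paths_in in \<open>simp add: time_shift_apply\<close>)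

lemma stop_paths:
  assumes x: "x \<in> paths S" and t: "0 \<le> t"
  shows "stop t x \<in> paths S"
proof (rule pathsI)
  fix s :: real assume s: "0 \<le> s"
  obtain e where e: "e > 0" "\<And>r. s \<le> r \<Longrightarrow> r < s + e \<Longrightarrow> x r = x s"
    using paths_right_constant[OF x s] by blast
  show "\<exists>e>0. \<forall>r. s \<le> r \<longrightarrow> r < s + e \<longrightarrow> stop t x r = stop t x s"
  proof (cases "s < t")
    case True
    show ?thesis
    proof (intro exI[of _ "min e (t - s)"] conjI allI impI)
      fix r assume "s \<le> r" "r < s + min e (t - s)"
      then show "stop t x r = stop t x s" using e(2)[of r] by (simp add: stop_def)
    qed (use e(1) True in simp)
  next
    case False
    then show ?thesis by (intro exI[of _ 1]) (simp add: stop_def)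
  qed
qed (use assms paths_in in \<open>simp add: stop_def\<close>)

lemma space_path_algebra [simp]: "space (path_algebra S) = paths S"
  unfolding path_algebra_def by (intro space_measure_of) auto

lemma sets_path_algebra:
  "sets (path_algebra S) = sigma_sets (paths S) {{x\<in>paths S. x t = j} | t j. 0 \<le> t}"
  unfolding path_algebra_def by (intro sets_measure_of) auto

lemma measurable_path_algebraI:
  assumes "\<And>\<omega>. \<omega> \<in> space M \<Longrightarrow> f \<omega> \<in> paths S"
    and "\<And>t j. 0 \<le> t \<Longrightarrow> {\<omega>\<in>space M. f \<omega> t = j} \<in> sets M"
  shows "f \<in> M \<rightarrow>\<^sub>M path_algebra S"
  unfolding path_algebra_def
proof (rule measurable_measure_of)
  fix A assume "A \<in> {{x\<in>paths S. x t = j} | t j. 0 \<le> t}"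
  then obtain t j where A: "A = {x\<in>paths S. x t = j}" "0 \<le> t" by auto
  have "f -` A \<inter> space M = {\<omega>\<in>space M. f \<omega> t = j}"
    using assms(1) A by auto
  then show "f -` A \<inter> space M \<in> sets M" using assms(2) A by simp
qed (use assms(1) in auto)

lemma measurable_path_eval:
  assumes "0 \<le> t"
  shows "(\<lambda>x. x t) \<in> path_algebra S \<rightarrow>\<^sub>M count_space S"
proof (subst measurable_count_space_eq_countable, safe)
  fix j assume "j \<in> S"
  have "(\<lambda>x. x t) -` {j} \<inter> space (path_algebra S) = {x\<in>paths S. x t = j}" by auto
  then show "(\<lambda>x. x t) -` {j} \<inter> space (path_algebra S) \<in> sets (path_algebra S)"
    using assms by (auto simp: sets_path_algebra)
qed (use assms paths_in in \<open>auto intro: countableI_type\<close>)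

lemma measurable_path_eval_UNIV:
  assumes "0 \<le> t"
  shows "(\<lambda>x. x t) \<in> path_algebra S \<rightarrow>\<^sub>M count_space UNIV"
  using measurable_compose[OF measurable_path_eval[OF assms, of S], of id "count_space UNIV"] by simp

lemma measurable_time_shift:
  assumes "0 \<le> t"
  shows "time_shift t \<in> path_algebra S \<rightarrow>\<^sub>M path_algebra S"
proof (rule measurable_path_algebraI)
  fix s j assume "0 \<le> (s::real)"
  then show "{\<omega> \<in> space (path_algebra S). time_shift t \<omega> s = j} \<in> sets (path_algebra S)"
    using assms by (auto simp: time_shift_apply sets_path_algebra intro!: sigma_sets.Basic exI[of _ "t+s"])
qed (use assms in \<open>auto intro: time_shift_paths\<close>)


text \<open>The times are increments, so that two cylinders intersect in a cylinder by recursion on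
  whichever time comes first.\<close>

primrec cylinder :: "nat set \<Rightarrow> (real \<times> nat) list \<Rightarrow> (real \<Rightarrow> nat) set" where
  "cylinder S [] = paths S"
| "cylinder S (y # ys) = {x\<in>paths S. x (fst y) = snd y \<and> time_shift (fst y) x \<in> cylinder S ys}"

abbreviation increments :: "(real \<times> nat) list set" where
  "increments \<equiv> lists ({0..} \<times> UNIV)"

lemma cylinder_subset: "cylinder S ys \<subseteq> paths S"
  by (cases ys) auto

lemma sets_cylinder: "ys \<in> increments \<Longrightarrow> cylinder S ys \<in> sets (path_algebra S)"
proof (induction ys)
  case Nil
  then show ?case using sets.top[of "path_algebra S"] by simp
next
  case (Cons y ys)
  then have "0 \<le> fst y" "ys \<in> increments" by auto
  then have 1: "{x\<in>paths S. x (fst y) = snd y} \<in> sets (path_algebra S)"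
    by (auto simp: sets_path_algebra)
  have 2: "time_shift (fst y) -` cylinder S ys \<inter> space (path_algebra S) \<in> sets (path_algebra S)"
    using Cons \<open>0 \<le> fst y\<close> by (intro measurable_sets[OF measurable_time_shift]) auto
  have eq: "cylinder S (y # ys) =
      {x\<in>paths S. x (fst y) = snd y} \<inter> (time_shift (fst y) -` cylinder S ys \<inter> space (path_algebra S))"
    unfolding cylinder.simps space_path_algebra by blast
  show ?case unfolding eq using 1 2 by (rule sets.Int)
qed

lemma cylinder_Int:
  assumes "ys \<in> increments" "zs \<in> increments"
  shows "\<exists>ws\<in>increments. cylinder S ys \<inter> cylinder S zs = cylinder S ws"
  using assms
proof (induction "length ys + length zs" arbitrary: ys zs rule: less_induct)
  case less
  show ?case
  proof (cases "ys = [] \<or> zs = []")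
    case True
    then show ?thesis using less.prems cylinder_subset[of S ys] cylinder_subset[of S zs]
      by (metis cylinder.simps(1) inf.absorb_iff2 inf.orderE)
  next
    case False
    have step: "\<exists>ws\<in>increments. cylinder S ((s,j)#as) \<inter> cylinder S ((r,k)#bs) = cylinder S ws"
      if as: "as \<in> increments" and bs: "bs \<in> increments" and s: "0 \<le> s" "s \<le> r"
        and len: "length as + length bs + 2 = length ys + length zs" for s r j k as bs
    proof -
      have "(r - s, k) # bs \<in> increments" using s bs by simp
      from less.hyps[OF _ as this] obtain ws where ws: "ws \<in> increments"
          "cylinder S as \<inter> cylinder S ((r-s,k)#bs) = cylinder S ws" using len by auto
      have "cylinder S ((s,j)#as) \<inter> cylinder S ((r,k)#bs) = cylinder S ((s,j)#ws)"
        using s by (auto simp: ws(2)[symmetric] time_shift_apply time_shift_time_shift time_shift_paths)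
      then show ?thesis using ws s by (intro bexI[of _ "(s,j)#ws"]) auto
    qed
    from False obtain s j as r k bs where eq: "ys = (s,j)#as" "zs = (r,k)#bs"
      by (metis neq_Nil_conv surj_pair)
    show ?thesis
    proof (cases "s \<le> r")
      case True
      then show ?thesis using step[of as bs s r j k] less.prems unfolding eq by auto
    next
      case False
      then show ?thesis using step[of bs as r s k j] less.prems unfolding eq
        by (auto simp: Int_commute)
    qed
  qed
qed

lemma sets_path_algebra_cylinder:
  "sets (path_algebra S) = sigma_sets (paths S) (cylinder S ` increments)"
proof
  show "sets (path_algebra S) \<subseteq> sigma_sets (paths S) (cylinder S ` increments)"
    unfolding sets_path_algebra
  proof (rule sigma_sets_mono, safe)
    fix t j assume "0 \<le> (t::real)"
    moreover have "{x\<in>paths S. x t = j} = cylinder S [(t,j)]"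
      using \<open>0 \<le> t\<close> by (auto simp: time_shift_paths)
    ultimately show "{x\<in>paths S. x t = j} \<in> sigma_sets (paths S) (cylinder S ` increments)"
      by (metis (no_types, lifting) SigmaI UNIV_I atLeast_iff image_eqI lists.Cons lists.Nil sigma_sets.Basic)
  qed
  show "sigma_sets (paths S) (cylinder S ` increments) \<subseteq> sets (path_algebra S)"
  proof -
    have "cylinder S ` increments \<subseteq> sets (path_algebra S)"
      using sets_cylinder by blast
    from sets.sigma_sets_subset[OF this] show ?thesis by simp
  qed
qed

text \<open>Cylinders form a pi-system containing the whole space (the cylinder of
  \<open>[]\<close>), hence they determine a finite measure. Both Markov properties are extended
  from cylinders to all path events through this lemma.\<close>

lemma measure_eqI_cylinder:
  assumes M: "sets M = sets (path_algebra S)" and N: "sets N = sets (path_algebra S)"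
    and fin: "emeasure M (paths S) \<noteq> \<infinity>"
    and eq: "\<And>ys. ys \<in> increments \<Longrightarrow> emeasure M (cylinder S ys) = emeasure N (cylinder S ys)"
  shows "M = N"
proof (rule measure_eqI_generator_eq[where E="cylinder S ` increments" and \<Omega>="paths S"
      and A="\<lambda>_. paths S"])
  show "Int_stable (cylinder S ` increments)"
  proof (rule Int_stableI_image)
    fix ys zs assume "ys \<in> increments" "zs \<in> increments"
    then show "\<exists>ws\<in>increments. cylinder S ys \<inter> cylinder S zs = cylinder S ws"
      by (rule cylinder_Int)
  qed
  show "cylinder S ` increments \<subseteq> Pow (paths S)"
    using cylinder_subset by auto
  show "range (\<lambda>_. paths S) \<subseteq> cylinder S ` increments"
    by (auto intro!: image_eqI[of _ _ "[]"])
  show "sets M = sigma_sets (paths S) (cylinder S ` increments)"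
    unfolding M by (rule sets_path_algebra_cylinder)
  show "sets N = sigma_sets (paths S) (cylinder S ` increments)"
    unfolding N by (rule sets_path_algebra_cylinder)
qed (use fin eq in auto)

text \<open>A cylinder inspects finitely many times, and the path stays constant for a while after
  each of them; the least of these durations is \<open>e\<close>. For a general event a small shift
  may change membership at once, which is why grid limits are taken on cylinders only.\<close>

lemma cylinder_right_constant:
  assumes "ys \<in> increments" "x \<in> paths S" "0 \<le> t"
  shows "\<exists>e>0. \<forall>s. t \<le> s \<longrightarrow> s < t + e \<longrightarrow> (time_shift s x \<in> cylinder S ys \<longleftrightarrow> time_shift t x \<in> cylinder S ys)"
  using assms
proof (induction ys arbitrary: t rule: list.induct)
  case Nil
  then have "time_shift s x \<in> paths S" if "t \<le> s" for s
    using that by (intro time_shift_paths) auto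
  with Nil show ?case by (auto intro!: exI[of _ 1])
next
  case (Cons y ys)
  obtain r j where y: "y = (r, j)" by (cases y)
  with Cons.prems have r: "0 \<le> r" "0 \<le> t + r" by auto
  obtain e1 where e1: "e1 > 0" "\<And>s. t + r \<le> s \<Longrightarrow> s < t + r + e1 \<Longrightarrow> x s = x (t + r)"
    using paths_right_constant[OF Cons.prems(2) r(2)] by blast
  obtain e2 where e2: "e2 > 0" "\<And>s. t + r \<le> s \<Longrightarrow> s < t + r + e2 \<Longrightarrow>
      (time_shift s x \<in> cylinder S ys \<longleftrightarrow> time_shift (t + r) x \<in> cylinder S ys)"
    using Cons.IH[of "t+r"] Cons.prems r by auto
  show ?case
  proof (intro exI[of _ "min e1 e2"] conjI allI impI)
    fix s assume "t \<le> s" "s < t + min e1 e2"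
    then show "time_shift s x \<in> cylinder S (y # ys) \<longleftrightarrow> time_shift t x \<in> cylinder S (y # ys)"
      using e1(2)[of "s+r"] e2(2)[of "s+r"] Cons.prems
      by (simp add: y time_shift_apply time_shift_time_shift time_shift_paths)
  qed (use e1 e2 in auto)
qed


section \<open>Evaluation and shift of a path at a random time\<close>

lemma measurable_eval_random:
  assumes f: "f \<in> M \<rightarrow>\<^sub>M path_algebra S" and T: "T \<in> borel_measurable M"
    and T0: "\<And>\<omega>. \<omega> \<in> space M \<Longrightarrow> 0 \<le> T \<omega>"
  shows "(\<lambda>\<omega>. f \<omega> (T \<omega>)) \<in> M \<rightarrow>\<^sub>M count_space UNIV"
proof -
  \<comment> \<open>The random time is rounded strictly up to a multiple of
    \<open>1 / Suc n\<close>: it then has countably many values, and the approach is from the right,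
    where the path is constant for a while, so the rounded value is eventually exact.\<close>
  define g where "g n \<omega> = f \<omega> ((real (nat \<lfloor>T \<omega> * Suc n\<rfloor>) + 1) / Suc n)" for n \<omega>
  have g: "g n \<in> M \<rightarrow>\<^sub>M count_space UNIV" for n
    unfolding g_def
  proof (rule measurable_compose_countable[where f="\<lambda>k \<omega>. f \<omega> ((real k + 1) / Suc n)"])
    show "(\<lambda>\<omega>. nat \<lfloor>T \<omega> * Suc n\<rfloor>) \<in> M \<rightarrow>\<^sub>M count_space UNIV" using T by measurable
    show "(\<lambda>\<omega>. f \<omega> ((real k + 1) / Suc n)) \<in> M \<rightarrow>\<^sub>M count_space UNIV" for k
      by (rule measurable_compose[OF f measurable_path_eval_UNIV]) simp
  qed
  have lim: "(\<lambda>n. real (g n \<omega>)) \<longlonglongrightarrow> real (f \<omega> (T \<omega>))" if \<omega>: "\<omega> \<in> space M" for \<omega>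
  proof (rule tendsto_eventually)
    have "f \<omega> \<in> paths S" using f \<omega> by (auto simp: measurable_def)
    from paths_right_constant[OF this T0[OF \<omega>]] obtain e where
      e: "e > 0" "\<And>s. T \<omega> \<le> s \<Longrightarrow> s < T \<omega> + e \<Longrightarrow> f \<omega> s = f \<omega> (T \<omega>)" by blast
    have "eventually (\<lambda>n. inverse (real (Suc n)) < e) sequentially"
      using LIMSEQ_inverse_real_of_nat e(1) by (auto simp: order_tendsto_iff)
    then show "eventually (\<lambda>n. real (g n \<omega>) = real (f \<omega> (T \<omega>))) sequentially"
    proof eventually_elim
      case (elim n)
      let ?k = "nat \<lfloor>T \<omega> * Suc n\<rfloor>"
      have k: "real ?k \<le> T \<omega> * Suc n" "T \<omega> * Suc n < real ?k + 1"
        using T0[OF \<omega>] by (auto simp: of_nat_nat)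
      then have "T \<omega> \<le> (real ?k + 1) / Suc n" by (simp add: field_simps)
      moreover have "real ?k / Suc n \<le> T \<omega>" using k(1) by (simp add: field_simps)
      then have "(real ?k + 1) / Suc n < T \<omega> + e"
        using elim by (simp add: add_divide_distrib inverse_eq_divide)
      ultimately have "g n \<omega> = f \<omega> (T \<omega>)" unfolding g_def by (rule e(2))
      then show ?case by simp
    qed
  qed
  have "(\<lambda>\<omega>. real (f \<omega> (T \<omega>))) \<in> borel_measurable M"
  proof (rule borel_measurable_LIMSEQ_real[OF lim])
    show "(\<lambda>\<omega>. real (g n \<omega>)) \<in> borel_measurable M" for n using g by measurable
  qed
  then have "(\<lambda>\<omega>. nat \<lfloor>real (f \<omega> (T \<omega>))\<rfloor>) \<in> M \<rightarrow>\<^sub>M count_space UNIV" by measurable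
  then show ?thesis by simp
qed

lemma measurable_time_shift_random:
  assumes f: "f \<in> M \<rightarrow>\<^sub>M path_algebra S" and T: "T \<in> borel_measurable M"
    and T0: "\<And>\<omega>. \<omega> \<in> space M \<Longrightarrow> 0 \<le> T \<omega>"
  shows "(\<lambda>\<omega>. time_shift (T \<omega>) (f \<omega>)) \<in> M \<rightarrow>\<^sub>M path_algebra S"
proof (rule measurable_path_algebraI)
  fix \<omega> assume "\<omega> \<in> space M"
  then show "time_shift (T \<omega>) (f \<omega>) \<in> paths S"
    using f T0 by (auto simp: measurable_def intro: time_shift_paths)
next
  fix t j assume t: "0 \<le> (t::real)"
  have "(\<lambda>\<omega>. f \<omega> (T \<omega> + t)) \<in> M \<rightarrow>\<^sub>M count_space UNIV"
    using t T T0 by (intro measurable_eval_random[OF f]) (auto simp: add_nonneg_nonneg)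
  from measurable_sets[OF this, of "{j}"]
  show "{\<omega> \<in> space M. time_shift (T \<omega>) (f \<omega>) t = j} \<in> sets M"
    by (simp add: time_shift_apply vimage_def Int_def conj_commute)
qed


section \<open>First hitting times\<close>

definition hit :: "nat set \<Rightarrow> (real \<Rightarrow> nat) \<Rightarrow> ereal" where
  "hit B x = Inf {ereal s | s. 0 \<le> s \<and> x s \<in> B}"

lemma hit_less_iff: "hit B x < a \<longleftrightarrow> (\<exists>s\<ge>0. ereal s < a \<and> x s \<in> B)"
  by (auto simp: hit_def Inf_less_iff)

lemma hit_le: "0 \<le> s \<Longrightarrow> x s \<in> B \<Longrightarrow> hit B x \<le> ereal s"
  unfolding hit_def by (rule Inf_lower) auto

lemma hit_nonneg: "0 \<le> hit B x"
  unfolding hit_def by (rule Inf_greatest) auto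

text \<open>A path outside \<open>B\<close> at the infimum would remain outside for a while longer,
  leaving a gap between the infimum and the visits; so right constancy puts the infimum among the
  visits.\<close>

lemma hit_attained:
  assumes x: "x \<in> paths S" and fin: "hit B x < \<infinity>"
  shows "\<exists>t. 0 \<le> t \<and> hit B x = ereal t \<and> x t \<in> B \<and> (\<forall>s. 0 \<le> s \<longrightarrow> s < t \<longrightarrow> x s \<notin> B)"
proof -
  from hit_nonneg[of B x] fin obtain t where t: "hit B x = ereal t" "0 \<le> t"
    by (cases "hit B x") auto
  have before: "x s \<notin> B" if "0 \<le> s" "s < t" for s
    using hit_le[of s x B] that t by auto
  have "x t \<in> B"
  proof (rule ccontr)
    assume *: "x t \<notin> B"
    obtain e where e: "e > 0" "\<And>s. t \<le> s \<Longrightarrow> s < t + e \<Longrightarrow> x s = x t"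
      using paths_right_constant[OF x t(2)] by blast
    have "hit B x < ereal (t + e)" using t e(1) by simp
    then obtain s where s: "s \<ge> 0" "s < t + e" "x s \<in> B" by (auto simp: hit_less_iff)
    then show False using e(2)[of s] before[of s] * by (cases "s < t") auto
  qed
  then show ?thesis using t before by blast
qed

text \<open>A visit before \<open>a\<close> persists on a short interval to its right, which
  contains a rational time still below \<open>a\<close>. The strict inequality leaves the room for
  this and turns the event into a countable union.\<close>

lemma hit_less_rat:
  assumes x: "x \<in> paths S"
  shows "hit B x < ereal a \<longleftrightarrow> (\<exists>r\<in>\<rat>. 0 \<le> r \<and> r < a \<and> x r \<in> B)"
proof
  assume "hit B x < ereal a"
  then obtain s where s: "s \<ge> 0" "s < a" "x s \<in> B" by (auto simp: hit_less_iff)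
  obtain e where e: "e > 0" "\<And>r. s \<le> r \<Longrightarrow> r < s + e \<Longrightarrow> x r = x s"
    using paths_right_constant[OF x s(1)] by blast
  obtain r where "r \<in> \<rat>" "s < r" "r < min a (s + e)"
    using Rats_dense_in_real[of s "min a (s+e)"] s(2) e(1) by auto
  then show "\<exists>r\<in>\<rat>. 0 \<le> r \<and> r < a \<and> x r \<in> B"
    using s(1,3) e(2)[of r] by (intro bexI[of _ r]) auto
qed (auto simp: hit_less_iff)

lemma measurable_path_event [measurable]:
  "0 \<le> t \<Longrightarrow> {x\<in>paths S. x t \<in> B} \<in> sets (path_algebra S)"
  using measurable_sets[OF measurable_path_eval_UNIV, of t B S]
  by (simp add: vimage_def Int_def conj_commute)

lemma measurable_hit: "hit B \<in> borel_measurable (path_algebra S)"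
proof (rule borel_measurableI_less)
  fix a
  show "{w \<in> space (path_algebra S). hit B w < a} \<in> sets (path_algebra S)"
  proof (cases a)
    case (real r)
    have "{w \<in> space (path_algebra S). hit B w < a} =
        (\<Union>s\<in>{s\<in>\<rat>. 0 \<le> s \<and> s < r}. {w\<in>paths S. w s \<in> B})"
      using hit_less_rat[of _ S B r] by (auto simp: real)
    also have "\<dots> \<in> sets (path_algebra S)"
      by (intro sets.countable_UN'' countable_subset[OF _ countable_rat]) auto
    finally show ?thesis .
  next
    case PInf
    have "{w \<in> space (path_algebra S). hit B w < a} =
        (\<Union>s\<in>{s\<in>\<rat>. 0 \<le> s}. {w\<in>paths S. w s \<in> B})"
    proof safe
      fix w assume w: "w \<in> space (path_algebra S)" "hit B w < a"
      then obtain s where "0 \<le> s" "w s \<in> B" by (auto simp only: hit_less_iff)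
      then have "hit B w < ereal (s + 1)" unfolding hit_less_iff by (intro exI[of _ s]) auto
      then show "w \<in> (\<Union>s\<in>{s\<in>\<rat>. 0 \<le> s}. {w\<in>paths S. w s \<in> B})"
        using hit_less_rat[of w S B] w by auto
    next
      fix w s assume "w \<in> paths S" "0 \<le> s" "w s \<in> B"
      then show "hit B w < a" using hit_le[of s w B] by (auto simp: PInf less_top intro: le_less_trans)
    qed auto
    also have "\<dots> \<in> sets (path_algebra S)"
      by (intro sets.countable_UN'' countable_subset[OF _ countable_rat]) auto
    finally show ?thesis .
  next
    case MInf
    then show ?thesis by auto
  qed
qed


section \<open>Jump times and current holding time of a path\<close>

lemma jump_time_nonneg: "0 \<le> jump_time x n"
proof (induction n)
  case (Suc n)
  then show ?case
    by (auto intro!: Inf_greatest intro: order_trans)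
qed simp

lemma jump_time_1: "jump_time x (Suc 0) = hit (- {x 0}) x"
  by (simp add: hit_def)

lemma jump_time_Suc_infinity: "jump_time x n = \<infinity> \<Longrightarrow> jump_time x (Suc n) = \<infinity>"
proof -
  assume "jump_time x n = \<infinity>"
  then have "{ereal s | s. jump_time x n \<le> ereal s \<and> x s \<noteq> x (real_of_ereal (jump_time x n))} = {}"
    by simp
  then show ?thesis by (simp only: jump_time.simps(2) Inf_empty) (simp add: top_ereal_def)
qed

lemma jump_time_Suc:
  assumes x: "x \<in> paths S" and t: "jump_time x n = ereal t"
  shows "jump_time x (Suc n) = ereal t + hit (- {x t}) (time_shift t x)"
proof -
  have t0: "0 \<le> t" using jump_time_nonneg[of x n] t by simp
  have eq: "jump_time x (Suc n) = Inf {ereal s | s. t \<le> s \<and> x s \<noteq> x t}"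
    using t by simp
  show ?thesis unfolding eq
  proof (rule antisym)
    show "ereal t + hit (- {x t}) (time_shift t x) \<le> Inf {ereal s | s. t \<le> s \<and> x s \<noteq> x t}"
    proof (rule Inf_greatest, safe)
      fix s assume s: "t \<le> s" "x s \<noteq> x t"
      then have "hit (- {x t}) (time_shift t x) \<le> ereal (s - t)"
        by (intro hit_le) (auto simp: time_shift_apply)
      then have "ereal t + hit (- {x t}) (time_shift t x) \<le> ereal t + ereal (s - t)"
        by (rule add_left_mono)
      then show "ereal t + hit (- {x t}) (time_shift t x) \<le> ereal s" by simp
    qed
    show "Inf {ereal s | s. t \<le> s \<and> x s \<noteq> x t} \<le> ereal t + hit (- {x t}) (time_shift t x)"
    proof (cases "hit (- {x t}) (time_shift t x) < \<infinity>")
      case True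
      from hit_attained[OF time_shift_paths[OF x t0] True] obtain s where
        "0 \<le> s" "hit (- {x t}) (time_shift t x) = ereal s" "time_shift t x s \<in> - {x t}" by blast
      then have "ereal t + hit (- {x t}) (time_shift t x) = ereal (t + s)" "t \<le> t + s" "x (t + s) \<noteq> x t"
        by (simp_all add: time_shift_apply)
      then show ?thesis by (intro Inf_lower) blast
    qed auto
  qed
qed

lemma visited_0 [simp]: "visited x 0 = x 0"
  by (simp add: visited_def zero_ereal_def[symmetric])

lemma holding_0: "holding x 0 = jump_time x (Suc 0)"
  by (simp add: holding_def del: jump_time.simps(2))

context
  fixes S x t
  assumes x: "x \<in> paths S" and t: "jump_time x (Suc 0) = ereal t"
begin

lemma first_jump_nonneg: "0 \<le> t"
  using jump_time_nonneg[of x "Suc 0"] unfolding t by simp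

text \<open>Renewal at the first jump: the path started there has the same later jump times, counted
  from its own origin. All inductions on the number of jumps remove the first jump by means of this
  fact.\<close>

lemma jump_time_time_shift: "jump_time x (Suc n) = ereal t + jump_time (time_shift t x) n"
proof -
  define y where "y = time_shift t x"
  have y: "y \<in> paths S" unfolding y_def by (rule time_shift_paths[OF x first_jump_nonneg])
  have "jump_time x (Suc n) = ereal t + jump_time y n"
  proof (induction n)
    case 0
    then show ?case using t by (simp del: jump_time.simps(2))
  next
    case (Suc n)
    show ?case
    proof (cases "jump_time y n")
      case (real s)
      have "jump_time x (Suc n) = ereal (t + s)" using Suc real by simp
      note jump_time_Suc[OF x this]
      moreover have "x (t + s) = y s" "time_shift (t + s) x = time_shift s y"
        by (simp_all add: y_def time_shift_time_shift time_shift_apply)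
      ultimately have "jump_time x (Suc (Suc n)) = ereal (t + s) + hit (- {y s}) (time_shift s y)"
        by simp
      then show ?thesis unfolding jump_time_Suc[OF y real]
        by (simp only: plus_ereal.simps(1)[symmetric] add.assoc)
    next
      case PInf
      then show ?thesis using Suc by (simp add: jump_time_Suc_infinity del: jump_time.simps(2))
    next
      case MInf
      then show ?thesis using jump_time_nonneg[of y n] by simp
    qed
  qed
  then show ?thesis by (simp only: y_def)
qed

text \<open>Finiteness is essential: at jump time \<infinity>, \<open>visited\<close> reads the path
  at \<open>real_of_ereal \<infinity> = 0\<close>, that is, at its start, and the starts of
  \<open>x\<close> and of the shifted path are different states.\<close>

lemma visited_time_shift:
  assumes "jump_time (time_shift t x) n < \<infinity>"
  shows "visited x (Suc n) = visited (time_shift t x) n"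
proof -
  from assms jump_time_nonneg[of "time_shift t x" n]
  obtain s where "jump_time (time_shift t x) n = ereal s"
    by (cases "jump_time (time_shift t x) n") auto
  then show ?thesis
    by (simp add: visited_def jump_time_time_shift time_shift_apply del: jump_time.simps(2))
qed

lemma holding_time_shift: "holding x (Suc n) = holding (time_shift t x) n"
  using jump_time_nonneg[of "time_shift t x" n] jump_time_nonneg[of "time_shift t x" "Suc n"]
  unfolding holding_def jump_time_time_shift
  by (cases "jump_time (time_shift t x) n"; cases "jump_time (time_shift t x) (Suc n)")
    (simp_all del: jump_time.simps(2))

end

lemma measurable_jump_time [measurable]:
  "(\<lambda>x. jump_time x n) \<in> borel_measurable (path_algebra S)"
proof (induction n)
  case (Suc n)
  define T where "T x = real_of_ereal (jump_time x n)" for x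
  have T: "T \<in> borel_measurable (path_algebra S)" "\<And>x. 0 \<le> T x"
    unfolding T_def using Suc jump_time_nonneg by (auto simp: real_of_ereal_pos)
  have id: "(\<lambda>x. x) \<in> path_algebra S \<rightarrow>\<^sub>M path_algebra S" by simp
  \<comment> \<open>The set to be hit depends on the path through \<open>x (T x)\<close>; freezing
    this state at each of its countably many values reduces the claim to a fixed set.\<close>
  have "(\<lambda>x. hit (- {x (T x)}) (time_shift (T x) x)) \<in> borel_measurable (path_algebra S)"
    by (rule measurable_compose_countable[where f="\<lambda>k x. hit (- {k}) (time_shift (T x) x)"])
      (auto intro!: measurable_compose[OF measurable_time_shift_random[where S=S] measurable_hit]
        measurable_eval_random[OF id] T)
  then have "(\<lambda>x. if jump_time x n = \<infinity> then \<infinity> else jump_time x n + hit (- {x (T x)}) (time_shift (T x) x))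
      \<in> borel_measurable (path_algebra S)"
    using Suc by measurable
  also have "?this \<longleftrightarrow> ?case"
  proof (rule measurable_cong)
    fix x assume x: "x \<in> space (path_algebra S)"
    show "(if jump_time x n = \<infinity> then \<infinity> else jump_time x n + hit (- {x (T x)}) (time_shift (T x) x))
        = jump_time x (Suc n)"
      using jump_time_Suc[of x S n "T x"] x jump_time_nonneg[of x n]
      by (cases "jump_time x n") (auto simp: T_def jump_time_Suc_infinity simp del: jump_time.simps(2))
  qed
  finally show ?case .
qed simp

lemma measurable_visited [measurable]:
  "(\<lambda>x. visited x n) \<in> path_algebra S \<rightarrow>\<^sub>M count_space UNIV"
  unfolding visited_def
  by (intro measurable_eval_random[where S=S]) (auto simp: real_of_ereal_pos jump_time_nonneg)

lemma measurable_holding [measurable]: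
  "(\<lambda>x. holding x n) \<in> borel_measurable (path_algebra S)"
  unfolding holding_def by measurable

lemma sets_image_ereal [measurable]:
  assumes "A \<in> sets borel" shows "ereal ` A \<in> sets borel"
proof -
  have "ereal ` A = real_of_ereal -` A \<inter> space borel \<inter> (- {\<infinity>, -\<infinity>})"
  proof (intro set_eqI iffI)
    fix y assume "y \<in> real_of_ereal -` A \<inter> space borel \<inter> (- {\<infinity>, -\<infinity>})"
    then show "y \<in> ereal ` A" by (cases y) auto
  qed auto
  also have "\<dots> \<in> sets borel"
    using assms by (intro sets.Int measurable_sets[OF borel_measurable_real_of_ereal]) auto
  finally show ?thesis .
qed


section \<open>The age in 0 and the killing time\<close>

text \<open>A real number in place of the optional holding time: \<open>None\<close> becomes 0,
  which lies below the threshold 1, so \<open>tau\<close> can be read off \<open>age\<close>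
  alone.\<close>

definition age :: "real \<Rightarrow> (real \<Rightarrow> nat) \<Rightarrow> real \<Rightarrow> real" where
  "age u x t = snd (Xhat u x t)"

lemma age_eq:
  "age u x t = (if x t \<noteq> 0 then 0 else if \<forall>s\<in>{0..t}. x s = 0 then u + t
    else t - Inf {r\<in>{0..t}. \<forall>s\<in>{r..t}. x s = 0})"
  by (simp add: age_def Xhat_def current_holding_def)

lemma Xhat_eq: "Xhat u x t = (x t, age u x t)"
  by (simp add: age_def Xhat_def)

lemma age_nonzero: "x t \<noteq> 0 \<Longrightarrow> age u x t = 0"
  by (simp add: age_eq)

lemma age_nonneg:
  assumes "0 \<le> u" "0 \<le> t" shows "0 \<le> age u x t"
proof -
  have "Inf {r\<in>{0..t}. \<forall>s\<in>{r..t}. x s = 0} \<le> t" if "x t = 0"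
    using that assms by (intro cInf_lower) (auto intro!: bdd_belowI[of _ 0])
  then show ?thesis using assms by (auto simp: age_eq)
qed

lemma age_le:
  assumes "x 0 \<noteq> 0" "0 \<le> t" shows "age u x t \<le> t"
proof -
  have "0 \<le> Inf {r\<in>{0..t}. \<forall>s\<in>{r..t}. x s = 0}" if "x t = 0"
    using that assms by (intro cInf_greatest) auto
  moreover have "\<not> (\<forall>s\<in>{0..t}. x s = 0)" using assms by auto
  ultimately show ?thesis using assms by (auto simp: age_eq)
qed

lemma age_0: "age u x 0 = (if x 0 = 0 then u else 0)"
  by (auto simp: age_eq)

text \<open>The age at time \<open>t\<close> is all that the clock remembers of the past. If the
  path is in 0 throughout from \<open>t\<close> to \<open>t + s\<close>, the current spell may reach
  back before \<open>t\<close>, and the shifted clock continues from the age at \<open>t\<close>.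
  Otherwise the current spell began after \<open>t\<close>, and its start is found from the shifted
  path alone.\<close>

lemma age_time_shift:
  assumes t: "0 \<le> t" and s: "0 \<le> s"
  shows "age u x (t + s) = age (age u x t) (time_shift t x) s"
proof (cases "x (t + s) = 0")
  case False
  then show ?thesis by (simp add: age_nonzero time_shift_apply)
next
  case zero: True
  let ?A = "{r\<in>{0..t+s}. \<forall>v\<in>{r..t+s}. x v = 0}"
  show ?thesis
  proof (cases "\<forall>v\<in>{0..s}. x (t + v) = 0")
    case True
    have on: "x v = 0" if "t \<le> v" "v \<le> t + s" for v
      using True[rule_format, of "v - t"] that by simp
    have xt: "x t = 0" using on[of t] s by simp
    have R: "age (age u x t) (time_shift t x) s = age u x t + s"
      using True zero by (simp add: age_eq[of "age u x t"] time_shift_apply)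
    show ?thesis
    proof (cases "\<forall>v\<in>{0..t}. x v = 0")
      case all: True
      have "\<forall>v\<in>{0..t+s}. x v = 0"
      proof
        fix v assume "v \<in> {0..t+s}"
        then show "x v = 0" using all on[of v] by (cases "v \<le> t") auto
      qed
      then show ?thesis using R all xt zero by (simp add: age_eq[of u])
    next
      case notall: False
      then have notall': "\<not> (\<forall>v\<in>{0..t+s}. x v = 0)" using s by auto
      let ?B = "{r\<in>{0..t}. \<forall>v\<in>{r..t}. x v = 0}"
      have tB: "t \<in> ?B" using xt t by auto
      have "Inf ?A = Inf ?B"
      proof (rule antisym)
        have "?B \<subseteq> ?A"
        proof safe
          fix r v assume "r \<in> {0..t}" "\<forall>v\<in>{r..t}. x v = 0" "v \<in> {r..t+s}"
          then show "x v = 0" using on[of v] by (cases "v \<le> t") auto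
        qed (use s in auto)
        then show "Inf ?A \<le> Inf ?B"
          using tB by (intro cInf_superset_mono) (auto intro!: bdd_belowI[of _ 0])
        show "Inf ?B \<le> Inf ?A"
        proof (rule cInf_greatest)
          show "?A \<noteq> {}" using zero t s by auto
          fix r assume r: "r \<in> ?A"
          show "Inf ?B \<le> r"
          proof (cases "r \<le> t")
            case True
            then have "r \<in> ?B" using r s by auto
            then show ?thesis by (intro cInf_lower) (auto intro!: bdd_belowI[of _ 0])
          next
            case False
            have "Inf ?B \<le> t" using tB by (intro cInf_lower) (auto intro!: bdd_belowI[of _ 0])
            then show ?thesis using False by simp
          qed
        qed
      qed
      moreover have "age u x (t + s) = t + s - Inf ?A"
        unfolding age_eq if_not_P[OF notall'] using zero by simp
      moreover have "age u x t = t - Inf ?B"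
        unfolding age_eq if_not_P[OF notall] using xt by simp
      ultimately show ?thesis unfolding R by simp
    qed
  next
    case False
    then obtain v0 where v0: "0 \<le> v0" "v0 \<le> s" "x (t + v0) \<noteq> 0" by auto
    let ?B = "{r\<in>{0..s}. \<forall>v\<in>{r..s}. x (t + v) = 0}"
    have notall': "\<not> (\<forall>v\<in>{0..t+s}. x v = 0)"
      using v0 t by (auto intro!: bexI[of _ "t + v0"])
    have "?A = (\<lambda>r. t + r) ` ?B"
    proof (intro set_eqI iffI)
      fix r assume r: "r \<in> ?A"
      have "t + v0 < r"
      proof (rule ccontr)
        assume "\<not> t + v0 < r"
        then show False using r v0 by auto
      qed
      then have "r - t \<in> ?B" using r v0 by auto
      then show "r \<in> (\<lambda>r. t + r) ` ?B" by (intro image_eqI[of _ _ "r - t"]) auto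
    next
      fix r assume "r \<in> (\<lambda>r. t + r) ` ?B"
      then obtain r' where r': "r = t + r'" "r' \<in> ?B" by auto
      have "x v = 0" if "v \<in> {r..t+s}" for v
        using r' that by (auto dest!: bspec[of _ _ "v - t"])
      then show "r \<in> ?A" using r' t by auto
    qed
    moreover have "Inf ((\<lambda>r. t + r) ` ?B) = t + Inf ?B"
      using s zero by (subst Inf_add_eq) (auto intro!: bdd_belowI[of _ 0])
    ultimately have "Inf ?A = t + Inf ?B" by simp
    moreover have "age u x (t + s) = t + s - Inf ?A"
      unfolding age_eq if_not_P[OF notall'] using zero by simp
    moreover have "age (age u x t) (time_shift t x) s = s - Inf ?B"
      unfolding age_eq time_shift_apply if_not_P[OF False] using zero by simp
    ultimately show ?thesis by simp
  qed
qed

lemma age_constant: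
  assumes "0 \<le> t" "0 \<le> s" "\<And>r. t \<le> r \<Longrightarrow> r \<le> t + s \<Longrightarrow> x r = x t"
  shows "age u x (t + s) = (if x t = 0 then age u x t + s else 0)"
proof (cases "x t = 0")
  case True
  have "x (t + v) = 0" if "0 \<le> v" "v \<le> s" for v using assms(3)[of "t + v"] that True by simp
  then show ?thesis unfolding age_time_shift[OF assms(1,2)]
    using True assms(2) by (simp add: age_eq[of "age u x t"] time_shift_apply)
next
  case False
  moreover have "x (t + s) = x t" using assms(1,2) by (intro assms(3)) auto
  ultimately show ?thesis by (simp add: age_nonzero)
qed

lemma tau_eq: "tau u x = Inf {ereal t | t. 0 \<le> t \<and> 1 \<le> age u x t}"
proof -
  have "(\<exists>h. current_holding u x t = Some h \<and> 1 \<le> h) \<longleftrightarrow> 1 \<le> age u x t" for t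
    by (cases "current_holding u x t") (auto simp: age_def Xhat_def)
  then show ?thesis by (simp add: tau_def)
qed

lemma less_tau_iff:
  assumes x: "x \<in> paths S" and t: "0 \<le> t"
  shows "ereal t < tau u x \<longleftrightarrow> (\<forall>s\<in>{0..t}. age u x s < 1)"
proof
  assume less: "ereal t < tau u x"
  show "\<forall>s\<in>{0..t}. age u x s < 1"
  proof (rule ballI, rule ccontr)
    fix s assume "s \<in> {0..t}" "\<not> age u x s < 1"
    then have "tau u x \<le> ereal s" unfolding tau_eq by (intro Inf_lower) auto
    also have "\<dots> \<le> ereal t" using \<open>s \<in> {0..t}\<close> by simp
    finally show False using less by simp
  qed
next
  assume before: "\<forall>s\<in>{0..t}. age u x s < 1"
  obtain e where e: "e > 0" "\<And>s. t \<le> s \<Longrightarrow> s < t + e \<Longrightarrow> x s = x t"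
    using paths_right_constant[OF x t] by blast
  \<comment> \<open>Before \<open>t + e\<close> the path does not move, and in 0 the age grows at
    unit speed; so it needs a further time \<open>1 - age u x t\<close> to reach the
    threshold.\<close>
  define e' where "e' = min e (1 - age u x t)"
  have e': "0 < e'" "e' \<le> e" "e' \<le> 1 - age u x t" using e(1) before t by (auto simp: e'_def)
  have "ereal (t + e') \<le> tau u x" unfolding tau_eq
  proof (rule Inf_greatest, safe)
    fix s assume s: "0 \<le> s" "1 \<le> age u x s"
    show "ereal (t + e') \<le> ereal s"
    proof (rule ccontr)
      assume "\<not> ereal (t + e') \<le> ereal s"
      then have se: "s < t + e'" by simp
      have st: "t < s"
      proof (rule ccontr)
        assume "\<not> t < s"
        then have "age u x s < 1" using s(1) before by simp
        then show False using s(2) by simp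
      qed
      have c: "x r = x t" if "t \<le> r" "r \<le> t + (s - t)" for r
        using that se e' by (intro e(2)) auto
      have "age u x (t + (s - t)) = (if x t = 0 then age u x t + (s - t) else 0)"
        using st t by (intro age_constant c) simp_all
      then have "age u x s = (if x t = 0 then age u x t + (s - t) else 0)" by simp
      then show False using s(2) se e' by (auto split: if_splits)
    qed
  qed
  moreover have "ereal t < ereal (t + e')" using e'(1) by simp
  ultimately show "ereal t < tau u x" by (rule less_le_trans[rotated])
qed

text \<open>An age of at least 1 at some time before \<open>t\<close> persists, or grows, at a
  rational time shortly afterwards. At the endpoint \<open>t\<close> there is no such room inside
  the interval, hence the separate condition there.\<close>

lemma less_tau_rat:
  assumes x: "x \<in> paths S" and t: "0 \<le> t"
  shows "ereal t < tau u x \<longleftrightarrow> age u x t < 1 \<and> (\<forall>s\<in>{s\<in>\<rat>. 0 \<le> s \<and> s \<le> t}. age u x s < 1)"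
proof
  assume rat: "age u x t < 1 \<and> (\<forall>s\<in>{s\<in>\<rat>. 0 \<le> s \<and> s \<le> t}. age u x s < 1)"
  show "ereal t < tau u x" unfolding less_tau_iff[OF x t]
  proof (rule ballI, rule ccontr)
    fix s assume s: "s \<in> {0..t}" "\<not> age u x s < 1"
    then have st: "0 \<le> s" "s < t" using rat by (auto simp: le_less)
    have xs: "x s = 0" using s age_nonzero[of x s u] by auto
    obtain e where e: "e > 0" "\<And>r. s \<le> r \<Longrightarrow> r < s + e \<Longrightarrow> x r = x s"
      using paths_right_constant[OF x st(1)] by blast
    obtain r where r: "r \<in> \<rat>" "s < r" "r < min t (s + e)"
      using Rats_dense_in_real[of s "min t (s + e)"] st e(1) by auto
    have c: "x v = x s" if "s \<le> v" "v \<le> s + (r - s)" for v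
      using that r by (intro e(2)) auto
    have "age u x (s + (r - s)) = (if x s = 0 then age u x s + (r - s) else 0)"
      using r st(1) by (intro age_constant c) simp_all
    then have "age u x r = age u x s + (r - s)" using xs by simp
    then have "1 \<le> age u x r" using s r by simp
    moreover have "age u x r < 1" using rat r st by auto
    ultimately show False by simp
  qed
next
  assume "ereal t < tau u x"
  then have *: "age u x s < 1" if "0 \<le> s" "s \<le> t" for s
    using that by (simp add: less_tau_iff[OF x t])
  show "age u x t < 1 \<and> (\<forall>s\<in>{s\<in>\<rat>. 0 \<le> s \<and> s \<le> t}. age u x s < 1)"
    using *[OF t] * by blast
qed

lemma tau_eq_infinity_iff:
  assumes x: "x \<in> paths S"
  shows "tau u x = \<infinity> \<longleftrightarrow> (\<forall>t\<ge>0. age u x t < 1)"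
proof
  assume "tau u x = \<infinity>"
  then show "\<forall>t\<ge>0. age u x t < 1" using less_tau_iff[OF x, of _ u] by auto
next
  assume "\<forall>t\<ge>0. age u x t < 1"
  then have empty: "{ereal t | t. 0 \<le> t \<and> 1 \<le> age u x t} = {}" by force
  show "tau u x = \<infinity>" unfolding tau_eq empty by (simp add: top_ereal_def)
qed

lemma tau_eq_infinity_iff_nat: "tau u x = \<infinity> \<longleftrightarrow> (\<forall>n::nat. ereal (real n) < tau u x)"
proof
  assume *: "\<forall>n::nat. ereal (real n) < tau u x"
  show "tau u x = \<infinity>"
  proof (cases "tau u x")
    case (real r)
    obtain n :: nat where "r < n" using reals_Archimedean2 by blast
    then show ?thesis using real * [rule_format, of n] by simp
  qed (use * [rule_format, of 0] in auto)
qed auto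

lemma less_tau_time_shift:
  assumes x: "x \<in> paths S" and t: "0 \<le> t" and s: "0 \<le> s"
  shows "ereal (t + s) < tau u x \<longleftrightarrow> ereal t < tau u x \<and> ereal s < tau (age u x t) (time_shift t x)"
proof -
  have "(\<forall>r\<in>{0..t+s}. age u x r < 1) \<longleftrightarrow>
    (\<forall>r\<in>{0..t}. age u x r < 1) \<and> (\<forall>r\<in>{0..s}. age u x (t + r) < 1)" (is "?L \<longleftrightarrow> ?R")
  proof
    assume L: ?L
    show ?R using L t s by auto
  next
    assume R: ?R
    show ?L
    proof
      fix r assume r: "r \<in> {0..t+s}"
      show "age u x r < 1"
      proof (cases "r \<le> t")
        case True
        then show ?thesis using R r by auto
      next
        case False
        then show ?thesis using R[THEN conjunct2, rule_format, of "r - t"] r by auto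
      qed
    qed
  qed
  then show ?thesis
    using t s by (simp add: less_tau_iff[OF x] less_tau_iff[OF time_shift_paths[OF x t]] age_time_shift)
qed

lemma tau_infinity_time_shift:
  assumes x: "x \<in> paths S" and t: "0 \<le> t"
  shows "tau u x = \<infinity> \<longleftrightarrow> ereal t < tau u x \<and> tau (age u x t) (time_shift t x) = \<infinity>"
proof
  assume inf: "tau u x = \<infinity>"
  have "ereal (real n) < tau (age u x t) (time_shift t x)" for n :: nat
    using less_tau_time_shift[OF x t, of "real n" u] inf by simp
  then show "ereal t < tau u x \<and> tau (age u x t) (time_shift t x) = \<infinity>"
    using inf by (simp add: tau_eq_infinity_iff_nat[of "age u x t"])
next
  assume *: "ereal t < tau u x \<and> tau (age u x t) (time_shift t x) = \<infinity>"
  have "ereal (real n) < tau u x" for n :: nat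
  proof -
    have "ereal (t + real n) < tau u x" using less_tau_time_shift[OF x t, of "real n" u] * by simp
    moreover have "ereal (real n) \<le> ereal (t + real n)" using t by simp
    ultimately show ?thesis by (rule le_less_trans[rotated])
  qed
  then show "tau u x = \<infinity>" by (simp add: tau_eq_infinity_iff_nat[of u])
qed

lemma age_stop:
  assumes "0 \<le> s" "s \<le> t" shows "age u (stop t x) s = age u x s"
proof -
  have "stop t x r = x r" if "r \<le> s" for r using that assms by (simp add: stop_def min_def)
  then have "{r\<in>{0..s}. \<forall>v\<in>{r..s}. stop t x v = 0} = {r\<in>{0..s}. \<forall>v\<in>{r..s}. x v = 0}"
    "(\<forall>v\<in>{0..s}. stop t x v = 0) \<longleftrightarrow> (\<forall>v\<in>{0..s}. x v = 0)" "stop t x s = x s"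
    by auto
  then show ?thesis unfolding age_eq by simp
qed

lemma age_first_zero:
  assumes "0 < t" "\<And>s. 0 \<le> s \<Longrightarrow> s < t \<Longrightarrow> x s \<noteq> 0" "x t = 0"
  shows "age u x t = 0"
proof -
  have "{r\<in>{0..t}. \<forall>s\<in>{r..t}. x s = 0} = {t}" using assms by (force simp: le_less)
  moreover have "\<not> (\<forall>s\<in>{0..t}. x s = 0)" using assms by force
  ultimately show ?thesis using assms(3) unfolding age_eq by (simp only: if_False cInf_singleton) simp
qed

text \<open>At the first jump the age is 0 whichever state is entered, so the survival of the first
  wait and that of the remaining path separate. The bound is not strict: a path that leaves 0
  exactly when its age would become 1 has had only ages below 1.\<close>

lemma tau_infinity_first_jump:
  assumes x: "x \<in> paths S" and J: "jump_time x (Suc 0) = ereal t"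
  shows "tau u x = \<infinity> \<longleftrightarrow> (x 0 = 0 \<longrightarrow> u + t \<le> 1) \<and> tau 0 (time_shift t x) = \<infinity>"
proof -
  have "hit (- {x 0}) x < \<infinity>" using J unfolding jump_time_1 by simp
  from hit_attained[OF x this] obtain t' where
    t': "0 \<le> t'" "hit (- {x 0}) x = ereal t'" "x t' \<in> - {x 0}"
      "\<forall>s. 0 \<le> s \<longrightarrow> s < t' \<longrightarrow> x s \<notin> - {x 0}" by blast
  have "t' = t" using J t'(2) unfolding jump_time_1 by simp
  then have t: "0 \<le> t" "x t \<noteq> x 0" using t'(1,3) by simp_all
  have before: "x s \<notin> - {x 0}" if "0 \<le> s" "s < t" for s
    using \<open>t' = t\<close> t'(4) that by blast
  have t0: "0 < t" using t by (cases "t = 0") auto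
  have age_t: "age u x t = 0"
  proof (cases "x t = 0")
    case True
    have "x s \<noteq> 0" if "0 \<le> s" "s < t" for s
      using before[OF that] t(2) True by simp
    then show ?thesis using True by (intro age_first_zero t0) simp_all
  qed (rule age_nonzero)
  have age_s: "age u x s = (if x 0 = 0 then u + s else 0)" if "0 \<le> s" "s < t" for s
  proof -
    have c: "x r = x 0" if "0 \<le> r" "r \<le> 0 + s" for r
      using before[of r] that \<open>s < t\<close> by simp
    have "age u x (0 + s) = (if x 0 = 0 then age u x 0 + s else 0)"
      using that by (intro age_constant c) simp_all
    then show ?thesis by (simp add: age_0)
  qed
  have "ereal t < tau u x \<longleftrightarrow> (\<forall>s\<in>{0..<t}. age u x s < 1)"
    unfolding less_tau_iff[OF x t(1)] using age_t by (force simp: le_less)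
  also have "\<dots> \<longleftrightarrow> (\<forall>s\<in>{0..<t}. x 0 = 0 \<longrightarrow> u + s < 1)"
    by (intro ball_cong) (auto simp: age_s)
  also have "\<dots> \<longleftrightarrow> (x 0 = 0 \<longrightarrow> u + t \<le> 1)"
  proof
    assume *: "\<forall>s\<in>{0..<t}. x 0 = 0 \<longrightarrow> u + s < 1"
    show "x 0 = 0 \<longrightarrow> u + t \<le> 1"
    proof (rule impI, rule ccontr)
      assume "x 0 = 0" "\<not> u + t \<le> 1"
      \<comment> \<open>At time \<open>max 0 (1 - u)\<close>, which lies before \<open>t\<close>,
        the age is already at least 1; the maximum covers an initial age above 1.\<close>
      then show False using * [rule_format, of "max 0 (1 - u)"] * [rule_format, of 0] t0
        by (auto simp: max_def split: if_splits)
    qed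
  qed auto
  finally show ?thesis using tau_infinity_time_shift[OF x t(1), of u] age_t by simp
qed

text \<open>Before the first visit to 0 the age is 0, and the visit itself begins with age 0; so
  nothing can kill the path before that moment and nothing is carried over it.\<close>

lemma tau_infinity_hit_0:
  assumes x: "x \<in> paths S" and x0: "x 0 \<noteq> 0" and T: "hit {0} x = ereal t"
  shows "tau u x = \<infinity> \<longleftrightarrow> tau 0 (time_shift t x) = \<infinity>"
proof -
  have "hit {0} x < \<infinity>" using T by simp
  from hit_attained[OF x this] T have t: "0 \<le> t" "x t = 0"
    and before: "\<And>s. 0 \<le> s \<Longrightarrow> s < t \<Longrightarrow> x s \<noteq> 0"
    by auto
  have t0: "0 < t" using t x0 by (cases "t = 0") auto
  have age_t: "age u x t = 0" by (rule age_first_zero) (use t0 before t(2) in auto)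
  have "ereal t < tau u x"
    unfolding less_tau_iff[OF x t(1)]
  proof
    fix s assume "s \<in> {0..t}"
    then show "age u x s < 1" using age_t before[of s] age_nonzero[of x s u] by (cases "s = t") auto
  qed
  then show ?thesis using tau_infinity_time_shift[OF x t(1), of u] age_t by simp
qed

lemma tau_infinity_never_0:
  assumes x: "x \<in> paths S" and T: "hit {0} x = \<infinity>"
  shows "tau u x = \<infinity>"
  unfolding tau_eq_infinity_iff[OF x]
proof (intro allI impI)
  fix t :: real assume "0 \<le> t"
  then have "x t \<noteq> 0" using hit_le[of t x "{0}"] T by auto
  then show "age u x t < 1" by (simp add: age_nonzero)
qed

section \<open>Measurability of the age and of the killing time\<close>

text \<open>A condition on uncountably many times becomes one inequality for a hitting time, which
  is known to be measurable.\<close>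

lemma zero_on_iff:
  assumes x: "x \<in> paths S" and r: "0 \<le> r" "r \<le> t"
  shows "(\<forall>s\<in>{r..t}. x s = 0) \<longleftrightarrow> ereal (t - r) < hit (- {0}) (time_shift r x)"
proof
  assume zero: "\<forall>s\<in>{r..t}. x s = 0"
  show "ereal (t - r) < hit (- {0}) (time_shift r x)"
  proof (rule ccontr)
    assume "\<not> ?thesis"
    then have le: "hit (- {0}) (time_shift r x) \<le> ereal (t - r)" by simp
    then have "hit (- {0}) (time_shift r x) < \<infinity>" by (auto simp: less_top[symmetric])
    from hit_attained[OF time_shift_paths[OF x r(1)] this] obtain s where
      "0 \<le> s" "hit (- {0}) (time_shift r x) = ereal s" "time_shift r x s \<in> - {0}" by blast
    then show False using le zero by (auto simp: time_shift_apply)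
  qed
next
  assume less: "ereal (t - r) < hit (- {0}) (time_shift r x)"
  show "\<forall>s\<in>{r..t}. x s = 0"
  proof (rule ballI, rule ccontr)
    fix s assume s: "s \<in> {r..t}" "x s \<noteq> 0"
    then have "hit (- {0}) (time_shift r x) \<le> ereal (s - r)"
      by (intro hit_le) (auto simp: time_shift_apply)
    also have "\<dots> \<le> ereal (t - r)" using s by simp
    finally show False using less by simp
  qed
qed

lemma measurable_zero_on [measurable]:
  assumes r: "0 \<le> r" "r \<le> t"
  shows "Measurable.pred (path_algebra S) (\<lambda>x. \<forall>s\<in>{r..t}. x s = 0)"
proof -
  have "(\<lambda>x. hit (- {0}) (time_shift r x)) \<in> borel_measurable (path_algebra S)"
    by (rule measurable_compose[OF measurable_time_shift[OF r(1)] measurable_hit])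
  then have "Measurable.pred (path_algebra S) (\<lambda>x. ereal (t - r) < hit (- {0}) (time_shift r x))"
    by measurable
  also have "?this \<longleftrightarrow> ?thesis"
    by (rule measurable_cong) (simp add: zero_on_iff[OF _ r])
  finally show ?thesis .
qed

lemma pred_Bex_countable:
  assumes "countable I" "\<And>i. i \<in> I \<Longrightarrow> Measurable.pred M (P i)"
  shows "Measurable.pred M (\<lambda>x. \<exists>i\<in>I. P i x)"
proof -
  have "{x\<in>space M. \<exists>i\<in>I. P i x} = (\<Union>i\<in>I. {x\<in>space M. P i x})" by auto
  also have "\<dots> \<in> sets M" using assms by (intro sets.countable_UN'') (auto simp: pred_def)
  finally show ?thesis by (simp add: pred_def)
qed

lemma pred_Ball_countable:
  assumes "countable I" "\<And>i. i \<in> I \<Longrightarrow> Measurable.pred M (P i)"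
  shows "Measurable.pred M (\<lambda>x. \<forall>i\<in>I. P i x)"
proof -
  have "Measurable.pred M (\<lambda>x. \<exists>i\<in>I. \<not> P i x)"
    using assms by (intro pred_Bex_countable pred_intros_logic) auto
  then have "Measurable.pred M (\<lambda>x. \<not> (\<exists>i\<in>I. \<not> P i x))" by measurable
  then show ?thesis by simp
qed

text \<open>If \<open>r\<close> begins an interval up to \<open>t\<close> spent in 0, then so does
  every later point up to \<open>t\<close>; hence rational \<open>r\<close> decide whether the
  infimum is below \<open>a\<close>. The guard \<open>x t = 0\<close> makes the set nonempty, since
  it then contains \<open>t\<close>.\<close>

lemma measurable_age_aux:
  assumes t: "0 \<le> t"
  shows "(\<lambda>x. if x t = 0 then Inf {r\<in>{0..t}. \<forall>s\<in>{r..t}. x s = 0} else 0)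
    \<in> borel_measurable (path_algebra S)" (is "?g \<in> _")
proof (rule borel_measurableI_less)
  fix a
  let ?P = "\<lambda>r x. \<forall>s\<in>{r..t}. x s = (0::nat)"
  have less: "Inf {r\<in>{0..t}. ?P r x} < a \<longleftrightarrow> t < a \<or> (\<exists>r\<in>{r\<in>\<rat>. 0 \<le> r \<and> r \<le> t \<and> r < a}. ?P r x)"
    if "x t = 0" for x
  proof -
    have ne: "{r\<in>{0..t}. ?P r x} \<noteq> {}" using that t by auto
    have bdd: "bdd_below {r\<in>{0..t}. ?P r x}" by (auto intro!: bdd_belowI[of _ 0])
    have "Inf {r\<in>{0..t}. ?P r x} < a \<longleftrightarrow> (\<exists>r\<in>{r\<in>{0..t}. ?P r x}. r < a)"
      by (rule cInf_less_iff[OF ne bdd])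
    also have "\<dots> \<longleftrightarrow> t < a \<or> (\<exists>r\<in>{r\<in>\<rat>. 0 \<le> r \<and> r \<le> t \<and> r < a}. ?P r x)" (is "?L \<longleftrightarrow> ?R")
    proof
      assume ?L
      then obtain r where r: "0 \<le> r" "r \<le> t" "?P r x" "r < a" by auto
      show ?R
      proof (cases "t < a")
        case False
        obtain r' where "r' \<in> \<rat>" "r < r'" "r' < a"
          using Rats_dense_in_real[OF r(4)] by auto
        then show ?thesis using r False by (intro disjI2 bexI[of _ r']) auto
      qed simp
    next
      assume ?R
      then show ?L using t that by (auto intro!: bexI[of _ t])
    qed
    finally show ?thesis .
  qed
  have [measurable]: "(\<lambda>x. x t) \<in> path_algebra S \<rightarrow>\<^sub>M count_space UNIV"
    using t by (rule measurable_path_eval_UNIV)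
  have "Measurable.pred (path_algebra S) (\<lambda>x. \<exists>r\<in>{r\<in>\<rat>. 0 \<le> r \<and> r \<le> t \<and> r < a}. ?P r x)"
    by (intro pred_Bex_countable countable_subset[OF _ countable_rat] measurable_zero_on) auto
  then have "Measurable.pred (path_algebra S) (\<lambda>x. if x t = 0 then t < a \<or>
      (\<exists>r\<in>{r\<in>\<rat>. 0 \<le> r \<and> r \<le> t \<and> r < a}. ?P r x) else 0 < a)"
    by measurable
  also have "(\<lambda>x. if x t = 0 then t < a \<or>
      (\<exists>r\<in>{r\<in>\<rat>. 0 \<le> r \<and> r \<le> t \<and> r < a}. ?P r x) else 0 < a) = (\<lambda>x. ?g x < a)"
  proof (rule ext)
    fix x
    show "(if x t = 0 then t < a \<or> (\<exists>r\<in>{r\<in>\<rat>. 0 \<le> r \<and> r \<le> t \<and> r < a}. ?P r x) else 0 < a) = (?g x < a)"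
    proof (cases "x t = 0")
      case True
      show ?thesis unfolding if_P[OF True] by (rule less[of x, OF True, symmetric])
    next
      case False
      show ?thesis unfolding if_not_P[OF False] by (rule refl)
    qed
  qed
  finally show "{x \<in> space (path_algebra S). ?g x < a} \<in> sets (path_algebra S)"
    by (simp add: pred_def)
qed

text \<open>Joint measurability in the initial age is required because, after a restart at time
  \<open>t\<close>, the initial age is the random age reached by then.\<close>

lemma measurable_age:
  assumes t: "0 \<le> t"
  shows "(\<lambda>(u, x). age u x t) \<in> borel_measurable (borel \<Otimes>\<^sub>M path_algebra S)"
proof -
  have [measurable]: "(\<lambda>x. x t) \<in> path_algebra S \<rightarrow>\<^sub>M count_space UNIV"
    using t by (rule measurable_path_eval_UNIV)
  note measurable_age_aux[OF t, measurable]
  have [measurable]: "Measurable.pred (path_algebra S) (\<lambda>x. \<forall>s\<in>{0..t}. x s = 0)"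
    using t by (intro measurable_zero_on) auto
  have "(\<lambda>p. if snd p t \<noteq> 0 then 0 else if \<forall>s\<in>{0..t}. snd p s = 0 then fst p + t
      else t - (if snd p t = 0 then Inf {r\<in>{0..t}. \<forall>s\<in>{r..t}. snd p s = 0} else 0))
    \<in> borel_measurable (borel \<Otimes>\<^sub>M path_algebra S)"
    by measurable
  then show ?thesis
    by (simp add: age_eq case_prod_beta cong: if_cong)
qed

lemma measurable_less_tau:
  assumes t: "0 \<le> t"
  shows "Measurable.pred (borel \<Otimes>\<^sub>M path_algebra S) (\<lambda>(u, x). ereal t < tau u x)"
proof -
  have [measurable]: "Measurable.pred (borel \<Otimes>\<^sub>M path_algebra S) (\<lambda>p. age (fst p) (snd p) s < 1)"
    if "0 \<le> s" for s
    using measurable_age[OF that, of S] unfolding case_prod_beta by measurable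
  have "Measurable.pred (borel \<Otimes>\<^sub>M path_algebra S)
      (\<lambda>p. \<forall>s\<in>{s\<in>\<rat>. 0 \<le> s \<and> s \<le> t}. age (fst p) (snd p) s < 1)"
    by (intro pred_Ball_countable countable_subset[OF _ countable_rat]) auto
  then have "Measurable.pred (borel \<Otimes>\<^sub>M path_algebra S) (\<lambda>p. age (fst p) (snd p) t < 1 \<and>
      (\<forall>s\<in>{s\<in>\<rat>. 0 \<le> s \<and> s \<le> t}. age (fst p) (snd p) s < 1))"
    using t by measurable
  also have "?this \<longleftrightarrow> ?thesis"
    by (rule measurable_cong) (auto simp: space_pair_measure less_tau_rat[OF _ t])
  finally show ?thesis .
qed

lemma measurable_tau_infinity:
  "Measurable.pred (borel \<Otimes>\<^sub>M path_algebra S) (\<lambda>(u, x). tau u x = \<infinity>)"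
proof -
  have [measurable]: "Measurable.pred (borel \<Otimes>\<^sub>M path_algebra S) (\<lambda>(u, x). ereal (real n) < tau u x)"
    for n :: nat by (rule measurable_less_tau) simp
  have "Measurable.pred (borel \<Otimes>\<^sub>M path_algebra S) (\<lambda>p. \<forall>n::nat. (\<lambda>(u, x). ereal (real n) < tau u x) p)"
    by measurable
  then show ?thesis by (simp add: tau_eq_infinity_iff_nat case_prod_beta)
qed


section \<open>The law of the chain on path space\<close>

text \<open>A path functional is measurable with respect to \<open>past S t\<close> as soon as it does not change
  when the path is stopped at \<open>t\<close>.\<close>

definition past :: "nat set \<Rightarrow> real \<Rightarrow> (real \<Rightarrow> nat) measure" where
  "past S t = vimage_algebra (paths S) (stop t) (path_algebra S)"

lemma space_past [simp]: "space (past S t) = paths S"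
  by (simp add: past_def)

lemma sets_past:
  "0 \<le> t \<Longrightarrow> sets (past S t) = {stop t -` A \<inter> paths S | A. A \<in> sets (path_algebra S)}"
  unfolding past_def by (rule sets_vimage_algebra2) (auto intro: stop_paths)

lemma stop_eval: "s \<le> t \<Longrightarrow> stop t x s = x s"
  by (simp add: stop_def min_def)

lemma stop_stop: "stop t (stop s x) = stop (min t s) x"
  by (simp add: stop_def min.assoc)

lemma measurable_stop_past:
  assumes "0 \<le> t" shows "stop t \<in> past S t \<rightarrow>\<^sub>M path_algebra S"
  unfolding past_def by (rule measurable_vimage_algebra1) (use assms in \<open>auto intro: stop_paths\<close>)

lemma measurable_pastI:
  assumes "0 \<le> t" "f \<in> path_algebra S \<rightarrow>\<^sub>M N" "\<And>x. x \<in> paths S \<Longrightarrow> f (stop t x) = f x"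
  shows "f \<in> past S t \<rightarrow>\<^sub>M N"
proof -
  have "(\<lambda>x. f (stop t x)) \<in> past S t \<rightarrow>\<^sub>M N"
    by (rule measurable_compose[OF measurable_stop_past[OF assms(1)] assms(2)])
  also have "?this \<longleftrightarrow> ?thesis" by (rule measurable_cong) (simp add: assms(3))
  finally show ?thesis .
qed

lemma measurable_past_eval:
  assumes "0 \<le> s" "s \<le> t"
  shows "(\<lambda>x. x s) \<in> past S t \<rightarrow>\<^sub>M count_space UNIV"
  using assms by (intro measurable_pastI[OF _ measurable_path_eval_UNIV]) (auto simp: stop_eval)

lemma sets_past_event:
  assumes "0 \<le> s" "s \<le> t"
  shows "{x\<in>paths S. x s \<in> B} \<in> sets (past S t)"
  using measurable_sets[OF measurable_past_eval[OF assms], of B S]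
  by (simp add: vimage_def Int_def conj_commute)

lemma measurable_stop:
  assumes "0 \<le> t" shows "stop t \<in> path_algebra S \<rightarrow>\<^sub>M path_algebra S"
proof (rule measurable_path_algebraI)
  fix s j assume "0 \<le> (s::real)"
  then have "{x\<in>paths S. x (min s t) \<in> {j}} \<in> sets (path_algebra S)"
    using assms by (intro measurable_path_event) auto
  then show "{x \<in> space (path_algebra S). stop t x s = j} \<in> sets (path_algebra S)"
    by (simp add: stop_def)
qed (use assms in \<open>auto intro: stop_paths\<close>)

lemma measurable_past_mono:
  assumes "0 \<le> s" "s \<le> t" shows "(\<lambda>x. x) \<in> past S t \<rightarrow>\<^sub>M past S s"
  unfolding past_def
proof (rule measurable_vimage_algebra2)
  show "(\<lambda>x. stop s x) \<in> vimage_algebra (paths S) (stop t) (path_algebra S) \<rightarrow>\<^sub>M path_algebra S"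
    using measurable_pastI[of t "stop s" S "path_algebra S"] assms
    by (auto simp: past_def[symmetric] stop_stop min_def measurable_stop)
qed auto

lemma sets_past_mono:
  assumes "0 \<le> s" "s \<le> t" "A \<in> sets (past S s)" shows "A \<in> sets (past S t)"
  using measurable_sets[OF measurable_past_mono[OF assms(1,2)] assms(3)]
    sets.sets_into_space[OF assms(3)] by (simp add: Int_absorb2)

lemma measurable_ident_past:
  assumes "0 \<le> t" shows "(\<lambda>x. x) \<in> path_algebra S \<rightarrow>\<^sub>M past S t"
  unfolding past_def by (rule measurable_vimage_algebra2) (use assms in \<open>auto intro: measurable_stop\<close>)

lemma sets_past_path:
  assumes "0 \<le> t" "A \<in> sets (past S t)" shows "A \<in> sets (path_algebra S)"
  using measurable_sets[OF measurable_ident_past[OF assms(1)] assms(2)]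
    sets.sets_into_space[OF assms(2)] by (simp add: Int_absorb2)

text \<open>For fixed \<open>A\<close> this exhibits the map taking \<open>G\<close> to the mass of
  \<open>A\<close> and \<open>f\<close> in \<open>G\<close> as a measure, so that identities in
  \<open>G\<close> fall under uniqueness of measures.\<close>

lemma emeasure_distr_restricted:
  assumes f: "f \<in> M \<rightarrow>\<^sub>M N" and A: "A \<in> sets M" and G: "G \<in> sets N"
  shows "emeasure (distr (density M (indicator A)) N f) G = emeasure M (A \<inter> (f -` G \<inter> space M))"
proof -
  have V: "f -` G \<inter> space M \<in> sets M" by (rule measurable_sets[OF f G])
  have "emeasure (distr (density M (indicator A)) N f) G =
      emeasure (density M (indicator A)) (f -` G \<inter> space M)"
    using f G by (subst emeasure_distr) (simp_all cong: measurable_cong_sets)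
  also have "\<dots> = (\<integral>\<^sup>+x. indicator A x * indicator (f -` G \<inter> space M) x \<partial>M)"
    using A V by (intro emeasure_density) auto
  also have "\<dots> = (\<integral>\<^sup>+x. indicator (A \<inter> (f -` G \<inter> space M)) x \<partial>M)"
    by (simp only: indicator_inter_arith)
  also have "\<dots> = emeasure M (A \<inter> (f -` G \<inter> space M))"
    using A V by (intro nn_integral_indicator) auto
  finally show ?thesis .
qed


context nonexplosive_ctmc
begin

definition sample_path :: "'w \<Rightarrow> real \<Rightarrow> nat" where
  "sample_path \<omega> = (\<lambda>s. X s \<omega>)"

definition path_law :: "nat \<Rightarrow> (real \<Rightarrow> nat) measure" where
  "path_law i = distr (P i) (path_algebra S) sample_path"

lemma zero_state: "0 \<in> S"
  using state_space by auto

lemma space_P: "i \<in> S \<Longrightarrow> space (P i) = space (P 0)"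
  by (rule sets_eq_imp_space_eq[OF sets_P])

lemma prob_space_P: "i \<in> S \<Longrightarrow> prob_space (P i)"
  using markov by (auto simp: markov_from_def)

lemma measurable_X: "i \<in> S \<Longrightarrow> 0 \<le> t \<Longrightarrow> X t \<in> P i \<rightarrow>\<^sub>M count_space S"
  using markov by (auto simp: markov_from_def)

lemma sample_path_paths: "\<omega> \<in> space (P 0) \<Longrightarrow> sample_path \<omega> \<in> paths S"
  using measurable_X[OF zero_state] right_continuous
  by (auto simp: paths_def sample_path_def measurable_def)

lemma measurable_sample_path: "i \<in> S \<Longrightarrow> sample_path \<in> P i \<rightarrow>\<^sub>M path_algebra S"
proof (rule measurable_path_algebraI)
  fix t j assume i: "i \<in> S" and t: "0 \<le> (t::real)"
  have "X t -` ({j} \<inter> S) \<inter> space (P i) \<in> sets (P i)"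
    by (rule measurable_sets[OF measurable_X[OF i t]]) auto
  also have "X t -` ({j} \<inter> S) \<inter> space (P i) = {\<omega> \<in> space (P i). sample_path \<omega> t = j}"
    using measurable_space[OF measurable_X[OF i t]] by (auto simp: sample_path_def)
  finally show "{\<omega> \<in> space (P i). sample_path \<omega> t = j} \<in> sets (P i)" .
qed (simp add: sample_path_paths space_P)

lemma sets_path_law [simp, measurable_cong]: "sets (path_law i) = sets (path_algebra S)"
  by (simp add: path_law_def)

lemma space_path_law [simp]: "space (path_law i) = paths S"
  by (simp add: path_law_def)

lemma prob_space_path_law: "i \<in> S \<Longrightarrow> prob_space (path_law i)"
  unfolding path_law_def by (rule prob_space.prob_space_distr[OF prob_space_P measurable_sample_path])

lemma emeasure_path_law:
  assumes "i \<in> S" "A \<in> sets (path_algebra S)"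
  shows "emeasure (path_law i) A = emeasure (P i) {\<omega>\<in>space (P i). sample_path \<omega> \<in> A}"
  unfolding path_law_def using assms
  by (subst emeasure_distr) (auto intro!: measurable_sample_path arg_cong2[where f=emeasure])

lemma measure_path_law:
  assumes "i \<in> S" "A \<in> sets (path_algebra S)"
  shows "measure (path_law i) A = measure (P i) {\<omega>\<in>space (P i). sample_path \<omega> \<in> A}"
  using emeasure_path_law[OF assms] by (simp add: measure_def)

lemma AE_path_law_start: "i \<in> S \<Longrightarrow> AE x in path_law i. x 0 = i"
proof -
  assume i: "i \<in> S"
  have "AE \<omega> in P i. X 0 \<omega> = i" using markov[OF i] by (simp add: markov_from_def)
  moreover have "{x \<in> space (path_algebra S). x 0 = i} \<in> sets (path_algebra S)"
    using measurable_path_event[of 0 S "{i}"] by simp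
  ultimately show ?thesis
    unfolding path_law_def using i
    by (subst AE_distr_iff) (auto intro: measurable_sample_path simp: sample_path_def)
qed

section \<open>The Markov property for path events\<close>

lemma measurable_path_law_kernel: "path_law \<in> count_space S \<rightarrow>\<^sub>M prob_algebra (path_algebra S)"
  by (auto simp: space_prob_algebra prob_space_path_law)

lemma measurable_path_law_eval:
  assumes "0 \<le> t"
  shows "(\<lambda>x. path_law (x t)) \<in> path_algebra S \<rightarrow>\<^sub>M prob_algebra (path_algebra S)"
  by (rule measurable_compose[OF measurable_path_eval[OF assms] measurable_path_law_kernel])

text \<open>The Markov clause of \<open>markov_from\<close> accepts only events of the generated
  history of \<open>X\<close>; this carries events of the path past into it. The stopped path uses
  coordinates up to \<open>t\<close> only.\<close>

lemma sample_path_history: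
  assumes i: "i \<in> S" and t: "0 \<le> t" and A: "A \<in> sets (past S t)"
  shows "{\<omega>\<in>space (P i). sample_path \<omega> \<in> A} \<in> sets (history (space (P i)) (count_space S) X t)"
proof -
  have gen: "(\<Union>s\<in>{0..t}. {X s -` B \<inter> space (P i) | B. B \<in> sets (count_space S)}) \<subseteq> Pow (space (P i))"
    by auto
  have sp: "space (history (space (P i)) (count_space S) X t) = space (P i)"
    unfolding history_def by (rule space_measure_of[OF gen])
  have "(\<lambda>\<omega>. stop t (sample_path \<omega>)) \<in> history (space (P i)) (count_space S) X t \<rightarrow>\<^sub>M path_algebra S"
  proof (rule measurable_path_algebraI)
    fix \<omega> assume "\<omega> \<in> space (history (space (P i)) (count_space S) X t)"
    then have "\<omega> \<in> space (P 0)" unfolding sp by (simp add: space_P[OF i])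
    then show "stop t (sample_path \<omega>) \<in> paths S"
      by (intro stop_paths sample_path_paths t)
  next
    fix s j assume s: "0 \<le> (s::real)"
    let ?r = "min s t"
    have r: "0 \<le> ?r" "?r \<in> {0..t}" using s t by auto
    have "X ?r -` ({j} \<inter> S) \<inter> space (P i) \<in> sets (history (space (P i)) (count_space S) X t)"
      unfolding history_def sets_measure_of[OF gen]
      by (rule sigma_sets.Basic, rule UN_I[OF r(2)]) auto
    also have "X ?r -` ({j} \<inter> S) \<inter> space (P i) =
        {\<omega> \<in> space (history (space (P i)) (count_space S) X t). stop t (sample_path \<omega>) s = j}"
      using measurable_space[OF measurable_X[OF i r(1)]] unfolding sp
      by (auto simp: stop_def sample_path_def)
    finally show "{\<omega> \<in> space (history (space (P i)) (count_space S) X t). stop t (sample_path \<omega>) s = j}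
      \<in> sets (history (space (P i)) (count_space S) X t)" .
  qed
  moreover obtain A' where A': "A' \<in> sets (path_algebra S)" "A = stop t -` A' \<inter> paths S"
    using A sets_past[OF t] by auto
  ultimately have "(\<lambda>\<omega>. stop t (sample_path \<omega>)) -` A' \<inter> space (P i)
      \<in> sets (history (space (P i)) (count_space S) X t)"
    using measurable_sets sp by metis
  also have "(\<lambda>\<omega>. stop t (sample_path \<omega>)) -` A' \<inter> space (P i) = {\<omega>\<in>space (P i). sample_path \<omega> \<in> A}"
    using i sample_path_paths by (auto simp: A'(2) space_P)
  finally show ?thesis .
qed

text \<open>The one place where the Markov clause of the assumption enters. On the abstract space
  the singleton is cut down to \<open>{j} \<inter> S\<close>, so that it is an event of
  \<open>count_space S\<close> for every \<open>j\<close>.\<close>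

lemma markov_one_step:
  assumes i: "i \<in> S" and t: "0 \<le> t" and s: "0 \<le> s" and A: "A \<in> sets (past S t)"
  shows "emeasure (path_law i) {x\<in>A. x (t + s) = j}
    = (\<integral>\<^sup>+x\<in>A. emeasure (path_law (x t)) {y\<in>paths S. y s = j} \<partial>path_law i)"
proof -
  have A': "A \<in> sets (path_algebra S)" by (rule sets_past_path[OF t A])
  note AS = sets.sets_into_space[OF A']
  have M: "emeasure (P i) {\<omega>\<in>E. X (t + s) \<omega> \<in> B} =
      (\<integral>\<^sup>+\<omega>\<in>E. emeasure (distr (P (X t \<omega>)) (count_space S) (X s)) B \<partial>P i)"
    if "E \<in> sets (history (space (P i)) (count_space S) X t)" "B \<in> sets (count_space S)" for E B
    using markov[OF i] t s that unfolding markov_from_def by blast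
  have ev: "{y\<in>paths S. y s = j} \<in> sets (path_algebra S)" if "0 \<le> s" for s
    using measurable_path_event[OF that, of S "{j}"] by simp
  have inA: "{x\<in>A. x (t + s) = j} = A \<inter> {y\<in>paths S. y (t + s) = j}" using AS by auto
  have "{x\<in>A. x (t + s) = j} \<in> sets (path_algebra S)"
    unfolding inA using A' ev[of "t+s"] t s by auto
  then have "emeasure (path_law i) {x\<in>A. x (t + s) = j} =
      emeasure (P i) {\<omega>\<in>space (P i). sample_path \<omega> \<in> {x\<in>A. x (t + s) = j}}"
    by (rule emeasure_path_law[OF i])
  also have "{\<omega>\<in>space (P i). sample_path \<omega> \<in> {x\<in>A. x (t + s) = j}} =
      {\<omega>\<in>{\<omega>\<in>space (P i). sample_path \<omega> \<in> A}. X (t + s) \<omega> \<in> {j} \<inter> S}"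
    using measurable_space[OF measurable_X[OF i, of "t+s"]] t s by (auto simp: sample_path_def)
  also have "emeasure (P i) \<dots> = (\<integral>\<^sup>+\<omega>\<in>{\<omega>\<in>space (P i). sample_path \<omega> \<in> A}.
      emeasure (distr (P (X t \<omega>)) (count_space S) (X s)) ({j} \<inter> S) \<partial>P i)"
    by (rule M[OF sample_path_history[OF i t A]]) simp
  also have "\<dots> = (\<integral>\<^sup>+\<omega>. emeasure (path_law (sample_path \<omega> t)) {y\<in>paths S. y s = j} *
      indicator A (sample_path \<omega>) \<partial>P i)"
  proof (rule nn_integral_cong)
    fix \<omega> assume \<omega>: "\<omega> \<in> space (P i)"
    then have k: "X t \<omega> \<in> S" using measurable_space[OF measurable_X[OF i t]] by auto
    have "emeasure (distr (P (X t \<omega>)) (count_space S) (X s)) ({j} \<inter> S) =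
        emeasure (P (X t \<omega>)) (X s -` ({j} \<inter> S) \<inter> space (P (X t \<omega>)))"
      by (rule emeasure_distr[OF measurable_X[OF k s]]) auto
    also have "X s -` ({j} \<inter> S) \<inter> space (P (X t \<omega>)) =
        {\<omega>'\<in>space (P (X t \<omega>)). sample_path \<omega>' \<in> {y\<in>paths S. y s = j}}"
      using measurable_space[OF measurable_X[OF k s]] k
      by (auto simp: space_P sample_path_def intro: sample_path_paths[unfolded sample_path_def])
    also have "emeasure (P (X t \<omega>)) \<dots> = emeasure (path_law (X t \<omega>)) {y\<in>paths S. y s = j}"
      by (rule emeasure_path_law[OF k ev[OF s], symmetric])
    finally show "emeasure (distr (P (X t \<omega>)) (count_space S) (X s)) ({j} \<inter> S) *
          indicator {\<omega>\<in>space (P i). sample_path \<omega> \<in> A} \<omega>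
        = emeasure (path_law (sample_path \<omega> t)) {y\<in>paths S. y s = j} * indicator A (sample_path \<omega>)"
      using \<omega> by (simp add: sample_path_def indicator_def)
  qed
  also have "\<dots> = (\<integral>\<^sup>+x\<in>A. emeasure (path_law (x t)) {y\<in>paths S. y s = j} \<partial>path_law i)"
  proof -
    have "(\<lambda>x. emeasure (path_law (x t)) {y\<in>paths S. y s = j}) \<in> borel_measurable (path_algebra S)"
      by (rule measurable_compose[OF measurable_path_law_eval[OF t, THEN measurable_prob_algebraD]
            measurable_emeasure_subprob_algebra[OF ev[OF s]]])
    then have "(\<lambda>x. emeasure (path_law (x t)) {y\<in>paths S. y s = j} * indicator A x)
        \<in> borel_measurable (path_algebra S)"
      using A' by measurable
    then show ?thesis
      unfolding path_law_def[of i]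
      by (subst nn_integral_distr[OF measurable_sample_path[OF i]]) simp_all
  qed
  finally show ?thesis .
qed

lemma emeasure_path_law_measurable:
  assumes "0 \<le> t" "G \<in> sets (path_algebra S)"
  shows "(\<lambda>x. emeasure (path_law (x t)) G) \<in> borel_measurable (path_algebra S)"
  by (rule measurable_compose[OF measurable_path_law_eval[OF assms(1), THEN measurable_prob_algebraD]
        measurable_emeasure_subprob_algebra[OF assms(2)]])

lemma markov_cylinder:
  assumes "ys \<in> increments" "i \<in> S" "0 \<le> t" "A \<in> sets (past S t)"
  shows "emeasure (path_law i) {x\<in>A. time_shift t x \<in> cylinder S ys}
    = (\<integral>\<^sup>+x\<in>A. emeasure (path_law (x t)) (cylinder S ys) \<partial>path_law i)"
  using assms
proof (induction ys arbitrary: i t A rule: list.induct)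
  case Nil
  have A': "A \<in> sets (path_algebra S)" by (rule sets_past_path[OF Nil(3,4)])
  have "{x\<in>A. time_shift t x \<in> cylinder S []} = A"
    using sets.sets_into_space[OF A'] time_shift_paths[OF _ Nil(3)] by auto
  moreover have "(\<integral>\<^sup>+x\<in>A. emeasure (path_law (x t)) (cylinder S []) \<partial>path_law i) =
      (\<integral>\<^sup>+x. indicator A x \<partial>path_law i)"
  proof (rule nn_integral_cong)
    fix x assume "x \<in> space (path_law i)"
    then have "x t \<in> S" using paths_in Nil(3) by auto
    then show "emeasure (path_law (x t)) (cylinder S []) * indicator A x = indicator A x"
      using prob_space.emeasure_space_1[OF prob_space_path_law, of "x t"] by simp
  qed
  ultimately show ?case using A' by simp
next
  case (Cons y ys)
  obtain s j where y: "y = (s, j)" by (cases y)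
  have s: "0 \<le> s" and ys: "ys \<in> increments" using Cons.prems(1) by (auto simp: y)
  have t: "0 \<le> t" and ts: "0 \<le> t + s" using Cons.prems s by auto
  \<comment> \<open>Once the state \<open>j\<close> at time \<open>r + s\<close> is fixed, the
    induction hypothesis contributes a constant factor. The fact is used twice: under
    \<open>path_law i\<close> with the event \<open>A\<close> at time \<open>t\<close>, and under
    the law of the current state with all paths at time 0. Both uses give the same factor, which
    leaves the one-step property.\<close>
  have key: "emeasure (path_law k) {x\<in>B. x (r + s) = j \<and> time_shift (r + s) x \<in> cylinder S ys} =
      emeasure (path_law j) (cylinder S ys) * emeasure (path_law k) {x\<in>B. x (r + s) = j}"
    if k: "k \<in> S" and r: "0 \<le> r" and B: "B \<in> sets (past S r)" for k r B
  proof -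
    have rs: "0 \<le> r + s" using r s by simp
    let ?B = "{x\<in>B. x (r + s) = j}"
    have Beq: "?B = B \<inter> {x\<in>paths S. x (r + s) \<in> {j}}" using sets.sets_into_space[OF B] by auto
    have "B \<in> sets (past S (r + s))" using sets_past_mono[OF r _ B, of "r+s"] s by simp
    then have B': "?B \<in> sets (past S (r + s))"
      unfolding Beq using sets_past_event[OF rs order_refl, of S "{j}"] by (rule sets.Int)
    have "{x\<in>B. x (r + s) = j \<and> time_shift (r + s) x \<in> cylinder S ys} =
        {x\<in>?B. time_shift (r + s) x \<in> cylinder S ys}" by blast
    also have "emeasure (path_law k) \<dots> =
        (\<integral>\<^sup>+x\<in>?B. emeasure (path_law (x (r + s))) (cylinder S ys) \<partial>path_law k)"
      by (rule Cons.IH[OF ys k rs B'])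
    also have "\<dots> = (\<integral>\<^sup>+x. emeasure (path_law j) (cylinder S ys) * indicator ?B x \<partial>path_law k)"
      by (intro nn_integral_cong) (simp add: indicator_def)
    also have "\<dots> = emeasure (path_law j) (cylinder S ys) * emeasure (path_law k) ?B"
      using sets_past_path[OF rs B'] by (subst nn_integral_cmult_indicator) auto
    finally show ?thesis .
  qed
  have A': "A \<in> sets (path_algebra S)" by (rule sets_past_path[OF t Cons.prems(4)])
  have ev: "{y\<in>paths S. y s = j} \<in> sets (path_algebra S)"
    using measurable_path_event[OF s, of S "{j}"] by simp
  have "{x\<in>A. time_shift t x \<in> cylinder S (y # ys)} =
      {x\<in>A. x (t + s) = j \<and> time_shift (t + s) x \<in> cylinder S ys}"
    using sets.sets_into_space[OF A'] time_shift_paths[OF _ t]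
    by (auto simp: y time_shift_apply time_shift_time_shift)
  then have "emeasure (path_law i) {x\<in>A. time_shift t x \<in> cylinder S (y # ys)} =
      emeasure (path_law j) (cylinder S ys) * emeasure (path_law i) {x\<in>A. x (t + s) = j}"
    using key[OF Cons.prems(2) t Cons.prems(4)] by simp
  also have "\<dots> = emeasure (path_law j) (cylinder S ys) *
      (\<integral>\<^sup>+x\<in>A. emeasure (path_law (x t)) {y\<in>paths S. y s = j} \<partial>path_law i)"
    by (simp add: markov_one_step[OF Cons.prems(2) t s Cons.prems(4)])
  also have "\<dots> = (\<integral>\<^sup>+x. emeasure (path_law j) (cylinder S ys) *
      (emeasure (path_law (x t)) {y\<in>paths S. y s = j} * indicator A x) \<partial>path_law i)"
    using A' emeasure_path_law_measurable[OF t ev]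
    by (subst nn_integral_cmult) auto
  also have "\<dots> = (\<integral>\<^sup>+x\<in>A. emeasure (path_law (x t)) (cylinder S (y # ys)) \<partial>path_law i)"
  proof (rule nn_integral_cong)
    fix x assume "x \<in> space (path_law i)"
    then have xt: "x t \<in> S" using paths_in t by auto
    have all: "paths S \<in> sets (past S 0)" using sets.top[of "past S 0"] by simp
    have "cylinder S (y # ys) = {x\<in>paths S. x (0 + s) = j \<and> time_shift (0 + s) x \<in> cylinder S ys}"
      by (simp add: y)
    then have "emeasure (path_law (x t)) (cylinder S (y # ys)) =
        emeasure (path_law j) (cylinder S ys) * emeasure (path_law (x t)) {x\<in>paths S. x s = j}"
      using key[OF xt order_refl all] by simp
    then show "emeasure (path_law j) (cylinder S ys) *
        (emeasure (path_law (x t)) {y\<in>paths S. y s = j} * indicator A x) =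
        emeasure (path_law (x t)) (cylinder S (y # ys)) * indicator A x"
      by (simp add: mult.assoc)
  qed
  finally show ?case .
qed

lemma markov_property:
  assumes i: "i \<in> S" and t: "0 \<le> t" and A: "A \<in> sets (past S t)" and G: "G \<in> sets (path_algebra S)"
  shows "emeasure (path_law i) {x\<in>A. time_shift t x \<in> G}
    = (\<integral>\<^sup>+x\<in>A. emeasure (path_law (x t)) G \<partial>path_law i)"
proof -
  have A': "A \<in> sets (path_algebra S)" by (rule sets_past_path[OF t A])
  define D where "D = density (path_law i) (indicator A)"
  have sets_D [simp, measurable_cong]: "sets D = sets (path_algebra S)"
    and space_D [simp]: "space D = paths S" by (simp_all add: D_def)
  have ne: "paths S \<noteq> {}"
    using prob_space.not_empty[OF prob_space_path_law[OF i]] by simp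
  have kerD: "(\<lambda>x. path_law (x t)) \<in> D \<rightarrow>\<^sub>M subprob_algebra (path_algebra S)"
    using measurable_path_law_eval[OF t, THEN measurable_prob_algebraD]
    by (simp cong: measurable_cong_sets)
  have em1: "emeasure (distr D (path_algebra S) (time_shift t)) G =
      emeasure (path_law i) {x\<in>A. time_shift t x \<in> G}" if G: "G \<in> sets (path_algebra S)" for G
  proof -
    have "time_shift t \<in> path_law i \<rightarrow>\<^sub>M path_algebra S"
      using measurable_time_shift[OF t] by (simp cong: measurable_cong_sets)
    from emeasure_distr_restricted[OF this _ G, of A]
    have "emeasure (distr D (path_algebra S) (time_shift t)) G =
        emeasure (path_law i) (A \<inter> (time_shift t -` G \<inter> paths S))"
      using A' by (simp add: D_def)
    also have "A \<inter> (time_shift t -` G \<inter> paths S) = {x\<in>A. time_shift t x \<in> G}"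
      using sets.sets_into_space[OF A'] by auto
    finally show ?thesis .
  qed
  have em2: "emeasure (D \<bind> (\<lambda>x. path_law (x t))) G =
      (\<integral>\<^sup>+x\<in>A. emeasure (path_law (x t)) G \<partial>path_law i)" if G: "G \<in> sets (path_algebra S)" for G
  proof -
    have "emeasure (D \<bind> (\<lambda>x. path_law (x t))) G = (\<integral>\<^sup>+x. emeasure (path_law (x t)) G \<partial>D)"
      using kerD ne G by (intro emeasure_bind) auto
    also have "\<dots> = (\<integral>\<^sup>+x. indicator A x * emeasure (path_law (x t)) G \<partial>path_law i)"
      unfolding D_def using A' emeasure_path_law_measurable[OF t G]
      by (intro nn_integral_density) auto
    finally show ?thesis by (simp add: mult.commute)
  qed
  have "distr D (path_algebra S) (time_shift t) = D \<bind> (\<lambda>x. path_law (x t))"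
  proof (rule measure_eqI_cylinder)
    show "sets (D \<bind> (\<lambda>x. path_law (x t))) = sets (path_algebra S)"
      using ne by (intro sets_bind[where N="path_algebra S"]) auto
    have "emeasure (path_law i) {x\<in>A. time_shift t x \<in> paths S} \<le> emeasure (path_law i) (space (path_law i))"
      by (rule emeasure_space)
    also have "\<dots> = 1" using prob_space.emeasure_space_1[OF prob_space_path_law[OF i]] by simp
    finally show "emeasure (distr D (path_algebra S) (time_shift t)) (paths S) \<noteq> \<infinity>"
      using em1[of "paths S"] sets.top[of "path_algebra S"] by (auto simp: top_unique)
  next
    fix ys assume ys: "ys \<in> increments"
    show "emeasure (distr D (path_algebra S) (time_shift t)) (cylinder S ys) =
        emeasure (D \<bind> (\<lambda>x. path_law (x t))) (cylinder S ys)"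
      unfolding em1[OF sets_cylinder[OF ys]] em2[OF sets_cylinder[OF ys]]
      by (rule markov_cylinder[OF ys i t A])
  qed simp
  then show ?thesis using em1[OF G] em2[OF G] by simp
qed

lemma markov_event:
  assumes i: "i \<in> S" and t: "0 \<le> t" and A: "A \<in> sets (past S t)" and G: "G \<in> sets (path_algebra S)"
    and j: "\<And>x. x \<in> A \<Longrightarrow> x t = j"
  shows "emeasure (path_law i) {x\<in>A. time_shift t x \<in> G}
    = emeasure (path_law i) A * emeasure (path_law j) G"
proof -
  have "emeasure (path_law i) {x\<in>A. time_shift t x \<in> G} =
      (\<integral>\<^sup>+x. emeasure (path_law j) G * indicator A x \<partial>path_law i)"
    unfolding markov_property[OF i t A G] by (intro nn_integral_cong) (simp add: indicator_def j)
  also have "\<dots> = emeasure (path_law j) G * emeasure (path_law i) A"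
    using sets_past_path[OF t A] by (subst nn_integral_cmult_indicator) auto
  finally show ?thesis by (simp add: mult.commute)
qed

text \<open>Past and future share one integrand here, because whether the future path survives
  depends on the age inherited from the past. On rectangles it is \<open>markov_property\<close>;
  rectangles determine a measure on the product.\<close>

lemma markov_joint:
  assumes i: "i \<in> S" and t: "0 \<le> t"
    and F: "(\<lambda>(x, y). F x y) \<in> borel_measurable (past S t \<Otimes>\<^sub>M path_algebra S)"
  shows "(\<integral>\<^sup>+x. F x (time_shift t x) \<partial>path_law i) =
    (\<integral>\<^sup>+x. (\<integral>\<^sup>+y. F x y \<partial>path_law (x t)) \<partial>path_law i)"
proof -
  let ?N = "past S t \<Otimes>\<^sub>M path_algebra S"
  have ne: "paths S \<noteq> {}"
    using prob_space.not_empty[OF prob_space_path_law[OF i]] by simp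
  have id: "(\<lambda>x. x) \<in> path_law i \<rightarrow>\<^sub>M past S t"
    using measurable_ident_past[OF t] by (simp cong: measurable_cong_sets)
  have sh: "time_shift t \<in> path_law i \<rightarrow>\<^sub>M path_algebra S"
    using measurable_time_shift[OF t] by (simp cong: measurable_cong_sets)
  have pair: "(\<lambda>x. (x, time_shift t x)) \<in> path_law i \<rightarrow>\<^sub>M ?N"
    using id sh by (rule measurable_Pair)
  have ker: "(\<lambda>x. path_law (x t)) \<in> path_law i \<rightarrow>\<^sub>M subprob_algebra (path_algebra S)"
    using measurable_path_law_eval[OF t, THEN measurable_prob_algebraD]
    by (simp cong: measurable_cong_sets)
  have Pr: "(\<lambda>y. (x, y)) \<in> path_law k \<rightarrow>\<^sub>M ?N" if "x \<in> paths S" for x k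
    using that by (intro measurable_Pair) (auto cong: measurable_cong_sets)
  have K: "(\<lambda>x. distr (path_law (x t)) ?N (\<lambda>y. (x, y))) \<in> path_law i \<rightarrow>\<^sub>M subprob_algebra ?N"
  proof (rule measurable_distr2[OF _ ker])
    have "(\<lambda>z. (fst z, snd z)) \<in> path_law i \<Otimes>\<^sub>M path_algebra S \<rightarrow>\<^sub>M ?N"
      by (intro measurable_Pair measurable_compose[OF measurable_fst id] measurable_snd)
    then show "(\<lambda>(x, y). (x, y)) \<in> path_law i \<Otimes>\<^sub>M path_algebra S \<rightarrow>\<^sub>M ?N"
      by (simp add: case_prod_beta)
  qed
  have sp: "space ?N = paths S \<times> paths S" by (simp add: space_pair_measure)
  have "distr (path_law i) ?N (\<lambda>x. (x, time_shift t x)) =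
      path_law i \<bind> (\<lambda>x. distr (path_law (x t)) ?N (\<lambda>y. (x, y)))" (is "?M1 = ?M2")
  proof (rule measure_eqI_generator_eq[where E="{a \<times> b | a b. a \<in> sets (past S t) \<and> b \<in> sets (path_algebra S)}"
        and \<Omega>="paths S \<times> paths S" and A="\<lambda>_. paths S \<times> paths S"])
    show "Int_stable {a \<times> b | a b. a \<in> sets (past S t) \<and> b \<in> sets (path_algebra S)}"
      by (rule Int_stable_pair_measure_generator)
    show "{a \<times> b | a b. a \<in> sets (past S t) \<and> b \<in> sets (path_algebra S)} \<subseteq> Pow (paths S \<times> paths S)"
      using sets.sets_into_space[of _ "past S t"] sets.sets_into_space[of _ "path_algebra S"]
      by auto
    show "sets ?M1 = sigma_sets (paths S \<times> paths S)
        {a \<times> b | a b. a \<in> sets (past S t) \<and> b \<in> sets (path_algebra S)}"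
      by (simp add: sets_pair_measure)
    have "sets ?M2 = sets ?N" using ne by (intro sets_bind) auto
    then show "sets ?M2 = sigma_sets (paths S \<times> paths S)
        {a \<times> b | a b. a \<in> sets (past S t) \<and> b \<in> sets (path_algebra S)}"
      by (simp add: sets_pair_measure)
    show "range (\<lambda>_::nat. paths S \<times> paths S) \<subseteq>
        {a \<times> b | a b. a \<in> sets (past S t) \<and> b \<in> sets (path_algebra S)}"
      using sets.top[of "past S t"] sets.top[of "path_algebra S"] by auto
    show "(\<Union>_::nat. paths S \<times> paths S) = paths S \<times> paths S" by simp
    have "prob_space ?M1" by (rule prob_space.prob_space_distr[OF prob_space_path_law[OF i] pair])
    then show "emeasure ?M1 (paths S \<times> paths S) \<noteq> \<infinity>"
      using prob_space.emeasure_space_1[of ?M1] by (simp add: sp)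
  next
    fix U assume "U \<in> {a \<times> b | a b. a \<in> sets (past S t) \<and> b \<in> sets (path_algebra S)}"
    then obtain A G where U: "U = A \<times> G" and A: "A \<in> sets (past S t)" and G: "G \<in> sets (path_algebra S)"
      by auto
    have UN: "U \<in> sets ?N" using A G by (auto simp: U)
    have "emeasure ?M1 U = emeasure (path_law i) ((\<lambda>x. (x, time_shift t x)) -` U \<inter> paths S)"
      using UN pair by (simp add: emeasure_distr)
    also have "(\<lambda>x. (x, time_shift t x)) -` U \<inter> paths S = {x\<in>A. time_shift t x \<in> G}"
      using sets.sets_into_space[OF A] by (auto simp: U)
    also have "emeasure (path_law i) \<dots> = (\<integral>\<^sup>+x\<in>A. emeasure (path_law (x t)) G \<partial>path_law i)"
      by (rule markov_property[OF i t A G])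
    also have "\<dots> = (\<integral>\<^sup>+x. emeasure (distr (path_law (x t)) ?N (\<lambda>y. (x, y))) U \<partial>path_law i)"
    proof (rule nn_integral_cong)
      fix x assume x: "x \<in> space (path_law i)"
      have "emeasure (distr (path_law (x t)) ?N (\<lambda>y. (x, y))) U =
          emeasure (path_law (x t)) ((\<lambda>y. (x, y)) -` U \<inter> paths S)"
        using UN Pr x by (simp add: emeasure_distr)
      also have "(\<lambda>y. (x, y)) -` U \<inter> paths S = (if x \<in> A then G else {})"
        using sets.sets_into_space[OF G] by (auto simp: U)
      finally show "emeasure (path_law (x t)) G * indicator A x =
          emeasure (distr (path_law (x t)) ?N (\<lambda>y. (x, y))) U"
        by (simp add: indicator_def)
    qed
    also have "\<dots> = emeasure ?M2 U"
      using UN ne by (intro emeasure_bind[OF _ K, symmetric]) auto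
    finally show "emeasure ?M1 U = emeasure ?M2 U" .
  qed
  then have "(\<integral>\<^sup>+z. (\<lambda>(x, y). F x y) z \<partial>?M1) = (\<integral>\<^sup>+z. (\<lambda>(x, y). F x y) z \<partial>?M2)" by simp
  also have "(\<integral>\<^sup>+z. (\<lambda>(x, y). F x y) z \<partial>?M1) = (\<integral>\<^sup>+x. F x (time_shift t x) \<partial>path_law i)"
    using F by (subst nn_integral_distr[OF pair]) simp_all
  also have "(\<integral>\<^sup>+z. (\<lambda>(x, y). F x y) z \<partial>?M2) =
      (\<integral>\<^sup>+x. (\<integral>\<^sup>+z. (\<lambda>(x, y). F x y) z \<partial>distr (path_law (x t)) ?N (\<lambda>y. (x, y))) \<partial>path_law i)"
    by (rule nn_integral_bind[OF F K])
  also have "\<dots> = (\<integral>\<^sup>+x. (\<integral>\<^sup>+y. F x y \<partial>path_law (x t)) \<partial>path_law i)"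
    using F by (intro nn_integral_cong, subst nn_integral_distr[OF Pr]) simp_all
  finally show ?thesis .
qed

end


section \<open>Strong Markov property at hitting times\<close>

text \<open>Pathwise eventual agreement is convergence of the indicators, dominated by 1. This gives
  the limits of grid events, of growing time horizons and of the survival function.\<close>

lemma measure_tendsto_eventually:
  assumes "finite_measure M" and A: "\<And>m. A m \<in> sets M" and B: "B \<in> sets M"
    and ev: "\<And>x. x \<in> space M \<Longrightarrow> eventually (\<lambda>m. x \<in> A m \<longleftrightarrow> x \<in> B) sequentially"
  shows "(\<lambda>m. measure M (A m)) \<longlonglongrightarrow> measure M B"
proof -
  interpret finite_measure M by fact
  have "(\<lambda>m. \<integral>x. indicat_real (A m) x \<partial>M) \<longlonglongrightarrow> (\<integral>x. indicat_real B x \<partial>M)"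
  proof (rule integral_dominated_convergence[where w="\<lambda>_. 1"])
    show "AE x in M. (\<lambda>m. indicat_real (A m) x) \<longlonglongrightarrow> indicat_real B x"
    proof (rule AE_I2)
      fix x assume "x \<in> space M"
      from ev[OF this] show "(\<lambda>m. indicat_real (A m) x) \<longlonglongrightarrow> indicat_real B x"
        by (intro tendsto_eventually) (auto elim!: eventually_mono simp: indicator_def)
    qed
  qed (use A B in \<open>auto simp: indicator_def\<close>)
  then show ?thesis using A B sets.sets_into_space by (simp add: Int_absorb2)
qed

text \<open>The point in question is the first grid point at or after \<open>T\<close>; the last
  clause keeps all earlier grid points before \<open>T\<close>, so that a grid cannot see a hit too
  soon.\<close>

lemma eventually_grid_point:
  fixes T a e :: real
  assumes "0 \<le> T" "T < a" "0 < e"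
  shows "eventually (\<lambda>m. \<exists>n<Suc m. T \<le> real n * (a / Suc m) \<and> real n * (a / Suc m) < T + e \<and>
    (\<forall>k<n. real k * (a / Suc m) < T)) sequentially"
proof -
  \<comment> \<open>The distance \<open>a - T\<close> is included so that the first grid point at or
    after \<open>T\<close> still lies below \<open>a\<close>, that is, has an index below
    \<open>Suc m\<close>.\<close>
  define e' where "e' = min e (a - T)"
  have e': "0 < e'" "e' \<le> e" "T + e' \<le> a" using assms by (auto simp: e'_def)
  have a: "0 < a" using assms by simp
  have "(\<lambda>m. a * inverse (real (Suc m))) \<longlonglongrightarrow> a * 0"
    by (intro tendsto_mult_left LIMSEQ_inverse_real_of_nat)
  then have "eventually (\<lambda>m. a * inverse (real (Suc m)) < e') sequentially"
    using e'(1) by (intro order_tendstoD(2)) simp_all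
  then show ?thesis
  proof eventually_elim
    case (elim m)
    define h where "h = a / real (Suc m)"
    have h: "0 < h" "h < e'" using a elim by (auto simp: h_def divide_inverse)
    define n where "n = nat \<lceil>T / h\<rceil>"
    have nT: "T / h \<le> real n" "real n < T / h + 1"
      using assms(1) h(1) ceiling_correct[of "T / h"] by (simp_all add: n_def of_nat_nat)
    have 1: "T \<le> real n * h" using nT(1) h(1) by (simp add: field_simps)
    have 2: "real n * h < T + h" using nT(2) h(1) by (simp add: field_simps)
    have 3: "real k * h < T" if "k < n" for k
    proof -
      have "real k + 1 \<le> real n" using that by linarith
      then have "real k < T / h" using nT(2) by linarith
      then show ?thesis using h(1) by (simp add: field_simps)
    qed
    have "real n * h < real (Suc m) * h" using 2 h(2) e'(3) by (simp add: h_def)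
    then have "n < Suc m" using h(1) by (simp add: mult_less_cancel_right)
    then show ?case using 1 2 3 h(2) e'(2) unfolding h_def[symmetric] by (intro exI[of _ n]) auto
  qed
qed

lemma filterlim_grid_width:
  assumes "0 < (a::real)"
  shows "filterlim (\<lambda>m. a / real (Suc m)) (at_right 0) sequentially"
proof (rule tendsto_imp_filterlim_at_right)
  have "(\<lambda>m. a * inverse (real (Suc m))) \<longlonglongrightarrow> a * 0"
    by (intro tendsto_mult_left LIMSEQ_inverse_real_of_nat)
  then show "(\<lambda>m. a / real (Suc m)) \<longlonglongrightarrow> 0" by (simp add: divide_inverse)
qed (use assms in auto)

text \<open>The exponent is \<open>m\<close> and not \<open>Suc m\<close> because the grid points
  with indices 0 to \<open>m\<close> have only \<open>m\<close> steps between them. The logarithm of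
  the power is \<open>a\<close> times \<open>m / Suc m\<close>, which tends to 1, times the
  difference quotient of \<open>ln\<close> of \<open>f\<close> at 0.\<close>

lemma exp_limit_of_derivative:
  fixes f :: "real \<Rightarrow> real"
  assumes f: "(f has_real_derivative D) (at_right 0)" and f0: "f 0 = 1" and a: "0 < a"
  shows "(\<lambda>m. f (a / Suc m) ^ m) \<longlonglongrightarrow> exp (D * a)"
proof -
  note h = filterlim_grid_width[OF a]
  have "((\<lambda>x. ln (f x)) has_real_derivative (inverse (f 0) * D)) (at_right 0)"
  proof (rule DERIV_chain2[where f=ln])
    show "(ln has_real_derivative inverse (f 0)) (at (f 0))" using DERIV_ln[of "f 0"] f0 by simp
  qed (rule f)
  then have "((\<lambda>y. (ln (f y) - ln (f 0)) / (y - 0)) \<longlongrightarrow> D) (at_right 0)"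
    using f0 by (simp add: has_field_derivative_iff)
  then have "(\<lambda>m. (ln (f (a / Suc m)) - ln (f 0)) / (a / Suc m - 0)) \<longlonglongrightarrow> D"
    by (rule filterlim_compose[OF _ h])
  moreover have "(\<lambda>m. real m / real (Suc m)) \<longlonglongrightarrow> 1" by (rule LIMSEQ_n_over_Suc_n)
  ultimately have "(\<lambda>m. a * (real m / real (Suc m)) * ((ln (f (a / Suc m)) - ln (f 0)) / (a / Suc m - 0)))
      \<longlonglongrightarrow> a * 1 * D"
    by (intro tendsto_mult tendsto_const)
  also have "(\<lambda>m. a * (real m / real (Suc m)) * ((ln (f (a / Suc m)) - ln (f 0)) / (a / Suc m - 0))) =
      (\<lambda>m. real m * ln (f (a / Suc m)))"
    using a f0 by (simp add: fun_eq_iff divide_simps del: of_nat_Suc)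
  finally have "(\<lambda>m. exp (real m * ln (f (a / Suc m)))) \<longlonglongrightarrow> exp (D * a)"
    by (intro tendsto_exp) (simp add: mult.commute)
  moreover have "(f \<longlongrightarrow> f 0) (at_right 0)"
    using has_field_derivative_imp_has_derivative[OF f, THEN has_derivative_continuous]
    by (simp add: continuous_within)
  then have "(\<lambda>m. f (a / Suc m)) \<longlonglongrightarrow> 1" using f0 by (metis filterlim_compose[OF _ h])
  then have "eventually (\<lambda>m. 0 < f (a / Suc m)) sequentially"
    by (rule order_tendstoD(1)) simp
  then have "eventually (\<lambda>m. exp (real m * ln (f (a / Suc m))) = f (a / Suc m) ^ m) sequentially"
    by eventually_elim (simp add: exp_of_nat_mult)
  ultimately show ?thesis by (rule Lim_transform_eventually)
qed

lemma difference_quotient_limit: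
  fixes f :: "real \<Rightarrow> real"
  assumes f: "(f has_real_derivative D) (at_right 0)" and a: "0 < a"
  shows "(\<lambda>m. (f (a / Suc m) - f 0) / (a / Suc m)) \<longlonglongrightarrow> D"
proof -
  note h = filterlim_grid_width[OF a]
  have "((\<lambda>y. (f y - f 0) / (y - 0)) \<longlongrightarrow> D) (at_right 0)"
    using f by (simp add: has_field_derivative_iff)
  from filterlim_compose[OF this h] show ?thesis by simp
qed


context nonexplosive_ctmc
begin

lemma finite_measure_path_law: "i \<in> S \<Longrightarrow> finite_measure (path_law i)"
  using prob_space_path_law prob_space.finite_measure by blast

lemma path_sets_top: "paths S \<in> sets (path_algebra S)"
  using sets.top[of "path_algebra S"] by simp

lemma markov_event_measure:
  assumes "i \<in> S" "0 \<le> t" "A \<in> sets (past S t)" "G \<in> sets (path_algebra S)" "\<And>x. x \<in> A \<Longrightarrow> x t = j"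
  shows "measure (path_law i) {x\<in>A. time_shift t x \<in> G}
    = measure (path_law i) A * measure (path_law j) G"
proof -
  have "emeasure (path_law i) {x\<in>A. time_shift t x \<in> G}
      = emeasure (path_law i) A * emeasure (path_law j) G"
    by (rule markov_event) (fact assms)+
  then show ?thesis by (simp add: measure_def enn2real_mult)
qed

section \<open>Grid approximation of hitting events\<close>

definition hit_event :: "nat set \<Rightarrow> nat \<Rightarrow> real \<Rightarrow> (real \<Rightarrow> nat) set \<Rightarrow> (real \<Rightarrow> nat) set" where
  "hit_event B l a G = {x\<in>paths S. hit B x < ereal a \<and> x (real_of_ereal (hit B x)) = l \<and>
     time_shift (real_of_ereal (hit B x)) x \<in> G}"

text \<open>With \<open>l\<close> in \<open>B\<close> the grid first meets \<open>B\<close> at index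
  \<open>n\<close>. The definition also serves with \<open>B = - {i}\<close> and
  \<open>l = i\<close>, where it says that the grid sees only \<open>i\<close> up to index
  \<open>n\<close>.\<close>

definition grid_entry :: "nat set \<Rightarrow> nat \<Rightarrow> real \<Rightarrow> nat \<Rightarrow> (real \<Rightarrow> nat) set" where
  "grid_entry B l h n = {x\<in>paths S. (\<forall>k<n. x (real k * h) \<notin> B) \<and> x (real n * h) = l}"

definition grid_event :: "nat set \<Rightarrow> nat \<Rightarrow> real \<Rightarrow> nat \<Rightarrow> (real \<Rightarrow> nat) set \<Rightarrow> (real \<Rightarrow> nat) set" where
  "grid_event B l h N G = (\<Union>n<N. {x\<in>grid_entry B l h n. time_shift (real n * h) x \<in> G})"

lemma measurable_hit_time:
  "(\<lambda>x. real_of_ereal (hit B x)) \<in> borel_measurable (path_algebra S)"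
  using measurable_hit[of B S] by measurable

lemma sets_hit_event:
  assumes G: "G \<in> sets (path_algebra S)"
  shows "hit_event B l a G \<in> sets (path_algebra S)"
proof -
  have nn: "0 \<le> real_of_ereal (hit B x)" for x by (intro real_of_ereal_pos hit_nonneg)
  have id: "(\<lambda>x. x) \<in> path_algebra S \<rightarrow>\<^sub>M path_algebra S" by simp
  note measurable_eval_random[OF id measurable_hit_time[of B] nn, measurable]
    measurable_time_shift_random[OF id measurable_hit_time[of B] nn, measurable]
    measurable_hit[of B S, measurable] G[measurable]
  have "{x\<in>space (path_algebra S). hit B x < ereal a \<and> x (real_of_ereal (hit B x)) = l \<and>
     time_shift (real_of_ereal (hit B x)) x \<in> G} \<in> sets (path_algebra S)"
    by measurable
  then show ?thesis by (simp add: hit_event_def)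
qed

lemma sets_grid_entry:
  assumes "0 \<le> h" shows "grid_entry B l h n \<in> sets (past S (real n * h))"
proof -
  have "Measurable.pred (past S (real n * h)) (\<lambda>x. x (real k * h) \<notin> B)" if "k \<in> {..<n}" for k
  proof -
    have "real k * h \<le> real n * h" using that assms by (intro mult_right_mono) auto
    then have [measurable]: "(\<lambda>x. x (real k * h)) \<in> past S (real n * h) \<rightarrow>\<^sub>M count_space UNIV"
      using assms by (intro measurable_past_eval) auto
    show ?thesis by measurable
  qed
  then have 1: "Measurable.pred (past S (real n * h)) (\<lambda>x. \<forall>k\<in>{..<n}. x (real k * h) \<notin> B)"
    by (intro pred_Ball_countable) auto
  have "(\<lambda>x. x (real n * h)) \<in> past S (real n * h) \<rightarrow>\<^sub>M count_space UNIV"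
    using assms by (intro measurable_past_eval) auto
  then have 2: "Measurable.pred (past S (real n * h)) (\<lambda>x. x (real n * h) = l)"
    by measurable
  have eq: "grid_entry B l h n = {x\<in>space (past S (real n * h)). (\<forall>k\<in>{..<n}. x (real k * h) \<notin> B) \<and>
      x (real n * h) = l}"
    by (simp add: grid_entry_def Ball_def)
  show ?thesis unfolding eq using 2 1 unfolding pred_def by (rule sets.sets_Collect_conj)
qed

lemma sets_grid_piece:
  assumes "0 \<le> h" "G \<in> sets (path_algebra S)"
  shows "{x\<in>grid_entry B l h n. time_shift (real n * h) x \<in> G} \<in> sets (path_algebra S)"
proof -
  have nh: "0 \<le> real n * h" using assms by simp
  have 1: "grid_entry B l h n \<in> sets (path_algebra S)"
    by (rule sets_past_path[OF nh sets_grid_entry[OF assms(1)]])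
  have 2: "time_shift (real n * h) -` G \<inter> space (path_algebra S) \<in> sets (path_algebra S)"
    by (rule measurable_sets[OF measurable_time_shift[OF nh] assms(2)])
  have "{x\<in>grid_entry B l h n. time_shift (real n * h) x \<in> G} =
      grid_entry B l h n \<inter> (time_shift (real n * h) -` G \<inter> space (path_algebra S))"
    by (auto simp: grid_entry_def)
  then show ?thesis using 1 2 by simp
qed

lemma sets_grid_event:
  assumes "0 \<le> h" "G \<in> sets (path_algebra S)"
  shows "grid_event B l h N G \<in> sets (path_algebra S)"
  unfolding grid_event_def using sets_grid_piece[OF assms] by (intro sets.finite_UN) auto

lemma grid_entry_unique:
  assumes "l \<in> B" "x \<in> grid_entry B l h n" "x \<in> grid_entry B l h m" shows "n = m"
  using assms by (cases n m rule: linorder_cases) (auto simp: grid_entry_def)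

text \<open>Grid times are deterministic, so the ordinary Markov property applies to each piece; the
  entry state is \<open>l\<close> for every \<open>n\<close>, and the factor for the future can be
  taken out of the sum. The pieces are disjoint because \<open>l\<close> lies in
  \<open>B\<close>.\<close>

lemma measure_grid_event:
  assumes i: "i \<in> S" and l: "l \<in> B" and h: "0 \<le> h" and G: "G \<in> sets (path_algebra S)"
  shows "measure (path_law i) (grid_event B l h N G) =
    (\<Sum>n<N. measure (path_law i) (grid_entry B l h n)) * measure (path_law l) G"
proof -
  interpret finite_measure "path_law i" by (rule finite_measure_path_law[OF i])
  have "measure (path_law i) (grid_event B l h N G) =
      (\<Sum>n<N. measure (path_law i) {x\<in>grid_entry B l h n. time_shift (real n * h) x \<in> G})"
    unfolding grid_event_def
  proof (rule finite_measure_finite_Union)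
    show "disjoint_family_on (\<lambda>n. {x\<in>grid_entry B l h n. time_shift (real n * h) x \<in> G}) {..<N}"
      using grid_entry_unique[OF l] by (auto simp: disjoint_family_on_def)
  qed (use sets_grid_piece[OF h G] in auto)
  also have "\<dots> = (\<Sum>n<N. measure (path_law i) (grid_entry B l h n) * measure (path_law l) G)"
    by (intro sum.cong refl markov_event_measure[OF i _ sets_grid_entry[OF h] G])
      (use h in \<open>auto simp: grid_entry_def\<close>)
  finally show ?thesis by (simp add: sum_distrib_right)
qed

text \<open>On a single path a coarse grid can err in two ways: it may overlook a short visit to
  \<open>B\<close>, or start the future so late that the cylinder is left. Once its step is below
  both constancy durations after the hitting time, neither happens.\<close>

lemma eventually_grid_event:
  assumes x: "x \<in> paths S" and l: "l \<in> B" and a: "0 < a" and ys: "ys \<in> increments"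
  shows "eventually (\<lambda>m. x \<in> grid_event B l (a / Suc m) (Suc m) (cylinder S ys) \<longleftrightarrow>
    x \<in> hit_event B l a (cylinder S ys)) sequentially"
proof (cases "hit B x < ereal a")
  case False
  have "x \<notin> grid_event B l (a / Suc m) (Suc m) (cylinder S ys)" for m
  proof
    assume "x \<in> grid_event B l (a / Suc m) (Suc m) (cylinder S ys)"
    then obtain n where n: "n < Suc m" "x (real n * (a / Suc m)) = l"
      by (auto simp: grid_event_def grid_entry_def)
    have "hit B x \<le> ereal (real n * (a / Suc m))" using n l a by (intro hit_le) auto
    also have "real n * (a / Suc m) < real (Suc m) * (a / Suc m)"
      using n(1) a by (intro mult_strict_right_mono) auto
    finally show False using False by simp
  qed
  then show ?thesis using False by (simp add: hit_event_def)
next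
  case True
  then have "hit B x < \<infinity>" by auto
  from hit_attained[OF x this] obtain T where T: "0 \<le> T" "hit B x = ereal T" "x T \<in> B"
    and before: "\<forall>s. 0 \<le> s \<longrightarrow> s < T \<longrightarrow> x s \<notin> B" by blast
  have Ta: "T < a" using True T by simp
  obtain e1 where e1: "0 < e1" "\<And>s. T \<le> s \<Longrightarrow> s < T + e1 \<Longrightarrow> x s = x T"
    using paths_right_constant[OF x T(1)] by blast
  obtain e2 where e2: "0 < e2" "\<And>s. T \<le> s \<Longrightarrow> s < T + e2 \<Longrightarrow>
      (time_shift s x \<in> cylinder S ys \<longleftrightarrow> time_shift T x \<in> cylinder S ys)"
    using cylinder_right_constant[OF ys x T(1)] by blast
  have "0 < min e1 e2" using e1(1) e2(1) by simp
  from eventually_grid_point[OF T(1) Ta this] show ?thesis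
  proof eventually_elim
    case (elim m)
    let ?h = "a / Suc m"
    from elim obtain n where n: "n < Suc m" "T \<le> real n * ?h" "real n * ?h < T + min e1 e2"
      "\<forall>k<n. real k * ?h < T" by blast
    have xn: "x (real n * ?h) = x T" using n by (intro e1(2)) auto
    have shn: "time_shift (real n * ?h) x \<in> cylinder S ys \<longleftrightarrow> time_shift T x \<in> cylinder S ys"
      using n by (intro e2(2)) auto
    have earlier: "x (real k * ?h) \<notin> B" if "k < n" for k
      using before n(4) that a by simp
    have only: "k = n" if "x \<in> grid_entry B l ?h k" for k
    proof (rule linorder_cases[of k n])
      assume "k < n"
      then show ?thesis using earlier[of k] that l by (auto simp: grid_entry_def)
    next
      assume "n < k"
      then show ?thesis using T(3) xn that by (auto simp: grid_entry_def)
    qed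
    have entry: "x \<in> grid_entry B l ?h n \<longleftrightarrow> x T = l"
      using x earlier xn by (auto simp: grid_entry_def)
    have "x \<in> grid_event B l ?h (Suc m) (cylinder S ys) \<longleftrightarrow>
        x \<in> grid_entry B l ?h n \<and> time_shift (real n * ?h) x \<in> cylinder S ys"
      unfolding grid_event_def using only n(1) by blast
    then show ?case unfolding entry shn using x T Ta by (simp add: hit_event_def)
  qed
qed

lemma grid_event_tendsto:
  assumes i: "i \<in> S" and l: "l \<in> B" and a: "0 < a" and ys: "ys \<in> increments"
  shows "(\<lambda>m. measure (path_law i) (grid_event B l (a / Suc m) (Suc m) (cylinder S ys)))
    \<longlonglongrightarrow> measure (path_law i) (hit_event B l a (cylinder S ys))"
proof (rule measure_tendsto_eventually[OF finite_measure_path_law[OF i]])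
  show "grid_event B l (a / Suc m) (Suc m) (cylinder S ys) \<in> sets (path_law i)" for m
    unfolding sets_path_law using a by (intro sets_grid_event sets_cylinder ys) simp
  show "hit_event B l a (cylinder S ys) \<in> sets (path_law i)"
    unfolding sets_path_law by (intro sets_hit_event sets_cylinder ys)
  fix x assume "x \<in> space (path_law i)"
  then have "x \<in> paths S" by simp
  then show "eventually (\<lambda>m. x \<in> grid_event B l (a / Suc m) (Suc m) (cylinder S ys) \<longleftrightarrow>
      x \<in> hit_event B l a (cylinder S ys)) sequentially"
    by (rule eventually_grid_event[OF _ l a ys])
qed

text \<open>The entry state \<open>l\<close> is fixed so that the law of the future is a constant
  factor, and the horizon \<open>a\<close> is finite so that each grid has finitely many points. The
  factorisation is exact on every grid and passes to the limit on cylinders.\<close>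

lemma strong_markov_hit:
  assumes i: "i \<in> S" and l: "l \<in> B" "l \<in> S" and G: "G \<in> sets (path_algebra S)"
  shows "measure (path_law i) (hit_event B l a G) =
    measure (path_law i) (hit_event B l a (paths S)) * measure (path_law l) G"
proof (cases "0 < a")
  case False
  have "\<not> hit B x < ereal a" for x
  proof -
    have "ereal a \<le> 0" using False by simp
    then have "ereal a \<le> hit B x" using hit_nonneg by (rule order_trans)
    then show ?thesis by (simp only: not_less)
  qed
  then show ?thesis by (simp add: hit_event_def)
next
  case a: True
  interpret Li: finite_measure "path_law i" by (rule finite_measure_path_law[OF i])
  interpret Ll: finite_measure "path_law l" by (rule finite_measure_path_law[OF l(2)])
  let ?H = "hit_event B l a"
  define T where "T = (\<lambda>x. real_of_ereal (hit B x))"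
  have T: "T \<in> borel_measurable (path_algebra S)" "\<And>x. 0 \<le> T x"
    unfolding T_def by (auto intro: measurable_hit_time real_of_ereal_pos hit_nonneg)
  have cyl: "measure (path_law i) (?H (cylinder S ys)) =
    measure (path_law i) (?H (paths S)) * measure (path_law l) (cylinder S ys)"
    if ys: "ys \<in> increments" for ys
  proof -
    \<comment> \<open>The empty cylinder is the whole path space and has mass 1; so its grid
      probability is the bare entry probability, and the grid formula for \<open>ys\<close> is a
      constant multiple of it.\<close>
    have Nil: "[] \<in> increments" by simp
    have "(\<lambda>m. measure (path_law i) (grid_event B l (a / Suc m) (Suc m) (cylinder S [])) *
          measure (path_law l) (cylinder S ys))
        \<longlonglongrightarrow> measure (path_law i) (?H (cylinder S [])) * measure (path_law l) (cylinder S ys)"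
      by (intro tendsto_mult_right grid_event_tendsto i l a Nil)
    also have "(\<lambda>m. measure (path_law i) (grid_event B l (a / Suc m) (Suc m) (cylinder S [])) *
          measure (path_law l) (cylinder S ys)) =
        (\<lambda>m. measure (path_law i) (grid_event B l (a / Suc m) (Suc m) (cylinder S ys)))"
    proof (rule ext)
      fix m
      have h: "0 \<le> a / Suc m" using a by simp
      have "measure (path_law l) (cylinder S []) = 1"
        using prob_space.prob_space[OF prob_space_path_law[OF l(2)]] by simp
      then show "measure (path_law i) (grid_event B l (a / Suc m) (Suc m) (cylinder S [])) *
          measure (path_law l) (cylinder S ys) =
        measure (path_law i) (grid_event B l (a / Suc m) (Suc m) (cylinder S ys))"
        using measure_grid_event[OF i l(1) h sets_cylinder[OF ys], of "Suc m"]
          measure_grid_event[OF i l(1) h sets_cylinder[OF Nil], of "Suc m"] by simp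
    qed
    finally show ?thesis
      using LIMSEQ_unique[OF grid_event_tendsto[OF i l(1) a ys]] by simp
  qed
  define D where "D = density (path_law i) (indicator (?H (paths S)))"
  have em: "emeasure (distr D (path_algebra S) (\<lambda>x. time_shift (T x) x)) G = emeasure (path_law i) (?H G)"
    if G: "G \<in> sets (path_algebra S)" for G
  proof -
    have "(\<lambda>x. time_shift (T x) x) \<in> path_law i \<rightarrow>\<^sub>M path_algebra S"
      using measurable_time_shift_random[OF _ T(1), of "\<lambda>x. x" S] T(2) by (simp cong: measurable_cong_sets)
    from emeasure_distr_restricted[OF this _ G, of "?H (paths S)"]
    have "emeasure (distr D (path_algebra S) (\<lambda>x. time_shift (T x) x)) G =
        emeasure (path_law i) (?H (paths S) \<inter> ((\<lambda>x. time_shift (T x) x) -` G \<inter> paths S))"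
      using sets_hit_event[OF path_sets_top] by (simp add: D_def)
    also have "?H (paths S) \<inter> ((\<lambda>x. time_shift (T x) x) -` G \<inter> paths S) = ?H G"
      using sets.sets_into_space[OF G] by (auto simp: hit_event_def T_def)
    finally show ?thesis .
  qed
  have "distr D (path_algebra S) (\<lambda>x. time_shift (T x) x) =
      scale_measure (emeasure (path_law i) (?H (paths S))) (path_law l)"
  proof (rule measure_eqI_cylinder)
    show "emeasure (distr D (path_algebra S) (\<lambda>x. time_shift (T x) x)) (paths S) \<noteq> \<infinity>"
      unfolding em[OF path_sets_top] by (simp add: Li.emeasure_finite)
    fix ys assume ys: "ys \<in> increments"
    show "emeasure (distr D (path_algebra S) (\<lambda>x. time_shift (T x) x)) (cylinder S ys) =
        emeasure (scale_measure (emeasure (path_law i) (?H (paths S))) (path_law l)) (cylinder S ys)"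
      unfolding em[OF sets_cylinder[OF ys]] using cyl[OF ys]
      by (simp add: Li.emeasure_eq_measure Ll.emeasure_eq_measure ennreal_mult')
  qed simp_all
  then have "emeasure (path_law i) (?H G) = emeasure (path_law i) (?H (paths S)) * emeasure (path_law l) G"
    using em[OF G] by simp
  then show ?thesis by (simp add: measure_def enn2real_mult)
qed

section \<open>The first jump from the derivatives of the transition function\<close>

definition trans_prob :: "nat \<Rightarrow> nat \<Rightarrow> real \<Rightarrow> real" where
  "trans_prob i j t = measure (path_law i) {x\<in>paths S. x t = j}"

lemma sets_eval_eq: "0 \<le> t \<Longrightarrow> {x\<in>paths S. x t = j} \<in> sets (path_algebra S)"
  using measurable_path_event[of t S "{j}"] by simp

lemma trans_prob_eq:
  assumes "i \<in> S" "0 \<le> t"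
  shows "trans_prob i j t = measure (P i) {\<omega>\<in>space (P i). X t \<omega> = j}"
  unfolding trans_prob_def measure_path_law[OF assms(1) sets_eval_eq[OF assms(2)]]
  using assms sample_path_paths
  by (auto simp: sample_path_def space_P intro!: arg_cong[where f="measure (P i)"])

text \<open>\<open>trans_prob\<close> is known to agree with the probabilities on the original space
  at nonnegative times only; the derivative is therefore transferred through difference quotients to
  the right of 0.\<close>

lemma trans_prob_derivative:
  assumes "i \<in> S" "j \<in> S"
  shows "(trans_prob i j has_real_derivative q i j) (at_right 0)"
proof -
  have "((\<lambda>t. (measure (P i) {\<omega>\<in>space (P i). X t \<omega> = j} - measure (P i) {\<omega>\<in>space (P i). X 0 \<omega> = j})
      / (t - 0)) \<longlongrightarrow> q i j) (at_right 0)"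
    using q_deriv[OF assms] by (simp only: has_field_derivative_iff)
  moreover have "eventually (\<lambda>t. (measure (P i) {\<omega>\<in>space (P i). X t \<omega> = j} -
      measure (P i) {\<omega>\<in>space (P i). X 0 \<omega> = j}) / (t - 0) =
      (trans_prob i j t - trans_prob i j 0) / (t - 0)) (at_right 0)"
    using eventually_at_right_less[of "0::real"]
    by eventually_elim (simp add: trans_prob_eq[OF assms(1)])
  ultimately show ?thesis
    unfolding has_field_derivative_iff by (rule Lim_transform_eventually)
qed

lemma trans_prob_0:
  assumes "i \<in> S" shows "trans_prob i j 0 = (if i = j then 1 else 0)"
proof -
  interpret prob_space "path_law i" by (rule prob_space_path_law[OF assms])
  have "trans_prob i j 0 = measure (path_law i) (if i = j then space (path_law i) else {})"
    unfolding trans_prob_def using AE_path_law_start[OF assms] sets_eval_eq[of 0 j] path_sets_top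
    by (intro finite_measure_eq_AE) (auto elim!: eventually_mono)
  then show ?thesis using prob_space by auto
qed

lemma measure_stay:
  assumes i: "i \<in> S" and h: "0 \<le> h"
  shows "measure (path_law i) {x\<in>paths S. \<forall>k\<le>n. x (real k * h) = i} = trans_prob i i h ^ n"
proof (induction n)
  case 0
  then show ?case using trans_prob_0[OF i, of i] by (simp add: trans_prob_def)
next
  case (Suc n)
  let ?A = "{x\<in>paths S. \<forall>k\<le>n. x (real k * h) = i}"
  have nh: "0 \<le> real n * h" using h by simp
  have "?A = grid_entry (- {i}) i h n"
    by (auto simp: grid_entry_def le_less)
  then have A: "?A \<in> sets (past S (real n * h))" using sets_grid_entry[OF h] by simp
  have eq: "{x\<in>paths S. \<forall>k\<le>Suc n. x (real k * h) = i} =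
      {x\<in>?A. time_shift (real n * h) x \<in> {y\<in>paths S. y h = i}}"
    using time_shift_paths[OF _ nh, of _ S]
    by (auto simp: le_Suc_eq time_shift_apply algebra_simps)
  have "measure (path_law i) {x\<in>?A. time_shift (real n * h) x \<in> {y\<in>paths S. y h = i}} =
      measure (path_law i) ?A * trans_prob i i h"
    unfolding trans_prob_def by (rule markov_event_measure[OF i nh A sets_eval_eq[OF h]]) blast
  then show ?case unfolding eq by (simp only: Suc.IH power_Suc2)
qed

lemma measure_grid_entry:
  assumes i: "i \<in> S" and l: "l \<noteq> i" and h: "0 \<le> h"
  shows "measure (path_law i) (grid_entry (- {i}) l h 0) = 0"
    and "measure (path_law i) (grid_entry (- {i}) l h (Suc n)) = trans_prob i i h ^ n * trans_prob i l h"
proof -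
  show "measure (path_law i) (grid_entry (- {i}) l h 0) = 0"
    using trans_prob_0[OF i, of l] l by (simp add: trans_prob_def grid_entry_def)
  let ?A = "{x\<in>paths S. \<forall>k\<le>n. x (real k * h) = i}"
  have nh: "0 \<le> real n * h" using h by simp
  have "?A = grid_entry (- {i}) i h n"
    by (auto simp: grid_entry_def le_less)
  then have A: "?A \<in> sets (past S (real n * h))" using sets_grid_entry[OF h] by simp
  have eq: "grid_entry (- {i}) l h (Suc n) = {x\<in>?A. time_shift (real n * h) x \<in> {y\<in>paths S. y h = l}}"
    using time_shift_paths[OF _ nh, of _ S]
    by (auto simp: grid_entry_def less_Suc_eq_le time_shift_apply algebra_simps)
  have "measure (path_law i) {x\<in>?A. time_shift (real n * h) x \<in> {y\<in>paths S. y h = l}} =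
      measure (path_law i) ?A * trans_prob i l h"
    unfolding trans_prob_def by (rule markov_event_measure[OF i nh A sets_eval_eq[OF h]]) blast
  then show "measure (path_law i) (grid_entry (- {i}) l h (Suc n)) = trans_prob i i h ^ n * trans_prob i l h"
    unfolding eq by (simp only: measure_stay[OF i h])
qed

text \<open>Being in \<open>i\<close> at all grid points below \<open>a\<close> has probability
  \<open>trans_prob i i h ^ m\<close> with \<open>h = a / Suc m\<close>. An excursion before
  \<open>a\<close> is seen by every sufficiently fine grid, so these probabilities converge to the
  probability of no exit before \<open>a\<close>.\<close>

lemma measure_first_exit_less:
  assumes i: "i \<in> S" and a: "0 < a"
  shows "measure (path_law i) {x\<in>paths S. hit (- {i}) x < ereal a} = 1 - exp (q i i * a)"
proof -
  interpret prob_space "path_law i" by (rule prob_space_path_law[OF i])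
  let ?A = "\<lambda>m. {x\<in>paths S. \<forall>k\<le>m. x (real k * (a / Suc m)) = i}"
  have A: "?A m \<in> sets (path_algebra S)" for m
  proof -
    have "?A m = grid_entry (- {i}) i (a / Suc m) m"
      by (auto simp: grid_entry_def le_less)
    then show ?thesis using sets_past_path[OF _ sets_grid_entry] a by simp
  qed
  have "(\<lambda>m. measure (path_law i) (paths S - ?A m)) \<longlonglongrightarrow>
      measure (path_law i) {x\<in>paths S. hit (- {i}) x < ereal a}"
  proof (rule measure_tendsto_eventually)
    show "finite_measure (path_law i)" by (rule finite_measure_path_law[OF i])
    show "paths S - ?A m \<in> sets (path_law i)" for m
      unfolding sets_path_law by (rule sets.Diff[OF path_sets_top A])
    have "Measurable.pred (path_algebra S) (\<lambda>x. hit (- {i}) x < ereal a)"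
      using measurable_hit[of "- {i}" S] by measurable
    then show "{x\<in>paths S. hit (- {i}) x < ereal a} \<in> sets (path_law i)" by (simp add: pred_def)
  next
    fix x assume "x \<in> space (path_law i)"
    then have x: "x \<in> paths S" by simp
    show "\<forall>\<^sub>F m in sequentially. x \<in> paths S - ?A m \<longleftrightarrow> x \<in> {x\<in>paths S. hit (- {i}) x < ereal a}"
    proof (cases "hit (- {i}) x < ereal a")
      case False
      have "x (real k * (a / Suc m)) = i" if "k \<le> m" for k m
      proof (rule ccontr)
        assume "x (real k * (a / Suc m)) \<noteq> i"
        then have "hit (- {i}) x \<le> ereal (real k * (a / Suc m))" using a by (intro hit_le) auto
        also have "real k * (a / Suc m) < real (Suc m) * (a / Suc m)"
          using that a by (intro mult_strict_right_mono) auto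
        finally show False using False by simp
      qed
      then have "x \<in> ?A m" for m using x by blast
      then have "x \<in> paths S - ?A m \<longleftrightarrow> x \<in> {x\<in>paths S. hit (- {i}) x < ereal a}" for m
        using False by blast
      then show ?thesis by (intro always_eventually allI)
    next
      case True
      then have "hit (- {i}) x < \<infinity>" by auto
      from hit_attained[OF x this] obtain T where
        T: "0 \<le> T" "hit (- {i}) x = ereal T" "x T \<in> - {i}" by blast
      have Ta: "T < a" using True T by simp
      obtain e where e: "0 < e" "\<And>s. T \<le> s \<Longrightarrow> s < T + e \<Longrightarrow> x s = x T"
        using paths_right_constant[OF x T(1)] by blast
      from eventually_grid_point[OF T(1) Ta e(1)] show ?thesis
      proof eventually_elim
        case (elim m)
        then obtain n where n: "n \<le> m" "x (real n * (a / Suc m)) = x T"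
          using e(2) less_Suc_eq_le by blast
        then have "x \<notin> ?A m" using T(3) by auto
        then show ?case using x True by blast
      qed
    qed
  qed
  moreover have "measure (path_law i) (paths S - ?A m) = 1 - trans_prob i i (a / Suc m) ^ m" for m
  proof -
    have h: "0 \<le> a / Suc m" using a by simp
    have "measure (path_law i) (space (path_law i) - ?A m) = 1 - measure (path_law i) (?A m)"
      by (rule prob_compl) (unfold sets_path_law, rule A)
    then show ?thesis unfolding measure_stay[OF i h] space_path_law .
  qed
  ultimately have "(\<lambda>m. 1 - trans_prob i i (a / Suc m) ^ m) \<longlonglongrightarrow>
      measure (path_law i) {x\<in>paths S. hit (- {i}) x < ereal a}" by simp
  moreover have "(\<lambda>m. 1 - trans_prob i i (a / Suc m) ^ m) \<longlonglongrightarrow> 1 - exp (q i i * a)"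
    by (intro tendsto_diff tendsto_const exp_limit_of_derivative trans_prob_derivative i a)
      (simp add: trans_prob_0[OF i])
  ultimately show ?thesis by (rule LIMSEQ_unique)
qed

lemma q_diag_nonpos: "i \<in> S \<Longrightarrow> q i i \<le> 0"
proof -
  assume i: "i \<in> S"
  have "0 \<le> 1 - exp (q i i * 1)"
    unfolding measure_first_exit_less[OF i zero_less_one, symmetric] by simp
  then show ?thesis by simp
qed

lemma q_off_diag_nonneg:
  assumes "i \<in> S" "j \<in> S" "i \<noteq> j" shows "0 \<le> q i j"
proof (rule LIMSEQ_le_const)
  show "(\<lambda>m. (trans_prob i j (1 / Suc m) - trans_prob i j 0) / (1 / Suc m)) \<longlonglongrightarrow> q i j"
    by (rule difference_quotient_limit[OF trans_prob_derivative[OF assms(1,2)]]) simp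
  show "\<exists>N. \<forall>n\<ge>N. 0 \<le> (trans_prob i j (1 / Suc n) - trans_prob i j 0) / (1 / Suc n)"
    using assms by (simp add: trans_prob_0) (simp add: trans_prob_def)
qed

text \<open>On a grid the first exit to \<open>l\<close> is a geometric sum, with value
  \<open>(1 - p ^ m) * p' / (1 - p)\<close> for the one-step probabilities \<open>p\<close> of
  staying and \<open>p'\<close> of going to \<open>l\<close>. Dividing numerator and denominator of
  \<open>p' / (1 - p)\<close> by the step turns both into difference quotients.\<close>

lemma measure_first_exit_to:
  assumes i: "i \<in> S" and l: "l \<in> S" "l \<noteq> i" and q: "q i i \<noteq> 0" and a: "0 < a"
  shows "measure (path_law i) (hit_event (- {i}) l a (paths S)) = (1 - exp (q i i * a)) * (q i l / - q i i)"
proof -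
  have Nil: "[] \<in> increments" by simp
  have lB: "l \<in> - {i}" using l by simp
  have 1: "(\<lambda>m. measure (path_law i) (grid_event (- {i}) l (a / Suc m) (Suc m) (paths S)))
    \<longlonglongrightarrow> measure (path_law i) (hit_event (- {i}) l a (paths S))"
    using grid_event_tendsto[OF i lB a Nil] by simp
  have "(\<lambda>m. (trans_prob i i (a / Suc m) - trans_prob i i 0) / (a / Suc m)) \<longlonglongrightarrow> q i i"
    by (rule difference_quotient_limit[OF trans_prob_derivative[OF i i] a])
  then have qi: "(\<lambda>m. - ((trans_prob i i (a / Suc m) - 1) / (a / Suc m))) \<longlonglongrightarrow> - q i i"
    by (intro tendsto_minus) (simp add: trans_prob_0[OF i])
  have ql: "(\<lambda>m. trans_prob i l (a / Suc m) / (a / Suc m)) \<longlonglongrightarrow> q i l"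
    using difference_quotient_limit[OF trans_prob_derivative[OF i l(1)] a] l(2)
    by (simp add: trans_prob_0[OF i])
  have 2: "(\<lambda>m. (1 - trans_prob i i (a / Suc m) ^ m) * ((trans_prob i l (a / Suc m) / (a / Suc m)) /
      - ((trans_prob i i (a / Suc m) - 1) / (a / Suc m)))) \<longlonglongrightarrow> (1 - exp (q i i * a)) * (q i l / - q i i)"
    by (intro tendsto_mult tendsto_divide ql qi tendsto_diff tendsto_const
        exp_limit_of_derivative trans_prob_derivative i a) (use q in \<open>simp_all add: trans_prob_0[OF i]\<close>)
  \<comment> \<open>The closed form of the geometric sum requires a staying probability different
    from 1, which holds for fine grids because \<open>q i i\<close> is nonzero.\<close>
  have "eventually (\<lambda>m. - ((trans_prob i i (a / Suc m) - 1) / (a / Suc m)) \<noteq> 0) sequentially"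
    by (rule tendsto_imp_eventually_ne[OF qi]) (use q in simp)
  then have "eventually (\<lambda>m. (1 - trans_prob i i (a / Suc m) ^ m) * ((trans_prob i l (a / Suc m) / (a / Suc m)) /
      - ((trans_prob i i (a / Suc m) - 1) / (a / Suc m))) =
      measure (path_law i) (grid_event (- {i}) l (a / Suc m) (Suc m) (paths S))) sequentially"
  proof eventually_elim
    case (elim m)
    define h where "h = a / Suc m"
    have h: "0 < h" using a by (simp add: h_def)
    have p1: "trans_prob i i h \<noteq> 1" using elim by (auto simp: h_def)
    have "measure (path_law i) (grid_event (- {i}) l h (Suc m) (paths S)) =
        (\<Sum>n<Suc m. measure (path_law i) (grid_entry (- {i}) l h n)) * measure (path_law l) (paths S)"
      using h by (intro measure_grid_event i lB path_sets_top) simp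
    also have "measure (path_law l) (paths S) = 1"
      using prob_space.prob_space[OF prob_space_path_law[OF l(1)]] by simp
    also have "(\<Sum>n<Suc m. measure (path_law i) (grid_entry (- {i}) l h n)) =
        (\<Sum>n<m. trans_prob i i h ^ n * trans_prob i l h)"
      using h by (subst sum.lessThan_Suc_shift) (simp add: measure_grid_entry[OF i l(2)])
    also have "\<dots> = (\<Sum>n<m. trans_prob i i h ^ n) * trans_prob i l h"
      by (simp add: sum_distrib_right)
    also have "(\<Sum>n<m. trans_prob i i h ^ n) = (1 - trans_prob i i h ^ m) / (1 - trans_prob i i h)"
      using p1 by (simp add: sum_gp_strict)
    finally show ?case unfolding h_def[symmetric] using h p1 by (simp add: field_simps)
  qed
  from Lim_transform_eventually[OF 2 this] have "(\<lambda>m. measure (path_law i)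
      (grid_event (- {i}) l (a / Suc m) (Suc m) (paths S))) \<longlonglongrightarrow> (1 - exp (q i i * a)) * (q i l / - q i i)" .
  from LIMSEQ_unique[OF 1 this] show ?thesis .
qed

section \<open>Independence of exit time, exit state and future\<close>

definition jump_event :: "real set \<Rightarrow> nat \<Rightarrow> (real \<Rightarrow> nat) set \<Rightarrow> (real \<Rightarrow> nat) set" where
  "jump_event A l G = {x\<in>paths S. jump_time x (Suc 0) \<in> ereal ` A \<and> visited x (Suc 0) = l \<and>
     time_shift (real_of_ereal (jump_time x (Suc 0))) x \<in> G}"

lemma measurable_first_jump_shift [measurable]:
  "(\<lambda>x. time_shift (real_of_ereal (jump_time x n)) x) \<in> path_algebra S \<rightarrow>\<^sub>M path_algebra S"
  by (rule measurable_time_shift_random[where S=S]) (auto simp: real_of_ereal_pos jump_time_nonneg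
      simp del: jump_time.simps)

lemma sets_jump_event:
  assumes [measurable]: "A \<in> sets borel" "G \<in> sets (path_algebra S)"
  shows "jump_event A l G \<in> sets (path_algebra S)"
proof -
  have "{x\<in>space (path_algebra S). jump_time x (Suc 0) \<in> ereal ` A \<and> visited x (Suc 0) = l \<and>
     time_shift (real_of_ereal (jump_time x (Suc 0))) x \<in> G} \<in> sets (path_algebra S)"
    by measurable
  then show ?thesis by (simp add: jump_event_def)
qed

lemma measure_exponential_lessThan:
  assumes r: "0 < r"
  shows "emeasure (density lborel (exponential_density r)) {..<a} = ennreal (if 0 < a then 1 - exp (- r * a) else 0)"
proof -
  have "emeasure (density lborel (exponential_density r)) {..<a} =
      emeasure (density lborel (exponential_density r)) {..a}"
  proof (rule emeasure_eq_AE)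
    show "AE x in density lborel (exponential_density r). x \<in> {..<a} \<longleftrightarrow> x \<in> {..a}"
      using AE_lborel_singleton[of a] by (subst AE_density) (auto elim!: eventually_mono)
  qed simp_all
  also have "\<dots> = ennreal (erlang_CDF 0 r a)" by (rule emeasure_erlang_density[OF r])
  also have "erlang_CDF 0 r a = (if 0 < a then 1 - exp (- r * a) else 0)"
    by (auto simp: erlang_CDF_def)
  finally show ?thesis .
qed

lemma mem_image_ereal_iff: "y \<in> ereal ` A \<longleftrightarrow> y \<in> ereal ` UNIV \<and> real_of_ereal y \<in> A"
  by (cases y) auto

text \<open>For \<open>A = {..<a}\<close> the jump event is almost surely the hitting event of
  \<open>- {i}\<close>, since the path almost surely starts in \<open>i\<close>; the strong Markov
  property and the exit formula apply. Both sides are measures in \<open>A\<close>, so half-lines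
  determine them.\<close>

theorem first_jump_law:
  assumes i: "i \<in> S" and l: "l \<in> S" "l \<noteq> i" and q: "q i i \<noteq> 0"
    and A: "A \<in> sets borel" and G: "G \<in> sets (path_algebra S)"
  shows "measure (path_law i) (jump_event A l G) =
    measure (density lborel (exponential_density (- q i i))) A * (q i l / - q i i) * measure (path_law l) G"
proof -
  interpret Li: finite_measure "path_law i" by (rule finite_measure_path_law[OF i])
  have r: "0 < - q i i" using q q_diag_nonpos[OF i] by simp
  interpret E: prob_space "density lborel (exponential_density (- q i i))"
    by (rule prob_space_exponential_density[OF r])
  define c where "c = (q i l / - q i i) * measure (path_law l) G"
  have c: "0 \<le> c" unfolding c_def using r q_off_diag_nonneg[OF i l(1)] l(2)
    by (intro mult_nonneg_nonneg divide_nonneg_pos) auto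
  define D where "D = density (path_law i) (indicator (jump_event UNIV l G))"
  define J where "J x = real_of_ereal (jump_time x (Suc 0))" for x
  have em: "emeasure (distr D borel J) A = emeasure (path_law i) (jump_event A l G)"
    if A: "A \<in> sets borel" for A
  proof -
    have "J \<in> path_law i \<rightarrow>\<^sub>M borel"
      unfolding J_def using measurable_jump_time[of "Suc 0" S]
      by (simp cong: measurable_cong_sets del: jump_time.simps)
    from emeasure_distr_restricted[OF this _ A, of "jump_event UNIV l G"]
    have "emeasure (distr D borel J) A = emeasure (path_law i) (jump_event UNIV l G \<inter> (J -` A \<inter> paths S))"
      using sets_jump_event[OF _ G] by (simp add: D_def)
    also have "jump_event UNIV l G \<inter> (J -` A \<inter> paths S) = jump_event A l G"
      unfolding jump_event_def J_def
        mem_image_ereal_iff[of "jump_time x (Suc 0)" A for x] by blast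
    finally show ?thesis .
  qed
  have less: "measure (path_law i) (jump_event {..<a} l G) = (if 0 < a then 1 - exp (q i i * a) else 0) * c" for a
  proof (cases "0 < a")
    case False
    have "\<not> (\<exists>s<a. jump_time x (Suc 0) = ereal s)" for x
      using jump_time_nonneg[of x "Suc 0"] False by (auto simp del: jump_time.simps)
    then have "jump_event {..<a} l G = {}" by (auto simp: jump_event_def simp del: jump_time.simps)
    then show ?thesis using False by simp
  next
    case True
    have "measure (path_law i) (jump_event {..<a} l G) = measure (path_law i) (hit_event (- {i}) l a G)"
    proof (rule measure_eq_AE)
      show "AE x in path_law i. x \<in> jump_event {..<a} l G \<longleftrightarrow> x \<in> hit_event (- {i}) l a G"
        using AE_path_law_start[OF i]
      proof eventually_elim
        case (elim x)
        have eq: "jump_time x (Suc 0) = hit (- {i}) x" unfolding jump_time_1 elim ..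
        have "hit (- {i}) x \<in> ereal ` {..<a} \<longleftrightarrow> hit (- {i}) x < ereal a"
          using hit_nonneg[of "- {i}" x] by (cases "hit (- {i}) x") auto
        then show ?case
          unfolding jump_event_def hit_event_def visited_def mem_Collect_eq eq by blast
      qed
    qed (use sets_jump_event[OF _ G] sets_hit_event[OF G] in auto)
    also have "\<dots> = measure (path_law i) (hit_event (- {i}) l a (paths S)) * measure (path_law l) G"
      using l by (intro strong_markov_hit i G) auto
    also have "\<dots> = (1 - exp (q i i * a)) * (q i l / - q i i) * measure (path_law l) G"
      by (simp only: measure_first_exit_to[OF i l q True])
    finally show ?thesis using True by (simp add: c_def)
  qed
  have "distr D borel J = scale_measure c (density lborel (exponential_density (- q i i)))"
  proof (rule measure_eqI_generator_eq[where E="range lessThan" and \<Omega>=UNIV and A="\<lambda>n. {..<real n}"])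
    show "Int_stable (range (lessThan :: real \<Rightarrow> real set))"
    proof (rule Int_stableI_image)
      fix a b :: real
      show "\<exists>c\<in>UNIV. {..<a} \<inter> {..<b} = {..<c}" by (intro bexI[of _ "min a b"]) auto
    qed
    have borel: "sets (borel :: real measure) = sigma_sets UNIV (range lessThan)"
      unfolding borel_Iio by (rule sets_measure_of) simp
    show "sets (distr D borel J) = sigma_sets UNIV (range lessThan)"
      by (simp only: sets_distr borel)
    show "sets (scale_measure c (density lborel (exponential_density (- q i i)))) = sigma_sets UNIV (range lessThan)"
      by (simp only: sets_scale_measure sets_density sets_lborel borel)
    show "(\<Union>n. {..<real n}) = UNIV" using reals_Archimedean2 by auto
    show "emeasure (distr D borel J) {..<real n} \<noteq> \<infinity>" for n
      by (simp add: em Li.emeasure_finite)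
  next
    fix B :: "real set" assume "B \<in> range lessThan"
    then obtain a where B: "B = {..<a}" by auto
    have "emeasure (distr D borel J) B = ennreal ((if 0 < a then 1 - exp (q i i * a) else 0) * c)"
      unfolding B by (simp add: em Li.emeasure_eq_measure less)
    also have "\<dots> = ennreal c * emeasure (density lborel (exponential_density (- q i i))) {..<a}"
      unfolding measure_exponential_lessThan[OF r] using c r
      by (subst ennreal_mult''[symmetric]) (auto simp: mult.commute mult_nonneg_nonpos)
    finally show "emeasure (distr D borel J) B =
        emeasure (scale_measure c (density lborel (exponential_density (- q i i)))) B"
      by (simp add: B)
  qed auto
  then have "emeasure (path_law i) (jump_event A l G) =
      ennreal c * emeasure (density lborel (exponential_density (- q i i))) A"
    using em[OF A] by simp
  then show ?thesis using c by (simp add: measure_def enn2real_mult c_def)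
qed

end


section \<open>Survival probabilities\<close>

declare jump_time.simps(2) [simp del]

lemma eventually_less_of_nat: "eventually (\<lambda>n. (a::real) < real n) sequentially"
  using filterlim_real_sequentially by (simp add: filterlim_at_top_dense)

lemma jump_time_mono: "m \<le> n \<Longrightarrow> jump_time x m \<le> jump_time x n"
proof (rule lift_Suc_mono_le[of "jump_time x"])
  fix n show "jump_time x n \<le> jump_time x (Suc n)"
    by (simp only: jump_time.simps) (auto intro!: Inf_greatest)
qed

lemma visited_between_jumps:
  assumes "jump_time x m \<le> ereal s" "ereal s < jump_time x (Suc m)"
  shows "x s = visited x m"
proof (rule ccontr)
  assume "x s \<noteq> visited x m"
  then have "jump_time x (Suc m) \<le> ereal s"
    unfolding jump_time.simps using assms(1) by (intro Inf_lower) (auto simp: visited_def)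
  then show False using assms(2) by simp
qed

text \<open>The implication counts a path without a first jump as escaping, which keeps the
  last-exit argument purely pathwise. Under the law from 0 it differs from
  \<open>escape_event\<close> by a null set.\<close>

definition escape :: "nat set \<Rightarrow> (real \<Rightarrow> nat) set" where
  "escape S = {x\<in>paths S. jump_time x (Suc 0) \<in> ereal ` UNIV \<longrightarrow>
     hit {0} (time_shift (real_of_ereal (jump_time x (Suc 0))) x) = \<infinity>}"

text \<open>Only finitely many jumps occur up to time \<open>N\<close>, so among the sojourns begun
  by then there is a last one in 0, with index \<open>k\<close>. A return to 0 after leaving this
  sojourn would take place before \<open>N\<close>, in a sojourn with a larger index.\<close>

lemma last_exit_from_0:
  assumes x: "x \<in> paths S" and x0: "x 0 = 0" and unbounded: "(SUP n. jump_time x n) = \<infinity>"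
    and bounded: "hit {0} (time_shift (real N) x) = \<infinity>"
  shows "\<exists>k. jump_time x k \<in> ereal ` UNIV \<and> visited x k = 0 \<and>
    time_shift (real_of_ereal (jump_time x k)) x \<in> escape S"
proof -
  have no_zero: "x s \<noteq> 0" if "real N \<le> s" for s
    using hit_le[of "s - real N" "time_shift (real N) x" "{0}"] bounded that
    by (auto simp: time_shift_apply)
  obtain n where n: "ereal (real N) < jump_time x n"
  proof -
    have "ereal (real N) < (SUP n. jump_time x n)" using unbounded by simp
    then show thesis using that by (auto simp: less_SUP_iff)
  qed
  \<comment> \<open>The bound \<open>n\<close> comes from non-explosion: the \<open>n\<close>-th
    jump time exceeds \<open>N\<close>, so it makes the set finite without losing any
    candidate.\<close>
  define K where "K = {k. k \<le> n \<and> jump_time x k \<le> ereal (real N) \<and> visited x k = 0}"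
  have K: "finite K" "0 \<in> K" using x0 by (auto simp: K_def)
  define k where "k = Max K"
  have kK: "k \<in> K" and k_max: "\<And>m. m \<in> K \<Longrightarrow> m \<le> k"
    using K by (auto simp: k_def intro!: Max_in)
  obtain a where a: "jump_time x k = ereal a" "0 \<le> a"
    using kK jump_time_nonneg[of x k] by (cases "jump_time x k") (auto simp: K_def)
  define y where "y = time_shift a x"
  have y: "y \<in> paths S" unfolding y_def by (rule time_shift_paths[OF x a(2)])
  have jk: "jump_time x (Suc k) = ereal a + jump_time y (Suc 0)"
    using jump_time_Suc[OF x a(1)] jump_time_1[of y] by (simp add: y_def time_shift_apply)
  have "hit {0} (time_shift (real_of_ereal (jump_time y (Suc 0))) y) = \<infinity>"
    if fin: "jump_time y (Suc 0) \<in> ereal ` UNIV"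
  proof (rule ccontr)
    assume not: "hit {0} (time_shift (real_of_ereal (jump_time y (Suc 0))) y) \<noteq> \<infinity>"
    obtain t where t: "jump_time y (Suc 0) = ereal t" using fin by blast
    have t0: "0 \<le> t" using jump_time_nonneg[of y "Suc 0"] t by (simp)
    have "hit {0} (time_shift t y) < \<infinity>" using not t by (simp add: less_top)
    from hit_attained[OF time_shift_paths[OF y t0] this] obtain r where
      r: "0 \<le> r" "time_shift t y r \<in> {0}" by blast
    define s where "s = a + t + r"
    have xs: "x s = 0" using r by (simp add: y_def time_shift_apply s_def add.assoc)
    have sN: "s < real N" using no_zero[of s] xs by (cases "s < real N") auto
    have Jk: "jump_time x (Suc k) \<le> ereal s" using jk t r by (simp add: s_def)
    have Sk: "Suc k \<le> n"
    proof (rule ccontr)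
      assume "\<not> Suc k \<le> n"
      then have "jump_time x n \<le> jump_time x (Suc k)" by (intro jump_time_mono) simp
      also have "\<dots> \<le> ereal (real N)" using Jk sN by (simp add: order_trans)
      finally show False using n by simp
    qed
    \<comment> \<open>The largest index in \<open>M\<close> belongs to the sojourn that contains the
      return time \<open>s\<close>; it is at least \<open>Suc k\<close>, against the maximality of
      \<open>k\<close>.\<close>
    define M where "M = {m. m \<le> n \<and> jump_time x m \<le> ereal s}"
    have M: "finite M" "Suc k \<in> M" using Sk Jk by (auto simp: M_def)
    define m where "m = Max M"
    have mM: "m \<in> M" and m_max: "\<And>l. l \<in> M \<Longrightarrow> l \<le> m"
      using M by (auto simp: m_def intro!: Max_in)
    have "ereal s < jump_time x (Suc m)"
    proof (rule ccontr)
      assume *: "\<not> ereal s < jump_time x (Suc m)"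
      have "m \<noteq> n"
      proof
        assume "m = n"
        then have "jump_time x n \<le> ereal s" using mM by (simp add: M_def)
        also have "\<dots> < ereal (real N)" using sN by simp
        finally show False using n by (meson less_asym)
      qed
      then have "Suc m \<in> M" using mM * by (auto simp: M_def)
      then show False using m_max[of "Suc m"] by simp
    qed
    then have "visited x m = 0" using visited_between_jumps[of x m s] mM xs by (auto simp: M_def)
    then have "m \<in> K" using mM sN by (auto simp: K_def M_def intro: order_trans)
    then show False using k_max[of m] m_max[OF M(2)] by simp
  qed
  then have "time_shift (real_of_ereal (jump_time x k)) x \<in> escape S"
    using y a by (simp add: escape_def y_def)
  then show ?thesis using kK a by (intro exI[of _ k]) (auto simp: K_def)
qed


section \<open>Consequences of transience\<close>

locale transient_ctmc = nonexplosive_ctmc +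
  assumes transient: "transient_chain S P X"
begin

lemma AE_path_law_iff:
  assumes "i \<in> S" "Measurable.pred (path_algebra S) Q"
  shows "(AE x in path_law i. Q x) \<longleftrightarrow> (AE \<omega> in P i. Q (sample_path \<omega>))"
  unfolding path_law_def using assms
  by (intro AE_distr_iff measurable_sample_path) (simp_all add: pred_def)

text \<open>Boundedness of the visiting times is restated by integers and hitting times, because an
  almost-sure statement moves to path space as a measurable predicate.\<close>

lemma AE_finitely_many_visits:
  assumes i: "i \<in> S"
  shows "AE x in path_law i. \<exists>N::nat. hit {i} (time_shift (real N) x) = \<infinity>"
proof (subst AE_path_law_iff[OF i])
  have [measurable]: "(\<lambda>x. hit {i} (time_shift (real N) x)) \<in> borel_measurable (path_algebra S)" for N :: nat
    by (rule measurable_compose[OF measurable_time_shift measurable_hit]) simp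
  show "Measurable.pred (path_algebra S) (\<lambda>x. \<exists>N::nat. hit {i} (time_shift (real N) x) = \<infinity>)"
    by measurable
  have "AE \<omega> in P i. bounded {t. 0 \<le> t \<and> X t \<omega> = i}"
    using transient i by (auto simp: transient_chain_def)
  then show "AE \<omega> in P i. \<exists>N::nat. hit {i} (time_shift (real N) (sample_path \<omega>)) = \<infinity>"
  proof eventually_elim
    case (elim \<omega>)
    then obtain a where a: "\<And>t. 0 \<le> t \<Longrightarrow> X t \<omega> = i \<Longrightarrow> \<bar>t\<bar> \<le> a"
      by (auto simp: bounded_iff)
    obtain N :: nat where N: "a < real N" using reals_Archimedean2 by blast
    have "{ereal s | s. 0 \<le> s \<and> time_shift (real N) (sample_path \<omega>) s \<in> {i}} = {}"
    proof -
      have "X (real N + s) \<omega> \<noteq> i" if "0 \<le> s" for s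
        using a[of "real N + s"] N that by auto
      then show ?thesis by (auto simp: time_shift_apply sample_path_def)
    qed
    then have "hit {i} (time_shift (real N) (sample_path \<omega>)) = \<infinity>"
      unfolding hit_def by (simp only: Inf_empty top_ereal_def)
    then show ?case by blast
  qed
qed

lemma AE_nonexplosive:
  assumes i: "i \<in> S"
  shows "AE x in path_law i. (SUP n. jump_time x n) = \<infinity>"
proof (subst AE_path_law_iff[OF i])
  show "Measurable.pred (path_algebra S) (\<lambda>x. (SUP n. jump_time x n) = \<infinity>)"
    using measurable_jump_time[of _ S] by measurable
  show "AE \<omega> in P i. (SUP n. jump_time (sample_path \<omega>) n) = \<infinity>"
    using nonexplosive i by (intro AE_I2) (simp add: sample_path_def space_P)
qed

text \<open>With \<open>q i i = 0\<close> the exit time from \<open>i\<close> would exceed every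
  integer almost surely, so the path would sit in \<open>i\<close> forever, against the boundedness
  of its visits.\<close>

lemma q_diag_neg: "i \<in> S \<Longrightarrow> q i i < 0"
proof (rule ccontr)
  assume i: "i \<in> S" and "\<not> q i i < 0"
  then have q0: "q i i = 0" using q_diag_nonpos[OF i] by simp
  interpret prob_space "path_law i" by (rule prob_space_path_law[OF i])
  have "AE x in path_law i. \<not> hit (- {i}) x < ereal (real (Suc n))" for n
  proof -
    have "Measurable.pred (path_algebra S) (\<lambda>x. hit (- {i}) x < ereal (real (Suc n)))"
      using measurable_hit[of "- {i}" S] by measurable
    then have s: "{x\<in>paths S. hit (- {i}) x < ereal (real (Suc n))} \<in> sets (path_law i)" by (simp add: pred_def)
    have "measure (path_law i) {x\<in>paths S. hit (- {i}) x < ereal (real (Suc n))} = 0"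
      using measure_first_exit_less[OF i, of "real (Suc n)"] q0 by simp
    then have "{x\<in>paths S. hit (- {i}) x < ereal (real (Suc n))} \<in> null_sets (path_law i)"
      using s by (intro null_setsI) (simp_all add: emeasure_eq_measure)
    from AE_not_in[OF this] AE_space show ?thesis by eventually_elim auto
  qed
  then have "AE x in path_law i. \<forall>n. \<not> hit (- {i}) x < ereal (real (Suc n))"
    by (simp add: AE_all_countable)
  with AE_path_law_start[OF i] AE_finitely_many_visits[OF i] have "AE x in path_law i. False"
  proof eventually_elim
    case (elim x)
    obtain N where N: "hit {i} (time_shift (real N) x) = \<infinity>" using elim by blast
    have "x (real N) \<noteq> i"
      using hit_le[of 0 "time_shift (real N) x" "{i}"] N by (auto simp: time_shift_apply)
    then have "hit (- {i}) x \<le> ereal (real N)" by (intro hit_le) auto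
    also have "\<dots> < ereal (real (Suc N))" by simp
    finally show ?case using elim by blast
  qed
  then show False by simp
qed

lemma AE_first_jump_finite:
  assumes i: "i \<in> S"
  shows "AE x in path_law i. jump_time x (Suc 0) \<in> ereal ` UNIV"
proof -
  interpret prob_space "path_law i" by (rule prob_space_path_law[OF i])
  have s: "{x\<in>paths S. hit (- {i}) x < a} \<in> sets (path_algebra S)" for a
  proof -
    have "Measurable.pred (path_algebra S) (\<lambda>x. hit (- {i}) x < a)"
      using measurable_hit[of "- {i}" S] by measurable
    then show ?thesis by (simp add: pred_def)
  qed
  have "(\<lambda>n. prob {x\<in>paths S. hit (- {i}) x < ereal (real (Suc n))}) \<longlonglongrightarrow>
      prob {x\<in>paths S. hit (- {i}) x < \<infinity>}"
  proof (rule measure_tendsto_eventually[OF finite_measure_axioms])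
    fix x assume x: "x \<in> space (path_law i)"
    show "\<forall>\<^sub>F n in sequentially. x \<in> {x\<in>paths S. hit (- {i}) x < ereal (real (Suc n))} \<longleftrightarrow>
        x \<in> {x\<in>paths S. hit (- {i}) x < \<infinity>}"
    proof (cases "hit (- {i}) x")
      case (real r)
      have "eventually (\<lambda>n. r < real (Suc n)) sequentially"
        using eventually_less_of_nat[of r] by (rule eventually_mono) simp
      then show ?thesis using x real by (auto elim: eventually_mono)
    qed (use x hit_nonneg[of "- {i}" x] in auto)
  qed (simp_all only: sets_path_law s)
  moreover have "(\<lambda>n. prob {x\<in>paths S. hit (- {i}) x < ereal (real (Suc n))}) \<longlonglongrightarrow> 1"
  proof -
    have "(\<lambda>n. exp (q i i) ^ Suc n) \<longlonglongrightarrow> 0"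
      using q_diag_neg[OF i] by (intro LIMSEQ_Suc LIMSEQ_realpow_zero) auto
    then have "(\<lambda>n. 1 - exp (q i i) ^ Suc n) \<longlonglongrightarrow> 1 - 0"
      by (intro tendsto_diff tendsto_const)
    also have "(\<lambda>n. 1 - exp (q i i) ^ Suc n) = (\<lambda>n. prob {x\<in>paths S. hit (- {i}) x < ereal (real (Suc n))})"
    proof (rule ext)
      fix n
      have "exp (q i i) ^ Suc n = exp (q i i * real (Suc n))"
        by (simp only: exp_of_nat_mult[symmetric] mult.commute)
      then show "1 - exp (q i i) ^ Suc n = prob {x\<in>paths S. hit (- {i}) x < ereal (real (Suc n))}"
        using measure_first_exit_less[OF i, of "real (Suc n)"] by simp
    qed
    finally show ?thesis by simp
  qed
  ultimately have "prob {x\<in>paths S. hit (- {i}) x < \<infinity>} = 1" by (rule LIMSEQ_unique)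
  then have "AE x in path_law i. x \<in> {x\<in>paths S. hit (- {i}) x < \<infinity>}"
    by (subst AE_in_set_eq_1) (simp_all only: sets_path_law s)
  with AE_path_law_start[OF i] show ?thesis
  proof eventually_elim
    case (elim x)
    then have "jump_time x (Suc 0) < \<infinity>" unfolding jump_time_1 by simp
    then show ?case using jump_time_nonneg[of x "Suc 0"]
      by (cases "jump_time x (Suc 0)") (auto)
  qed
qed

section \<open>Conditioning on the first jump\<close>

abbreviation exit_time_prob :: "nat \<Rightarrow> real set \<Rightarrow> real" where
  "exit_time_prob i A \<equiv> measure (density lborel (exponential_density (- q i i))) A"

abbreviation jump_prob :: "nat \<Rightarrow> nat \<Rightarrow> real" where
  "jump_prob i l \<equiv> q i l / - q i i"

text \<open>Total probability over the state entered. The event \<open>E\<close> has to match the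
  description by exit time and future only almost surely and on paths that do jump, so that
  identities valid for a fixed start suffice.\<close>

lemma first_jump_decomposition:
  assumes i: "i \<in> S" and A: "A \<in> sets borel" and G: "G \<in> sets (path_algebra S)"
    and E: "E \<in> sets (path_algebra S)"
    and eq: "AE x in path_law i. jump_time x (Suc 0) \<in> ereal ` UNIV \<longrightarrow>
      (x \<in> E \<longleftrightarrow> jump_time x (Suc 0) \<in> ereal ` A \<and>
        time_shift (real_of_ereal (jump_time x (Suc 0))) x \<in> G)"
  shows "((\<lambda>l. exit_time_prob i A * jump_prob i l * measure (path_law l) G) has_sum
    measure (path_law i) E) (S - {i})"
proof -
  interpret prob_space "path_law i" by (rule prob_space_path_law[OF i])
  \<comment> \<open>The empty set off \<open>S - {i}\<close> allows indexing by all of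
    \<open>nat\<close>, where countable additivity yields a series.\<close>
  define B where "B l = (if l \<in> S - {i} then jump_event A l G else {})" for l
  have B: "range B \<subseteq> sets (path_law i)" using sets_jump_event[OF A G] by (auto simp: B_def)
  have dis: "disjoint_family B" by (auto simp: disjoint_family_on_def B_def jump_event_def)
  have "prob E = prob (\<Union>l. B l)"
  proof (rule finite_measure_eq_AE)
    show "AE x in path_law i. x \<in> E \<longleftrightarrow> x \<in> (\<Union>l. B l)"
      using eq AE_first_jump_finite[OF i] AE_path_law_start[OF i] AE_space
    proof eventually_elim
      case (elim x)
      then have x: "x \<in> paths S" by simp
      obtain t where t: "jump_time x (Suc 0) = ereal t" using elim(2) by blast
      have "hit (- {x 0}) x < \<infinity>" using t unfolding jump_time_1 by simp
      from hit_attained[OF x this] obtain t' where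
        t': "0 \<le> t'" "hit (- {x 0}) x = ereal t'" "x t' \<in> - {x 0}" by blast
      have "t' = t" using t t'(2) unfolding jump_time_1 by simp
      then have v: "visited x (Suc 0) \<in> S - {i}"
        using t' t elim(3) paths_in[OF x, of t] by (simp add: visited_def)
      have "x \<in> (\<Union>l. B l) \<longleftrightarrow> x \<in> B (visited x (Suc 0))"
        by (auto simp: B_def jump_event_def split: if_splits)
      also have "\<dots> \<longleftrightarrow> jump_time x (Suc 0) \<in> ereal ` A \<and>
          time_shift (real_of_ereal (jump_time x (Suc 0))) x \<in> G"
        using v x by (simp add: B_def jump_event_def)
      finally show ?case using elim(1,2) by blast
    qed
  qed (use E B in auto)
  moreover have "(\<lambda>l. prob (B l)) sums prob (\<Union>l. B l)"
    by (rule finite_measure_UNION[OF B dis])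
  then have "((\<lambda>l. prob (B l)) has_sum prob (\<Union>l. B l)) UNIV"
    by (rule sums_nonneg_imp_has_sum) simp
  then have "((\<lambda>l. exit_time_prob i A * jump_prob i l * measure (path_law l) G) has_sum prob (\<Union>l. B l)) (S - {i})"
  proof (rule has_sum_cong_neutral[THEN iffD1, rotated -1])
    fix l assume "l \<in> UNIV \<inter> (S - {i})"
    then show "prob (B l) = exit_time_prob i A * jump_prob i l * measure (path_law l) G"
      using first_jump_law[OF i _ _ _ A G, of l] q_diag_neg[OF i] by (simp add: B_def)
  qed (auto simp: B_def)
  ultimately show ?thesis by simp
qed

lemma exit_time_prob_UNIV: "i \<in> S \<Longrightarrow> exit_time_prob i UNIV = 1"
  using prob_space.prob_space[OF prob_space_exponential_density, of "- q i i"] q_diag_neg by simp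

lemma exit_time_prob_atMost:
  assumes "i \<in> S" "0 \<le> a"
  shows "exit_time_prob i {..a} = 1 - exp (q i i * a)"
proof -
  have r: "0 < - q i i" using q_diag_neg[OF assms(1)] by simp
  have "emeasure (density lborel (exponential_density (- q i i))) {..a} = ennreal (erlang_CDF 0 (- q i i) a)"
    by (rule emeasure_erlang_density[OF r])
  moreover have "erlang_CDF 0 (- q i i) a = 1 - exp (q i i * a)"
    using assms(2) by (simp add: erlang_CDF_def)
  moreover have "0 \<le> 1 - exp (q i i * a)"
    using r assms(2) by (simp add: mult_nonpos_nonneg)
  ultimately show ?thesis by (simp add: measure_def)
qed

section \<open>Equations for the probability of never being killed\<close>

definition immortal :: "real \<Rightarrow> (real \<Rightarrow> nat) set" where
  "immortal u = {x\<in>paths S. tau u x = \<infinity>}"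

definition eternal_prob :: "nat \<times> real \<Rightarrow> real" where
  "eternal_prob z = measure (path_law (fst z)) (immortal (snd z))"

definition never_0_prob :: "nat \<Rightarrow> real" where
  "never_0_prob i = measure (path_law i) {x\<in>paths S. hit {0} x = \<infinity>}"

lemma sets_immortal: "immortal u \<in> sets (path_algebra S)"
proof -
  have "(\<lambda>x. (u, x)) \<in> path_algebra S \<rightarrow>\<^sub>M borel \<Otimes>\<^sub>M path_algebra S" by simp
  from measurable_compose[OF this measurable_tau_infinity]
  show ?thesis by (simp add: immortal_def pred_def)
qed

lemma sets_never_0: "{x\<in>paths S. hit {0} x = \<infinity>} \<in> sets (path_algebra S)"
proof -
  have "Measurable.pred (path_algebra S) (\<lambda>x. hit {0} x = \<infinity>)"
    using measurable_hit[of "{0}" S] by measurable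
  then show ?thesis by (simp add: pred_def)
qed

lemma sets_hit_0_shift:
  assumes G: "G \<in> sets (path_algebra S)"
  shows "{x\<in>paths S. hit {0} x < \<infinity> \<and> time_shift (real_of_ereal (hit {0} x)) x \<in> G} \<in> sets (path_algebra S)"
proof -
  have nn: "0 \<le> real_of_ereal (hit {0} x)" for x by (intro real_of_ereal_pos hit_nonneg)
  have id: "(\<lambda>x. x) \<in> path_algebra S \<rightarrow>\<^sub>M path_algebra S" by simp
  note measurable_time_shift_random[OF id measurable_hit_time[of "{0}"] nn, measurable]
    measurable_hit[of "{0}" S, measurable] G[measurable]
  have "{x\<in>space (path_algebra S). hit {0} x < \<infinity> \<and> time_shift (real_of_ereal (hit {0} x)) x \<in> G}
      \<in> sets (path_algebra S)"
    by measurable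
  then show ?thesis by simp
qed

text \<open>The horizon of the strong Markov property goes to infinity through the integers; taking
  all paths for \<open>G\<close> identifies the limit of the entry probabilities as the probability
  of ever reaching 0.\<close>

lemma strong_markov_hit_infinity:
  assumes i: "i \<in> S" and G: "G \<in> sets (path_algebra S)"
  shows "measure (path_law i) {x\<in>paths S. hit {0} x < \<infinity> \<and> time_shift (real_of_ereal (hit {0} x)) x \<in> G} =
    (1 - never_0_prob i) * measure (path_law 0) G"
proof -
  interpret prob_space "path_law i" by (rule prob_space_path_law[OF i])
  have lim: "(\<lambda>n. prob (hit_event {0} 0 (real n) G)) \<longlonglongrightarrow>
      prob {x\<in>paths S. hit {0} x < \<infinity> \<and> time_shift (real_of_ereal (hit {0} x)) x \<in> G}"
    if G: "G \<in> sets (path_algebra S)" for G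
  proof (rule measure_tendsto_eventually[OF finite_measure_axioms])
    show "hit_event {0} 0 (real n) G \<in> sets (path_law i)" for n using sets_hit_event[OF G] by simp
    show "{x\<in>paths S. hit {0} x < \<infinity> \<and> time_shift (real_of_ereal (hit {0} x)) x \<in> G} \<in> sets (path_law i)"
      using sets_hit_0_shift[OF G] by simp
    fix x assume "x \<in> space (path_law i)"
    then have x: "x \<in> paths S" by simp
    show "\<forall>\<^sub>F n in sequentially. x \<in> hit_event {0} 0 (real n) G \<longleftrightarrow>
        x \<in> {x\<in>paths S. hit {0} x < \<infinity> \<and> time_shift (real_of_ereal (hit {0} x)) x \<in> G}"
    proof (cases "hit {0} x < \<infinity>")
      case True
      from hit_attained[OF x True] obtain t where t: "hit {0} x = ereal t" "x t \<in> {0}" by blast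
      have "eventually (\<lambda>n. t < real n) sequentially"
        by (rule eventually_less_of_nat)
      then show ?thesis
        by eventually_elim (use x t in \<open>simp add: hit_event_def\<close>)
    next
      case False
      then have "x \<notin> hit_event {0} 0 (real n) G" for n by (auto simp: hit_event_def)
      then show ?thesis using False by simp
    qed
  qed
  have "prob {x\<in>paths S. hit {0} x < \<infinity> \<and> time_shift (real_of_ereal (hit {0} x)) x \<in> paths S} = 1 - never_0_prob i"
  proof -
    have eq: "{x\<in>paths S. hit {0} x < \<infinity> \<and> time_shift (real_of_ereal (hit {0} x)) x \<in> paths S} =
        space (path_law i) - {x\<in>paths S. hit {0} x = \<infinity>}"
      using time_shift_paths[OF _ real_of_ereal_pos[OF hit_nonneg]] by (auto simp: less_top)
    show ?thesis unfolding eq never_0_prob_def using sets_never_0 by (intro prob_compl) simp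
  qed
  then have "(\<lambda>n. prob (hit_event {0} 0 (real n) (paths S)) * measure (path_law 0) G) \<longlonglongrightarrow>
      (1 - never_0_prob i) * measure (path_law 0) G"
    using lim[OF path_sets_top] by (intro tendsto_mult_right) simp
  also have "(\<lambda>n. prob (hit_event {0} 0 (real n) (paths S)) * measure (path_law 0) G) =
      (\<lambda>n. prob (hit_event {0} 0 (real n) G))"
    by (intro ext strong_markov_hit[OF i _ zero_state G, symmetric]) simp
  finally show ?thesis using LIMSEQ_unique[OF lim[OF G]] by simp
qed

text \<open>A path that avoids 0 is never killed; a path that reaches 0 arrives with age 0 and
  starts afresh there by the strong Markov property.\<close>

lemma eternal_prob_off_0:
  assumes i: "i \<in> S" "i \<noteq> 0"
  shows "eternal_prob (i, u) = never_0_prob i + (1 - never_0_prob i) * eternal_prob (0, 0)"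
proof -
  interpret prob_space "path_law i" by (rule prob_space_path_law[OF i(1)])
  let ?N = "{x\<in>paths S. hit {0} x = \<infinity>}"
  let ?H = "{x\<in>paths S. hit {0} x < \<infinity> \<and> time_shift (real_of_ereal (hit {0} x)) x \<in> immortal 0}"
  have H: "?H \<in> sets (path_law i)" using sets_hit_0_shift[OF sets_immortal] by simp
  have "prob (immortal u) = prob (?N \<union> ?H)"
  proof (rule finite_measure_eq_AE)
    show "AE x in path_law i. x \<in> immortal u \<longleftrightarrow> x \<in> ?N \<union> ?H"
      using AE_path_law_start[OF i(1)] AE_space
    proof eventually_elim
      case (elim x)
      then have x: "x \<in> paths S" and x0: "x 0 \<noteq> 0" using i by auto
      show ?case
      proof (cases "hit {0} x")
        case (real t)
        then have "time_shift t x \<in> paths S"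
          using hit_nonneg[of "{0}" x] by (intro time_shift_paths[OF x]) simp
        then show ?thesis using tau_infinity_hit_0[OF x x0 real, of u] x real by (simp add: immortal_def)
      next
        case PInf
        then show ?thesis using tau_infinity_never_0[OF x PInf] x by (simp add: immortal_def)
      next
        case MInf
        then show ?thesis using hit_nonneg[of "{0}" x] by simp
      qed
    qed
  qed (use sets_immortal sets_never_0 H in auto)
  also have "\<dots> = prob ?N + prob ?H"
    using sets_never_0 H by (intro finite_measure_Union) auto
  finally show ?thesis
    by (simp only: strong_markov_hit_infinity[OF i(1) sets_immortal] eternal_prob_def never_0_prob_def fst_conv snd_conv)
qed

text \<open>The wait in 0 has to end within the remaining time \<open>1 - u\<close>. Its length is
  exponential and independent of the state entered, from which survival is required anew with age
  0.\<close>

lemma eternal_prob_at_0: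
  assumes u: "0 \<le> u" "u < 1"
  shows "((\<lambda>l. (1 - exp (q 0 0 * (1 - u))) * jump_prob 0 l * eternal_prob (l, 0)) has_sum
    eternal_prob (0, u)) (S - {0})"
proof -
  have "((\<lambda>l. exit_time_prob 0 {..1-u} * jump_prob 0 l * measure (path_law l) (immortal 0)) has_sum
    measure (path_law 0) (immortal u)) (S - {0})"
  proof (rule first_jump_decomposition[OF zero_state _ sets_immortal sets_immortal])
    show "AE x in path_law 0. jump_time x (Suc 0) \<in> ereal ` UNIV \<longrightarrow>
      (x \<in> immortal u \<longleftrightarrow> jump_time x (Suc 0) \<in> ereal ` {..1-u} \<and>
        time_shift (real_of_ereal (jump_time x (Suc 0))) x \<in> immortal 0)"
      using AE_path_law_start[OF zero_state] AE_space
    proof eventually_elim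
      case (elim x)
      then have x: "x \<in> paths S" by simp
      show ?case
      proof
        assume "jump_time x (Suc 0) \<in> ereal ` UNIV"
        then obtain t where t: "jump_time x (Suc 0) = ereal t" by blast
        have "time_shift t x \<in> paths S" using first_jump_nonneg[OF x t] by (rule time_shift_paths[OF x])
        then show "x \<in> immortal u \<longleftrightarrow> jump_time x (Suc 0) \<in> ereal ` {..1-u} \<and>
            time_shift (real_of_ereal (jump_time x (Suc 0))) x \<in> immortal 0"
          using tau_infinity_first_jump[OF x t, of u] x elim(1)
          unfolding t by (auto simp: immortal_def)
      qed
    qed
  qed simp
  then show ?thesis
    using exit_time_prob_atMost[OF zero_state, of "1 - u"] u by (simp add: eternal_prob_def)
qed

section \<open>Positivity of the escape probability\<close>

definition escape_event :: "(real \<Rightarrow> nat) set" where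
  "escape_event = {x\<in>paths S. jump_time x (Suc 0) \<in> ereal ` UNIV \<and>
     hit {0} (time_shift (real_of_ereal (jump_time x (Suc 0))) x) = \<infinity>}"

text \<open>This is the \<Delta> of the theorem, read as the probability that the first jump out of
  0 is never followed by a return.\<close>

definition escape_prob :: real where
  "escape_prob = measure (path_law 0) escape_event"

lemma sets_hit_after_jump:
  "{x\<in>paths S. hit {0} (time_shift (real_of_ereal (jump_time x (Suc 0))) x) = \<infinity>} \<in> sets (path_algebra S)"
proof -
  have [measurable]: "(\<lambda>x. hit {0} (time_shift (real_of_ereal (jump_time x (Suc 0))) x)) \<in> borel_measurable (path_algebra S)"
    by (rule measurable_compose[OF measurable_first_jump_shift measurable_hit])
  have "{x\<in>space (path_algebra S). hit {0} (time_shift (real_of_ereal (jump_time x (Suc 0))) x) = \<infinity>} \<in> sets (path_algebra S)"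
    by measurable
  then show ?thesis by (simp)
qed

lemma sets_first_jump_finite: "{x\<in>paths S. jump_time x (Suc 0) \<in> ereal ` UNIV} \<in> sets (path_algebra S)"
proof -
  note measurable_jump_time[of "Suc 0" S, measurable]
  have "{x\<in>space (path_algebra S). jump_time x (Suc 0) \<in> ereal ` UNIV} \<in> sets (path_algebra S)"
    by measurable
  then show ?thesis by (simp)
qed

lemma sets_escape: "escape S \<in> sets (path_algebra S)"
proof -
  have "escape S = (paths S - {x\<in>paths S. jump_time x (Suc 0) \<in> ereal ` UNIV}) \<union>
      {x\<in>paths S. hit {0} (time_shift (real_of_ereal (jump_time x (Suc 0))) x) = \<infinity>}"
    unfolding escape_def by blast
  also have "\<dots> \<in> sets (path_algebra S)"
    by (intro sets.Un sets.Diff path_sets_top sets_first_jump_finite sets_hit_after_jump)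
  finally show ?thesis .
qed

lemma sets_escape_event: "escape_event \<in> sets (path_algebra S)"
proof -
  have "escape_event = {x\<in>paths S. jump_time x (Suc 0) \<in> ereal ` UNIV} \<inter>
      {x\<in>paths S. hit {0} (time_shift (real_of_ereal (jump_time x (Suc 0))) x) = \<infinity>}"
    unfolding escape_event_def by blast
  then show ?thesis
    using sets.Int[OF sets_first_jump_finite sets_hit_after_jump] by simp
qed

lemma escape_prob_has_sum: "((\<lambda>l. jump_prob 0 l * never_0_prob l) has_sum escape_prob) (S - {0})"
proof -
  have "((\<lambda>l. exit_time_prob 0 UNIV * jump_prob 0 l * measure (path_law l) {x\<in>paths S. hit {0} x = \<infinity>}) has_sum
    measure (path_law 0) escape_event) (S - {0})"
  proof (rule first_jump_decomposition[OF zero_state _ sets_never_0 sets_escape_event])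
    show "AE x in path_law 0. jump_time x (Suc 0) \<in> ereal ` UNIV \<longrightarrow>
      (x \<in> escape_event \<longleftrightarrow> jump_time x (Suc 0) \<in> ereal ` UNIV \<and>
        time_shift (real_of_ereal (jump_time x (Suc 0))) x \<in> {x\<in>paths S. hit {0} x = \<infinity>})"
    proof (rule AE_I2)
      fix x assume "x \<in> space (path_law 0)"
      then have x: "x \<in> paths S" by simp
      have "time_shift (real_of_ereal (jump_time x (Suc 0))) x \<in> paths S"
        by (rule time_shift_paths[OF x real_of_ereal_pos[OF jump_time_nonneg]])
      then show "jump_time x (Suc 0) \<in> ereal ` UNIV \<longrightarrow>
          (x \<in> escape_event \<longleftrightarrow> jump_time x (Suc 0) \<in> ereal ` UNIV \<and>
            time_shift (real_of_ereal (jump_time x (Suc 0))) x \<in> {x\<in>paths S. hit {0} x = \<infinity>})"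
        unfolding escape_event_def using x by blast
    qed
  qed simp
  then show ?thesis
    unfolding escape_prob_def never_0_prob_def exit_time_prob_UNIV[OF zero_state] by simp
qed

text \<open>Total probability over the first jump with the whole path space as event, using that a
  first jump occurs almost surely.\<close>

lemma jump_prob_has_sum:
  assumes i: "i \<in> S"
  shows "(jump_prob i has_sum 1) (S - {i})"
proof -
  have "((\<lambda>l. exit_time_prob i UNIV * jump_prob i l * measure (path_law l) (paths S)) has_sum
    measure (path_law i) (paths S)) (S - {i})"
    by (rule first_jump_decomposition[OF i _ path_sets_top path_sets_top])
      (auto intro!: AE_I2 time_shift_paths real_of_ereal_pos jump_time_nonneg)
  also have "?this \<longleftrightarrow> ?thesis"
  proof -
    have 1: "measure (path_law l) (paths S) = 1" if "l \<in> S" for l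
      using prob_space.prob_space[OF prob_space_path_law[OF that]] by simp
    show ?thesis unfolding 1[OF i]
      by (rule has_sum_cong) (simp add: 1 exit_time_prob_UNIV[OF i])
  qed
  finally show ?thesis .
qed

lemma escape_prob_nonneg: "0 \<le> escape_prob"
  by (simp add: escape_prob_def)

lemma sets_escape_after_jump:
  "{x\<in>paths S. jump_time x k \<in> ereal ` UNIV \<and> visited x k = 0 \<and>
    time_shift (real_of_ereal (jump_time x k)) x \<in> escape S} \<in> sets (path_algebra S)"
proof -
  note measurable_jump_time[of k S, measurable] sets_escape[measurable]
  have "{x\<in>space (path_algebra S). jump_time x k \<in> ereal ` UNIV \<and> visited x k = 0 \<and>
    time_shift (real_of_ereal (jump_time x k)) x \<in> escape S} \<in> sets (path_algebra S)"
    by measurable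
  then show ?thesis by (simp only: space_path_algebra)
qed

lemma null_escape_after_jumps:
  assumes null: "measure (path_law 0) (escape S) = 0" and i: "i \<in> S"
  shows "measure (path_law i) {x\<in>paths S. jump_time x k \<in> ereal ` UNIV \<and> visited x k = 0 \<and>
    time_shift (real_of_ereal (jump_time x k)) x \<in> escape S} = 0"
  using i
proof (induction k arbitrary: i)
  case (0 i)
  interpret prob_space "path_law i" by (rule prob_space_path_law[OF 0])
  show ?case
  proof (cases "i = 0")
    case True
    have "prob {x\<in>paths S. jump_time x 0 \<in> ereal ` UNIV \<and> visited x 0 = 0 \<and>
        time_shift (real_of_ereal (jump_time x 0)) x \<in> escape S} \<le> prob (escape S)"
      by (rule finite_measure_mono) (use sets_escape in auto)
    also have "\<dots> = 0" using null True by simp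
    finally show ?thesis by (intro antisym measure_nonneg)
  next
    case False
    have "prob {x\<in>paths S. jump_time x 0 \<in> ereal ` UNIV \<and> visited x 0 = 0 \<and>
        time_shift (real_of_ereal (jump_time x 0)) x \<in> escape S} = prob {}"
    proof (rule finite_measure_eq_AE)
      show "AE x in path_law i. x \<in> {x\<in>paths S. jump_time x 0 \<in> ereal ` UNIV \<and> visited x 0 = 0 \<and>
        time_shift (real_of_ereal (jump_time x 0)) x \<in> escape S} \<longleftrightarrow> x \<in> {}"
        using AE_path_law_start[OF 0] by eventually_elim (use False in auto)
    qed (simp_all only: sets_path_law sets_escape_after_jump sets.empty_sets)
    then show ?thesis by simp
  qed
next
  case (Suc k i)
  interpret prob_space "path_law i" by (rule prob_space_path_law[OF Suc.prems])
  let ?G = "\<lambda>k. {x\<in>paths S. jump_time x k \<in> ereal ` UNIV \<and> visited x k = 0 \<and>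
    time_shift (real_of_ereal (jump_time x k)) x \<in> escape S}"
  have G: "?G k \<in> sets (path_algebra S)" for k by (rule sets_escape_after_jump)
  have "((\<lambda>l. exit_time_prob i UNIV * jump_prob i l * measure (path_law l) (?G k)) has_sum
    measure (path_law i) (?G (Suc k))) (S - {i})"
  proof (rule first_jump_decomposition[OF Suc.prems _ G G])
    show "AE x in path_law i. jump_time x (Suc 0) \<in> ereal ` UNIV \<longrightarrow>
      (x \<in> ?G (Suc k) \<longleftrightarrow> jump_time x (Suc 0) \<in> ereal ` UNIV \<and>
        time_shift (real_of_ereal (jump_time x (Suc 0))) x \<in> ?G k)"
    proof (rule AE_I2, rule impI)
      fix x assume "x \<in> space (path_law i)" and fin: "jump_time x (Suc 0) \<in> ereal ` UNIV"
      then have x: "x \<in> paths S" by simp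
      obtain t where t: "jump_time x (Suc 0) = ereal t" using fin by blast
      let ?y = "time_shift t x"
      have y: "?y \<in> paths S" using first_jump_nonneg[OF x t] by (rule time_shift_paths[OF x])
      have "x \<in> ?G (Suc k) \<longleftrightarrow> ?y \<in> ?G k"
      proof (cases "jump_time ?y k")
        case (real s)
        have "jump_time x (Suc k) = ereal (t + s)"
          using jump_time_time_shift[OF x t, of k] real by simp
        moreover have "visited x (Suc k) = visited ?y k"
          using visited_time_shift[OF x t, of k] real by simp
        ultimately show ?thesis using x y real by (simp add: time_shift_time_shift)
      next
        case PInf
        then have "jump_time x (Suc k) = \<infinity>" using jump_time_time_shift[OF x t, of k] by simp
        then show ?thesis using PInf by (auto)
      next
        case MInf
        then show ?thesis using jump_time_nonneg[of ?y k] by simp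
      qed
      then show "x \<in> ?G (Suc k) \<longleftrightarrow> jump_time x (Suc 0) \<in> ereal ` UNIV \<and>
          time_shift (real_of_ereal (jump_time x (Suc 0))) x \<in> ?G k"
        unfolding t by simp
    qed
  qed simp
  moreover have "((\<lambda>l. exit_time_prob i UNIV * jump_prob i l * measure (path_law l) (?G k)) has_sum 0) (S - {i})"
  proof (rule has_sum_0)
    fix l assume "l \<in> S - {i}"
    then have "l \<in> S" by simp
    then show "exit_time_prob i UNIV * jump_prob i l * measure (path_law l) (?G k) = 0"
      unfolding Suc.IH[OF \<open>l \<in> S\<close>] by (simp only: mult_zero_right)
  qed
  ultimately show ?case by (rule has_sum_unique)
qed

lemma escape_prob_pos: "0 < escape_prob"
proof (rule ccontr)
  assume "\<not> 0 < escape_prob"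
  then have zero: "escape_prob = 0" using escape_prob_nonneg by simp
  interpret prob_space "path_law 0" by (rule prob_space_path_law[OF zero_state])
  have "prob (escape S) = escape_prob"
    unfolding escape_prob_def
  proof (rule finite_measure_eq_AE)
    show "AE x in path_law 0. x \<in> escape S \<longleftrightarrow> x \<in> escape_event"
      using AE_first_jump_finite[OF zero_state]
      by eventually_elim (auto simp only: escape_def escape_event_def)
  qed (simp_all only: sets_path_law sets_escape sets_escape_event)
  then have null: "prob (escape S) = 0" using zero by simp
  let ?G = "\<lambda>k. {x\<in>paths S. jump_time x k \<in> ereal ` UNIV \<and> visited x k = 0 \<and>
    time_shift (real_of_ereal (jump_time x k)) x \<in> escape S}"
  have "AE x in path_law 0. x \<notin> ?G k" for k
  proof -
    have "?G k \<in> null_sets (path_law 0)"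
      by (intro null_setsI)
        (simp_all only: emeasure_eq_measure sets_path_law sets_escape_after_jump
          null_escape_after_jumps[OF null zero_state] ennreal_0)
    then show ?thesis by (rule AE_not_in)
  qed
  then have "\<forall>k. AE x in path_law 0. x \<notin> ?G k" by (rule allI)
  then have "AE x in path_law 0. \<forall>k. x \<notin> ?G k" unfolding AE_all_countable .
  with AE_path_law_start[OF zero_state] AE_nonexplosive[OF zero_state]
    AE_finitely_many_visits[OF zero_state] AE_space
  have "AE x in path_law 0. False"
  proof eventually_elim
    case (elim x)
    then have x: "x \<in> paths S" by simp
    obtain N where "hit {0} (time_shift (real N) x) = \<infinity>" using elim by blast
    from last_exit_from_0[OF x elim(1,2) this] show ?case using elim(5) x by blast
  qed
  then show False by simp
qed

section \<open>The explicit survival probabilities\<close>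

text \<open>Inserting the equation off 0 into the one at 0 makes the sum over entered states linear
  in the unknown \<open>p\<close>: \<open>p = (1 - e) * (escape_prob * (1 - p) + p)\<close> with
  \<open>e = exp (q 0 0)\<close>. Collecting \<open>p\<close> gives the denominator
  \<open>e + (1 - e) * escape_prob\<close>, which is positive.\<close>

lemma eternal_prob_0:
  "eternal_prob (0, 0) =
    (1 - exp (q 0 0)) * escape_prob / (exp (q 0 0) + (1 - exp (q 0 0)) * escape_prob)"
proof -
  let ?p = "eternal_prob (0, 0)" and ?e = "exp (q 0 0)"
  have "((\<lambda>l. (1 - ?e) * (jump_prob 0 l * never_0_prob l * (1 - ?p) + jump_prob 0 l * ?p)) has_sum
      (1 - ?e) * (escape_prob * (1 - ?p) + 1 * ?p)) (S - {0})"
    by (intro has_sum_cmult_right has_sum_add has_sum_cmult_left escape_prob_has_sum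
        jump_prob_has_sum zero_state)
  also have "?this \<longleftrightarrow> ((\<lambda>l. (1 - exp (q 0 0 * (1 - 0))) * jump_prob 0 l * eternal_prob (l, 0)) has_sum
      (1 - ?e) * (escape_prob * (1 - ?p) + 1 * ?p)) (S - {0})"
  proof (rule has_sum_cong)
    fix l assume l: "l \<in> S - {0}"
    then have p: "eternal_prob (l, 0) = never_0_prob l + (1 - never_0_prob l) * ?p"
      by (intro eternal_prob_off_0) auto
    have "w * b * (1 - r) + w * r = w * (b + (1 - b) * r)" for w b r :: real
      by (simp add: algebra_simps)
    then show "(1 - ?e) * (jump_prob 0 l * never_0_prob l * (1 - ?p) + jump_prob 0 l * ?p) =
        (1 - exp (q 0 0 * (1 - 0))) * jump_prob 0 l * eternal_prob (l, 0)"
      by (simp only: p diff_zero mult_1_right mult.assoc)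
  qed
  finally have "?p = (1 - ?e) * (escape_prob * (1 - ?p) + 1 * ?p)"
    by (rule has_sum_unique[OF eternal_prob_at_0, rotated -1]) simp_all
  moreover have "r * (e + (1 - e) * d) = (1 - e) * d" if "r = (1 - e) * (d * (1 - r) + 1 * r)"
    for r e d :: real
    using that by argo
  ultimately have "?p * (?e + (1 - ?e) * escape_prob) = (1 - ?e) * escape_prob" by blast
  moreover have "0 < ?e + (1 - ?e) * escape_prob"
    using q_diag_neg[OF zero_state] escape_prob_nonneg by (intro add_pos_nonneg) auto
  ultimately show ?thesis by (simp add: eq_divide_eq)
qed

lemma eternal_prob_0_pos: "0 < eternal_prob (0, 0)"
  unfolding eternal_prob_0 using q_diag_neg[OF zero_state] escape_prob_pos
  by (intro divide_pos_pos mult_pos_pos add_pos_pos) auto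

text \<open>The age enters the sum for survival from 0 only through the probability of leaving in
  time; the two sums are therefore proportional with the ratio of these probabilities.\<close>

lemma eternal_prob_0_age:
  assumes u: "0 \<le> u" "u < 1"
  shows "eternal_prob (0, u) =
    (1 - exp (q 0 0 * (1 - u))) / (1 - exp (q 0 0)) * eternal_prob (0, 0)"
proof -
  let ?c = "(1 - exp (q 0 0 * (1 - u))) / (1 - exp (q 0 0))"
  have e: "1 - exp (q 0 0) \<noteq> 0" using q_diag_neg[OF zero_state] by simp
  have "((\<lambda>l. ?c * ((1 - exp (q 0 0 * (1 - 0))) * jump_prob 0 l * eternal_prob (l, 0))) has_sum
      ?c * eternal_prob (0, 0)) (S - {0})"
    by (intro has_sum_cmult_right eternal_prob_at_0) auto
  also have "(\<lambda>l. ?c * ((1 - exp (q 0 0 * (1 - 0))) * jump_prob 0 l * eternal_prob (l, 0))) =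
      (\<lambda>l. (1 - exp (q 0 0 * (1 - u))) * jump_prob 0 l * eternal_prob (l, 0))"
    using e by (simp add: fun_eq_iff)
  finally show ?thesis by (rule has_sum_unique[OF eternal_prob_at_0[OF u]])
qed

lemma never_0_prob_bounds: "i \<in> S \<Longrightarrow> 0 \<le> never_0_prob i \<and> never_0_prob i \<le> 1"
  unfolding never_0_prob_def using prob_space.prob_le_1[OF prob_space_path_law] by simp

lemma eternal_prob_pos:
  assumes "z \<in> Shat S" shows "0 < eternal_prob z"
proof -
  obtain i u where z: "z = (i, u)" by (cases z)
  show ?thesis
  proof (cases "i = 0")
    case True
    then have u: "0 \<le> u" "u < 1" using assms by (auto simp: z Shat_def)
    have "q 0 0 * (1 - u) < 0" using q_diag_neg[OF zero_state] u by (simp add: mult_neg_pos)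
    then show ?thesis
      unfolding z True eternal_prob_0_age[OF u] using q_diag_neg[OF zero_state] eternal_prob_0_pos
      by (intro mult_pos_pos divide_pos_pos) auto
  next
    case False
    then have i: "i \<in> S" using assms by (auto simp: z Shat_def)
    let ?b = "never_0_prob i" and ?p = "eternal_prob (0, 0)"
    have "?p \<le> 1" unfolding eternal_prob_def
      using prob_space.prob_le_1[OF prob_space_path_law[OF zero_state]] by simp
    \<comment> \<open>The right-hand side is a convex combination of 1 and \<open>?p\<close>, hence
      at least \<open>?p\<close>.\<close>
    then have "?p \<le> ?b + (1 - ?b) * ?p"
      using mult_left_le[of ?p ?b] never_0_prob_bounds[OF i] by (simp add: algebra_simps)
    then show ?thesis unfolding z eternal_prob_off_0[OF i False] using eternal_prob_0_pos by simp
  qed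
qed

lemma sets_less_tau: "{x\<in>paths S. ereal t < tau u x} \<in> sets (path_algebra S)"
proof (cases "0 \<le> t")
  case True
  have "(\<lambda>x. (u, x)) \<in> path_algebra S \<rightarrow>\<^sub>M borel \<Otimes>\<^sub>M path_algebra S" by simp
  from measurable_compose[OF this measurable_less_tau[OF True]]
  show ?thesis by (simp add: pred_def)
next
  case False
  have "ereal t < tau u x" for x
  proof -
    have "ereal t < 0" using False by simp
    also have "0 \<le> tau u x" unfolding tau_eq by (rule Inf_greatest) auto
    finally show ?thesis .
  qed
  then have "{x\<in>paths S. ereal t < tau u x} = paths S" by simp
  then show ?thesis using path_sets_top by simp
qed

lemma survival_eq:
  assumes "fst z \<in> S"
  shows "survival P X z t = measure (path_law (fst z)) {x\<in>paths S. ereal t < tau (snd z) x}"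
  unfolding survival_def measure_path_law[OF assms sets_less_tau]
  using sample_path_paths assms
  by (auto simp: sample_path_def space_P intro!: arg_cong[where f="measure (P (fst z))"])

lemma survival_tendsto:
  assumes "fst z \<in> S"
  shows "(survival P X z \<longlongrightarrow> eternal_prob z) at_top"
\<comment> \<open>The limit over real times is tested along arbitrary sequences tending to infinity,
  to which the sequential convergence of measures applies.\<close>
proof (rule tendsto_at_topI_sequentially)
  fix T :: "nat \<Rightarrow> real" assume T: "filterlim T at_top sequentially"
  have "(\<lambda>n. measure (path_law (fst z)) {x\<in>paths S. ereal (T n) < tau (snd z) x}) \<longlonglongrightarrow>
      measure (path_law (fst z)) (immortal (snd z))"
  proof (rule measure_tendsto_eventually[OF finite_measure_path_law[OF assms]])
    fix x assume x: "x \<in> space (path_law (fst z))"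
    show "\<forall>\<^sub>F n in sequentially. x \<in> {x\<in>paths S. ereal (T n) < tau (snd z) x} \<longleftrightarrow> x \<in> immortal (snd z)"
    proof (cases "tau (snd z) x")
      case (real r)
      have "eventually (\<lambda>n. r \<le> T n) sequentially"
        using T by (auto simp: filterlim_at_top)
      then show ?thesis by eventually_elim (use real in \<open>simp add: immortal_def\<close>)
    next
      case MInf
      have "0 \<le> tau (snd z) x" unfolding tau_eq by (rule Inf_greatest) auto
      then show ?thesis using MInf by simp
    qed (use x in \<open>simp add: immortal_def\<close>)
  qed (use sets_less_tau sets_immortal in auto)
  then show "(\<lambda>n. survival P X z (T n)) \<longlonglongrightarrow> eternal_prob z"
    by (simp add: survival_eq[OF assms] eternal_prob_def)
qed

end


section \<open>The conditioned process\<close>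

context transient_ctmc
begin

section \<open>The killed process as a measurable function of the path\<close>

lemma space_Shat_algebra [simp]: "space (Shat_algebra S) = Shat S"
  by (simp add: Shat_algebra_def space_restrict_space space_pair_measure)

lemma measurable_Shat_fst: "fst \<in> Shat_algebra S \<rightarrow>\<^sub>M count_space S"
proof -
  have "fst \<in> Shat_algebra S \<rightarrow>\<^sub>M count_space UNIV"
    unfolding Shat_algebra_def by (rule measurable_restrict_space1[OF measurable_fst])
  then have "fst \<in> Shat_algebra S \<rightarrow>\<^sub>M restrict_space (count_space UNIV) S"
    by (intro measurable_restrict_space2) (auto simp: Shat_def)
  then show ?thesis by (simp add: restrict_count_space)
qed

lemma measurable_Shat_snd: "snd \<in> Shat_algebra S \<rightarrow>\<^sub>M borel"
  unfolding Shat_algebra_def by (rule measurable_restrict_space1[OF measurable_snd])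

lemma measurable_Shat_law:
  "(\<lambda>z. path_law (fst z)) \<in> Shat_algebra S \<rightarrow>\<^sub>M subprob_algebra (path_algebra S)"
  by (rule measurable_prob_algebraD[OF measurable_compose[OF measurable_Shat_fst measurable_path_law_kernel]])

lemma measurable_age_path:
  "(\<lambda>p. (snd (fst p), snd p)) \<in> Shat_algebra S \<Otimes>\<^sub>M path_algebra S \<rightarrow>\<^sub>M borel \<Otimes>\<^sub>M path_algebra S"
  by (intro measurable_Pair measurable_compose[OF measurable_fst measurable_Shat_snd] measurable_snd)

lemma pred_joint_less_tau:
  assumes "0 \<le> t"
  shows "Measurable.pred (Shat_algebra S \<Otimes>\<^sub>M path_algebra S) (\<lambda>p. ereal t < tau (snd (fst p)) (snd p))"
  using measurable_compose[OF measurable_age_path measurable_less_tau[OF assms]] by simp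

lemma pred_joint_immortal:
  "Measurable.pred (Shat_algebra S \<Otimes>\<^sub>M path_algebra S) (\<lambda>p. snd p \<in> immortal (snd (fst p)))"
proof -
  have "Measurable.pred (Shat_algebra S \<Otimes>\<^sub>M path_algebra S) (\<lambda>p. tau (snd (fst p)) (snd p) = \<infinity>)"
    using measurable_compose[OF measurable_age_path measurable_tau_infinity] by simp
  also have "?this \<longleftrightarrow> ?thesis"
    by (rule measurable_cong) (auto simp: space_pair_measure immortal_def)
  finally show ?thesis .
qed

text \<open>Past the killing time the clipped process rests in the arbitrary state \<open>(0, 0)\<close>, so that it
  is measurable into \<open>Shat_algebra S\<close> on the whole path space.\<close>

definition clipped :: "real \<Rightarrow> nat \<times> real \<Rightarrow> (real \<Rightarrow> nat) \<Rightarrow> nat \<times> real" where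
  "clipped t z x = (if ereal t < tau (snd z) x then Xhat (snd z) x t else (0, 0))"

lemma Shat_nonneg: "z \<in> Shat S \<Longrightarrow> 0 \<le> snd z"
  by (auto simp: Shat_def split: if_splits)

lemma Shat_fst: "z \<in> Shat S \<Longrightarrow> fst z \<in> S"
  by (auto simp: Shat_def)

lemma Xhat_Shat:
  assumes x: "x \<in> paths S" and u: "0 \<le> u" and t: "0 \<le> t" and less: "ereal t < tau u x"
  shows "Xhat u x t \<in> Shat S"
proof -
  have "age u x t < 1" using less t by (simp add: less_tau_iff[OF x])
  then show ?thesis
    using age_nonneg[OF u t, of x] age_nonzero[of x t u] paths_in[OF x t]
    by (auto simp: Xhat_eq Shat_def)
qed

lemma clipped_Shat:
  assumes "z \<in> Shat S" "x \<in> paths S" "0 \<le> t"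
  shows "clipped t z x \<in> Shat S"
  using Xhat_Shat[OF assms(2) Shat_nonneg[OF assms(1)] assms(3)] zero_state
  by (auto simp: clipped_def Shat_def)

lemma clipped_start:
  assumes "z \<in> Shat S" "x 0 = fst z" "x \<in> immortal (snd z)"
  shows "clipped 0 z x = z"
  using assms by (cases z) (auto simp: clipped_def immortal_def Xhat_eq age_0 Shat_def)

lemma sets_Shat_singleton:
  assumes "z \<in> Shat S" shows "{z} \<in> sets (Shat_algebra S)"
proof -
  obtain i u where z: "z = (i, u)" by (cases z)
  have "{i} \<times> {u} \<in> sets (count_space UNIV \<Otimes>\<^sub>M borel)" by (rule pair_measureI) auto
  then have "{(i, u)} \<in> sets (count_space UNIV \<Otimes>\<^sub>M borel)" by simp
  then have "Shat S \<inter> {(i, u)} \<in> sets (Shat_algebra S)"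
    unfolding Shat_algebra_def sets_restrict_space by (rule imageI)
  then show ?thesis using assms by (simp add: z)
qed

lemma measurable_clipped:
  assumes t: "0 \<le> t"
  shows "(\<lambda>p. clipped t (fst p) (snd p)) \<in> Shat_algebra S \<Otimes>\<^sub>M path_algebra S \<rightarrow>\<^sub>M Shat_algebra S"
  unfolding Shat_algebra_def[of S, THEN arg_cong[where f="\<lambda>N. measurable M N" for M]]
proof (rule measurable_restrict_space2)
  show "(\<lambda>p. clipped t (fst p) (snd p)) \<in> space (Shat_algebra S \<Otimes>\<^sub>M path_algebra S) \<rightarrow> Shat S"
    using clipped_Shat t by (auto simp: space_pair_measure)
  have a: "(\<lambda>p. age (snd (fst p)) (snd p) t) \<in> borel_measurable (Shat_algebra S \<Otimes>\<^sub>M path_algebra S)"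
    using measurable_compose[OF measurable_age_path measurable_age[OF t]] by simp
  have e: "(\<lambda>p. snd p t) \<in> Shat_algebra S \<Otimes>\<^sub>M path_algebra S \<rightarrow>\<^sub>M count_space UNIV"
    by (rule measurable_compose[OF measurable_snd measurable_path_eval_UNIV[OF t]])
  have "(\<lambda>p. if ereal t < tau (snd (fst p)) (snd p) then (snd p t, age (snd (fst p)) (snd p) t) else (0, 0))
      \<in> Shat_algebra S \<Otimes>\<^sub>M path_algebra S \<rightarrow>\<^sub>M count_space UNIV \<Otimes>\<^sub>M borel"
    using pred_joint_less_tau[OF t] a e
    by (intro measurable_If measurable_Pair) (auto simp: space_pair_measure pred_def)
  then show "(\<lambda>p. clipped t (fst p) (snd p)) \<in> Shat_algebra S \<Otimes>\<^sub>M path_algebra S \<rightarrow>\<^sub>M count_space UNIV \<Otimes>\<^sub>M borel"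
    unfolding clipped_def Xhat_eq .
qed

lemma measurable_clipped_path:
  assumes z: "z \<in> Shat S" and t: "0 \<le> t"
  shows "clipped t z \<in> path_algebra S \<rightarrow>\<^sub>M Shat_algebra S"
proof -
  have "(\<lambda>x. (z, x)) \<in> path_algebra S \<rightarrow>\<^sub>M Shat_algebra S \<Otimes>\<^sub>M path_algebra S"
    using z by (intro measurable_Pair measurable_const) auto
  from measurable_compose[OF this measurable_clipped[OF t]] show ?thesis by simp
qed

lemma less_tau_stop:
  assumes x: "x \<in> paths S" and t: "0 \<le> t"
  shows "ereal t < tau u (stop t x) \<longleftrightarrow> ereal t < tau u x"
  unfolding less_tau_iff[OF x t] less_tau_iff[OF stop_paths[OF x t] t]
  by (intro ball_cong refl) (simp add: age_stop)

text \<open>Adaptedness: neither survival up to \<open>t\<close> nor the state and age at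
  \<open>t\<close> change when the path is stopped at \<open>t\<close>.\<close>

lemma measurable_clipped_past:
  assumes z: "z \<in> Shat S" and t: "0 \<le> t"
  shows "clipped t z \<in> past S t \<rightarrow>\<^sub>M Shat_algebra S"
  by (rule measurable_pastI[OF t measurable_clipped_path[OF assms]])
    (simp add: clipped_def less_tau_stop t Xhat_eq age_stop stop_eval)

section \<open>The Doob transform\<close>

definition alive :: "real \<Rightarrow> nat \<times> real \<Rightarrow> (real \<Rightarrow> nat) set" where
  "alive t z = {x\<in>paths S. ereal t < tau (snd z) x}"

lemma sets_alive_past:
  assumes t: "0 \<le> t" shows "alive t z \<in> sets (past S t)"
proof -
  have "Measurable.pred (path_algebra S) (\<lambda>x. ereal t < tau (snd z) x)"
    using sets_less_tau[of t "snd z"] by (simp add: pred_def)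
  then have "Measurable.pred (past S t) (\<lambda>x. ereal t < tau (snd z) x)"
    by (rule measurable_pastI[OF t]) (simp add: less_tau_stop t)
  then show ?thesis by (simp add: pred_def alive_def)
qed

lemma sets_alive: "alive t z \<in> sets (path_algebra S)"
  unfolding alive_def by (rule sets_less_tau)

lemma clipped_alive: "x \<in> alive t z \<Longrightarrow> clipped t z x = (x t, age (snd z) x t)"
  by (simp add: alive_def clipped_def Xhat_eq)

text \<open>The integrand may depend on the present state together with its age, which is what the
  survival of the future path is judged by. On \<open>alive t z\<close> the clipped state is the
  actual one, so its first component names the law of the future.\<close>

lemma markov_hat:
  assumes z: "z \<in> Shat S" and t: "0 \<le> t" and A: "A \<in> sets (past S t)"
    and f: "(\<lambda>(w, y). f w y) \<in> borel_measurable (Shat_algebra S \<Otimes>\<^sub>M path_algebra S)"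
  shows "(\<integral>\<^sup>+x. f (clipped t z x) (time_shift t x) * indicator (A \<inter> alive t z) x \<partial>path_law (fst z)) =
    (\<integral>\<^sup>+x. (\<integral>\<^sup>+y. f (clipped t z x) y \<partial>path_law (fst (clipped t z x))) * indicator (A \<inter> alive t z) x
      \<partial>path_law (fst z))"
proof -
  define F where "F x y = f (clipped t z x) y * indicator (A \<inter> alive t z) x" for x y
  have AA: "A \<inter> alive t z \<in> sets (past S t)" using A sets_alive_past[OF t] by (rule sets.Int)
  have c: "(\<lambda>p. (clipped t z (fst p), snd p)) \<in> past S t \<Otimes>\<^sub>M path_algebra S \<rightarrow>\<^sub>M Shat_algebra S \<Otimes>\<^sub>M path_algebra S"
    by (intro measurable_Pair measurable_compose[OF measurable_fst measurable_clipped_past[OF z t]] measurable_snd)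
  have "(\<lambda>p. f (clipped t z (fst p)) (snd p)) \<in> borel_measurable (past S t \<Otimes>\<^sub>M path_algebra S)"
    using measurable_compose[OF c f] by simp
  moreover have "(\<lambda>p. indicator (A \<inter> alive t z) (fst p) :: ennreal) \<in> borel_measurable (past S t \<Otimes>\<^sub>M path_algebra S)"
    by (rule measurable_compose[OF measurable_fst borel_measurable_indicator[OF AA]])
  ultimately have "(\<lambda>(x, y). F x y) \<in> borel_measurable (past S t \<Otimes>\<^sub>M path_algebra S)"
    unfolding F_def case_prod_beta by (rule borel_measurable_times_ennreal)
  from markov_joint[OF Shat_fst[OF z] t this]
  have "(\<integral>\<^sup>+x. F x (time_shift t x) \<partial>path_law (fst z)) =
      (\<integral>\<^sup>+x. (\<integral>\<^sup>+y. F x y \<partial>path_law (x t)) \<partial>path_law (fst z))" .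
  also have "\<dots> = (\<integral>\<^sup>+x. (\<integral>\<^sup>+y. f (clipped t z x) y \<partial>path_law (fst (clipped t z x))) *
      indicator (A \<inter> alive t z) x \<partial>path_law (fst z))"
  proof (rule nn_integral_cong)
    fix x assume "x \<in> space (path_law (fst z))"
    show "(\<integral>\<^sup>+y. F x y \<partial>path_law (x t)) =
        (\<integral>\<^sup>+y. f (clipped t z x) y \<partial>path_law (fst (clipped t z x))) * indicator (A \<inter> alive t z) x"
      by (cases "x \<in> A \<inter> alive t z") (auto simp: F_def clipped_alive)
  qed
  finally show ?thesis by (simp only: F_def)
qed

lemma eternal_prob_nn_integral:
  assumes "w \<in> Shat S"
  shows "(\<integral>\<^sup>+y. indicator (immortal (snd w)) y \<partial>path_law (fst w)) = ennreal (eternal_prob w)"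
  using finite_measure.emeasure_eq_measure[OF finite_measure_path_law[OF Shat_fst[OF assms]]]
    sets_immortal by (simp add: eternal_prob_def)

lemma eternal_prob_measurable: "(\<lambda>w. ennreal (eternal_prob w)) \<in> borel_measurable (Shat_algebra S)"
proof -
  have "(\<lambda>p. indicator (immortal (snd (fst p))) (snd p) :: ennreal) \<in>
      borel_measurable (Shat_algebra S \<Otimes>\<^sub>M path_algebra S)"
    using pred_joint_immortal by (intro borel_measurable_indicator') (simp add: pred_def)
  then have "(\<lambda>(w, y). indicator (immortal (snd w)) y :: ennreal) \<in>
      borel_measurable (Shat_algebra S \<Otimes>\<^sub>M path_algebra S)"
    by (simp add: case_prod_beta)
  from nn_integral_measurable_subprob_algebra2[OF this measurable_Shat_law]
  show ?thesis by (rule measurable_cong[THEN iffD1, rotated]) (simp add: eternal_prob_nn_integral)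
qed

lemma joint_indicator_measurable:
  "(\<lambda>p. indicator (immortal (snd (fst p))) (snd p) :: ennreal) \<in>
      borel_measurable (Shat_algebra S \<Otimes>\<^sub>M path_algebra S)"
  using pred_joint_immortal by (intro borel_measurable_indicator') (simp add: pred_def)

lemma immortal_time_shift:
  assumes "x \<in> paths S" "0 \<le> t"
  shows "x \<in> immortal (snd z) \<longleftrightarrow> x \<in> alive t z \<and> time_shift t x \<in> immortal (age (snd z) x t)"
  using tau_infinity_time_shift[OF assms, of "snd z"] time_shift_paths[OF assms] assms(1)
  by (auto simp: immortal_def alive_def)

text \<open>Given the past up to \<open>t\<close> and survival so far, the probability of surviving
  forever is \<open>eternal_prob\<close> of the present state. Here this is integrated against an
  arbitrary past event and an arbitrary function of the present.\<close>

lemma conditioning_identity: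
  assumes z: "z \<in> Shat S" and t: "0 \<le> t" and A: "A \<in> sets (past S t)"
    and g: "g \<in> borel_measurable (Shat_algebra S)"
  shows "(\<integral>\<^sup>+x. g (clipped t z x) * indicator (A \<inter> immortal (snd z)) x \<partial>path_law (fst z)) =
    (\<integral>\<^sup>+x. g (clipped t z x) * ennreal (eternal_prob (clipped t z x)) * indicator (A \<inter> alive t z) x
      \<partial>path_law (fst z))"
proof -
  let ?f = "\<lambda>w y. g w * indicator (immortal (snd w)) y"
  have "(\<lambda>p. g (fst p) * indicator (immortal (snd (fst p))) (snd p)) \<in>
      borel_measurable (Shat_algebra S \<Otimes>\<^sub>M path_algebra S)"
    by (intro borel_measurable_times_ennreal joint_indicator_measurable measurable_compose[OF measurable_fst g])
  then have f: "(\<lambda>(w, y). ?f w y) \<in> borel_measurable (Shat_algebra S \<Otimes>\<^sub>M path_algebra S)"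
    by (simp add: case_prod_beta)
  have "(\<integral>\<^sup>+x. g (clipped t z x) * indicator (A \<inter> immortal (snd z)) x \<partial>path_law (fst z)) =
      (\<integral>\<^sup>+x. ?f (clipped t z x) (time_shift t x) * indicator (A \<inter> alive t z) x \<partial>path_law (fst z))"
  proof (rule nn_integral_cong)
    fix x assume "x \<in> space (path_law (fst z))"
    then have x: "x \<in> paths S" by simp
    show "g (clipped t z x) * indicator (A \<inter> immortal (snd z)) x =
        ?f (clipped t z x) (time_shift t x) * indicator (A \<inter> alive t z) x"
      using immortal_time_shift[OF x t, of z]
      by (cases "x \<in> alive t z") (auto simp: clipped_alive indicator_def)
  qed
  also have "\<dots> = (\<integral>\<^sup>+x. (\<integral>\<^sup>+y. ?f (clipped t z x) y \<partial>path_law (fst (clipped t z x))) *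
      indicator (A \<inter> alive t z) x \<partial>path_law (fst z))"
    by (rule markov_hat[OF z t A f])
  also have "\<dots> = (\<integral>\<^sup>+x. g (clipped t z x) * ennreal (eternal_prob (clipped t z x)) *
      indicator (A \<inter> alive t z) x \<partial>path_law (fst z))"
  proof (rule nn_integral_cong)
    fix x assume "x \<in> space (path_law (fst z))"
    then have "clipped t z x \<in> Shat S" using z t by (intro clipped_Shat) auto
    from eternal_prob_nn_integral[OF this]
    have "(\<integral>\<^sup>+y. ?f (clipped t z x) y \<partial>path_law (fst (clipped t z x))) =
        g (clipped t z x) * ennreal (eternal_prob (clipped t z x))"
      using sets_immortal by (subst nn_integral_cmult) simp_all
    then show "(\<integral>\<^sup>+y. ?f (clipped t z x) y \<partial>path_law (fst (clipped t z x))) * indicator (A \<inter> alive t z) x =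
        g (clipped t z x) * ennreal (eternal_prob (clipped t z x)) * indicator (A \<inter> alive t z) x"
      by simp
  qed
  finally show ?thesis .
qed

lemma sets_Phat [simp]: "sets (Phat S P X t z) = sets (Shat_algebra S)"
  by (simp add: Phat_def)

lemma space_Phat [simp]: "space (Phat S P X t z) = Shat S"
  by (simp add: Phat_def)

lemma nn_integral_Phat:
  assumes z: "z \<in> Shat S" and t: "0 \<le> t" and g: "g \<in> borel_measurable (Shat_algebra S)"
  shows "(\<integral>\<^sup>+y. g y \<partial>Phat S P X t z) =
    (\<integral>\<^sup>+x. g (clipped t z x) * indicator (alive t z) x \<partial>path_law (fst z))"
proof -
  let ?i = "fst z" and ?u = "snd z"
  have i: "?i \<in> S" by (rule Shat_fst[OF z])
  let ?E = "{\<omega>\<in>space (P ?i). ereal t < tau ?u (\<lambda>s. X s \<omega>)}"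
  have pth: "sample_path \<omega> \<in> paths S" if "\<omega> \<in> space (P ?i)" for \<omega>
    using that sample_path_paths by (simp add: space_P[OF i])
  have E: "?E = sample_path -` alive t z \<inter> space (P ?i)"
    using pth by (auto simp: alive_def sample_path_def)
  have EM: "?E \<in> sets (P ?i)"
    unfolding E by (rule measurable_sets[OF measurable_sample_path[OF i] sets_alive])
  have c: "(\<lambda>\<omega>. clipped t z (sample_path \<omega>)) \<in> P ?i \<rightarrow>\<^sub>M Shat_algebra S"
    by (rule measurable_compose[OF measurable_sample_path[OF i] measurable_clipped_path[OF z t]])
  have "(\<lambda>\<omega>. Xhat ?u (\<lambda>s. X s \<omega>) t) \<in> restrict_space (P ?i) ?E \<rightarrow>\<^sub>M Shat_algebra S \<longleftrightarrow>
      (\<lambda>\<omega>. clipped t z (sample_path \<omega>)) \<in> restrict_space (P ?i) ?E \<rightarrow>\<^sub>M Shat_algebra S"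
    by (rule measurable_cong) (auto simp: space_restrict_space clipped_def sample_path_def)
  then have m: "(\<lambda>\<omega>. Xhat ?u (\<lambda>s. X s \<omega>) t) \<in> restrict_space (P ?i) ?E \<rightarrow>\<^sub>M Shat_algebra S"
    using measurable_restrict_space1[OF c] by simp
  have "(\<integral>\<^sup>+y. g y \<partial>Phat S P X t z) = (\<integral>\<^sup>+\<omega>. g (Xhat ?u (\<lambda>s. X s \<omega>) t) \<partial>restrict_space (P ?i) ?E)"
    unfolding Phat_def using g by (subst nn_integral_distr[OF m]) simp_all
  also have "\<dots> = (\<integral>\<^sup>+\<omega>. g (Xhat ?u (\<lambda>s. X s \<omega>) t) * indicator ?E \<omega> \<partial>P ?i)"
    using EM by (intro nn_integral_restrict_space) simp
  also have "\<dots> = (\<integral>\<^sup>+\<omega>. g (clipped t z (sample_path \<omega>)) * indicator (alive t z) (sample_path \<omega>) \<partial>P ?i)"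
    using pth by (intro nn_integral_cong) (auto simp: indicator_def alive_def clipped_def sample_path_def)
  also have "\<dots> = (\<integral>\<^sup>+x. g (clipped t z x) * indicator (alive t z) x \<partial>path_law ?i)"
  proof -
    have "(\<lambda>x. g (clipped t z x) * indicator (alive t z) x) \<in> borel_measurable (path_algebra S)"
      by (intro borel_measurable_times_ennreal borel_measurable_indicator sets_alive
          measurable_compose[OF measurable_clipped_path[OF z t] g])
    then show ?thesis
      unfolding path_law_def by (subst nn_integral_distr[OF measurable_sample_path[OF i]]) simp_all
  qed
  finally show ?thesis .
qed

text \<open>The kernel \<open>Pinf\<close> with \<open>eternal_prob\<close> in place of the explicit
  \<open>p\<close>; the two functions are identified on \<open>Shat S\<close> only.\<close>

definition cond_kernel :: "real \<Rightarrow> nat \<times> real \<Rightarrow> (nat \<times> real) measure" where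
  "cond_kernel t z = density (Phat S P X t z) (\<lambda>y. ennreal (eternal_prob y / eternal_prob z))"

lemma sets_cond_kernel [simp]: "sets (cond_kernel t z) = sets (Shat_algebra S)"
  by (simp add: cond_kernel_def)

lemma space_cond_kernel [simp]: "space (cond_kernel t z) = Shat S"
  by (simp add: cond_kernel_def)

lemma density_measurable:
  assumes "z \<in> Shat S"
  shows "(\<lambda>y. ennreal (eternal_prob y / eternal_prob z)) \<in> borel_measurable (Shat_algebra S)"
proof -
  have "(\<lambda>y. ennreal (eternal_prob y) * ennreal (1 / eternal_prob z)) \<in> borel_measurable (Shat_algebra S)"
    by (intro borel_measurable_times_ennreal eternal_prob_measurable measurable_const) simp
  also have "(\<lambda>y. ennreal (eternal_prob y) * ennreal (1 / eternal_prob z)) =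
      (\<lambda>y. ennreal (eternal_prob y / eternal_prob z))"
    by (simp add: fun_eq_iff ennreal_mult'[symmetric] eternal_prob_def)
  finally show ?thesis .
qed

text \<open>The weighted killed semigroup is the law of the present state given survival forever.
  Total mass 1, measurability in the start and the Chapman-Kolmogorov equation are all read off this
  representation.\<close>

lemma nn_integral_cond_kernel:
  assumes z: "z \<in> Shat S" and t: "0 \<le> t" and g: "g \<in> borel_measurable (Shat_algebra S)"
  shows "(\<integral>\<^sup>+y. g y \<partial>cond_kernel t z) =
    (\<integral>\<^sup>+x. g (clipped t z x) * indicator (immortal (snd z)) x \<partial>path_law (fst z)) * ennreal (1 / eternal_prob z)"
proof -
  let ?c = "ennreal (1 / eternal_prob z)"
  have meas: "(\<lambda>x. g (clipped t z x) * ennreal (eternal_prob (clipped t z x)) * indicator (alive t z) x)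
      \<in> borel_measurable (path_algebra S)"
    by (intro borel_measurable_times_ennreal borel_measurable_indicator sets_alive
        measurable_compose[OF measurable_clipped_path[OF z t] g]
        measurable_compose[OF measurable_clipped_path[OF z t] eternal_prob_measurable])
  have "(\<integral>\<^sup>+y. g y \<partial>cond_kernel t z) =
      (\<integral>\<^sup>+y. ennreal (eternal_prob y / eternal_prob z) * g y \<partial>Phat S P X t z)"
    unfolding cond_kernel_def using density_measurable[OF z] g
    by (intro nn_integral_density) (simp_all cong: measurable_cong_sets)
  also have "\<dots> = (\<integral>\<^sup>+x. ennreal (eternal_prob (clipped t z x) / eternal_prob z) * g (clipped t z x) *
      indicator (alive t z) x \<partial>path_law (fst z))"
    by (rule nn_integral_Phat[OF z t]) (intro borel_measurable_times_ennreal density_measurable z g)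
  also have "\<dots> = (\<integral>\<^sup>+x. (g (clipped t z x) * ennreal (eternal_prob (clipped t z x)) * indicator (alive t z) x) * ?c
      \<partial>path_law (fst z))"
  proof (rule nn_integral_cong)
    fix x
    have "ennreal (eternal_prob (clipped t z x) / eternal_prob z) = ennreal (eternal_prob (clipped t z x)) * ?c"
      by (simp add: ennreal_mult'[symmetric] eternal_prob_def)
    then show "ennreal (eternal_prob (clipped t z x) / eternal_prob z) * g (clipped t z x) *
        indicator (alive t z) x =
      (g (clipped t z x) * ennreal (eternal_prob (clipped t z x)) * indicator (alive t z) x) * ?c"
      by (simp add: ac_simps)
  qed
  also have "\<dots> = (\<integral>\<^sup>+x. g (clipped t z x) * ennreal (eternal_prob (clipped t z x)) *
      indicator (alive t z) x \<partial>path_law (fst z)) * ?c"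
    using meas by (intro nn_integral_multc) (simp cong: measurable_cong_sets)
  also have "(\<integral>\<^sup>+x. g (clipped t z x) * ennreal (eternal_prob (clipped t z x)) *
      indicator (alive t z) x \<partial>path_law (fst z)) =
      (\<integral>\<^sup>+x. g (clipped t z x) * indicator (immortal (snd z)) x \<partial>path_law (fst z))"
  proof -
    have top: "paths S \<in> sets (past S t)" using sets.top[of "past S t"] by simp
    have "paths S \<inter> immortal (snd z) = immortal (snd z)" "paths S \<inter> alive t z = alive t z"
      by (auto simp: immortal_def alive_def)
    then show ?thesis using conditioning_identity[OF z t top g] by simp
  qed
  finally show ?thesis .
qed

lemma emeasure_cond_kernel:
  assumes z: "z \<in> Shat S" and t: "0 \<le> t" and B: "B \<in> sets (Shat_algebra S)"
  shows "emeasure (cond_kernel t z) B =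
    (\<integral>\<^sup>+x. indicator B (clipped t z x) * indicator (immortal (snd z)) x \<partial>path_law (fst z)) *
      ennreal (1 / eternal_prob z)"
proof -
  have "emeasure (cond_kernel t z) B = (\<integral>\<^sup>+y. indicator B y \<partial>cond_kernel t z)"
    using B by simp
  also have "\<dots> = (\<integral>\<^sup>+x. indicator B (clipped t z x) * indicator (immortal (snd z)) x \<partial>path_law (fst z)) *
      ennreal (1 / eternal_prob z)"
    using B by (intro nn_integral_cond_kernel z t) simp
  finally show ?thesis .
qed

lemma eternal_prob_cancel: "z \<in> Shat S \<Longrightarrow> ennreal (eternal_prob z) * ennreal (1 / eternal_prob z) = 1"
  using eternal_prob_pos[of z] by (simp add: ennreal_mult'[symmetric])

lemma prob_space_cond_kernel:
  assumes z: "z \<in> Shat S" and t: "0 \<le> t"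
  shows "prob_space (cond_kernel t z)"
proof
  have "Shat S \<in> sets (Shat_algebra S)" using sets.top[of "Shat_algebra S"] by simp
  from emeasure_cond_kernel[OF z t this]
  have "emeasure (cond_kernel t z) (Shat S) =
    (\<integral>\<^sup>+x. indicator (Shat S) (clipped t z x) * indicator (immortal (snd z)) x \<partial>path_law (fst z)) *
      ennreal (1 / eternal_prob z)" .
  also have "(\<integral>\<^sup>+x. indicator (Shat S) (clipped t z x) * indicator (immortal (snd z)) x \<partial>path_law (fst z)) =
      (\<integral>\<^sup>+x. indicator (immortal (snd z)) x \<partial>path_law (fst z))"
    using clipped_Shat[OF z _ t] by (intro nn_integral_cong) simp
  finally show "emeasure (cond_kernel t z) (space (cond_kernel t z)) = 1"
    using eternal_prob_cancel[OF z] eternal_prob_nn_integral[OF z] by simp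
qed

lemma measurable_cond_kernel_integral:
  assumes t: "0 \<le> t" and g: "g \<in> borel_measurable (Shat_algebra S)"
  shows "(\<lambda>z. \<integral>\<^sup>+y. g y \<partial>cond_kernel t z) \<in> borel_measurable (Shat_algebra S)"
proof -
  have "(\<lambda>p. g (clipped t (fst p) (snd p)) * indicator (immortal (snd (fst p))) (snd p)) \<in>
      borel_measurable (Shat_algebra S \<Otimes>\<^sub>M path_algebra S)"
    by (intro borel_measurable_times_ennreal joint_indicator_measurable measurable_compose[OF measurable_clipped[OF t] g])
  then have "(\<lambda>(z, x). g (clipped t z x) * indicator (immortal (snd z)) x) \<in>
      borel_measurable (Shat_algebra S \<Otimes>\<^sub>M path_algebra S)"
    by (simp add: case_prod_beta)
  from nn_integral_measurable_subprob_algebra2[OF this measurable_Shat_law]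
  have 1: "(\<lambda>z. \<integral>\<^sup>+x. g (clipped t z x) * indicator (immortal (snd z)) x \<partial>path_law (fst z)) \<in>
      borel_measurable (Shat_algebra S)" .
  have "(\<lambda>z. (\<integral>\<^sup>+x. g (clipped t z x) * indicator (immortal (snd z)) x \<partial>path_law (fst z)) *
      inverse (ennreal (eternal_prob z))) \<in> borel_measurable (Shat_algebra S)"
    using 1 eternal_prob_measurable by (intro borel_measurable_times_ennreal borel_measurable_inverse_ennreal)
  then show ?thesis
  proof (rule measurable_cong[THEN iffD1, rotated])
    fix z assume "z \<in> space (Shat_algebra S)"
    then have z: "z \<in> Shat S" by simp
    show "(\<integral>\<^sup>+x. g (clipped t z x) * indicator (immortal (snd z)) x \<partial>path_law (fst z)) *
        inverse (ennreal (eternal_prob z)) = (\<integral>\<^sup>+y. g y \<partial>cond_kernel t z)"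
      unfolding nn_integral_cond_kernel[OF z t g]
      using eternal_prob_pos[OF z] by (simp add: inverse_ennreal inverse_eq_divide)
  qed
qed

lemma measurable_cond_kernel:
  assumes t: "0 \<le> t"
  shows "cond_kernel t \<in> Shat_algebra S \<rightarrow>\<^sub>M prob_algebra (Shat_algebra S)"
proof (rule measurable_prob_algebraI)
  show "prob_space (cond_kernel t z)" if "z \<in> space (Shat_algebra S)" for z
    using prob_space_cond_kernel[OF _ t] that by simp
  show "cond_kernel t \<in> Shat_algebra S \<rightarrow>\<^sub>M subprob_algebra (Shat_algebra S)"
  proof (rule measurable_subprob_algebra)
    show "subprob_space (cond_kernel t z)" if "z \<in> space (Shat_algebra S)" for z
      using that by (intro prob_space_imp_subprob_space prob_space_cond_kernel t) simp
    fix B assume B: "B \<in> sets (Shat_algebra S)"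
    have "(\<lambda>z. \<integral>\<^sup>+y. indicator B y \<partial>cond_kernel t z) \<in> borel_measurable (Shat_algebra S)"
      using B by (intro measurable_cond_kernel_integral t) simp
    then show "(\<lambda>z. emeasure (cond_kernel t z) B) \<in> borel_measurable (Shat_algebra S)"
      using B by simp
  qed simp
qed

lemma clipped_time_shift:
  assumes x: "x \<in> immortal (snd z)" and t: "0 \<le> t" and h: "0 \<le> h"
  shows "clipped (t + h) z x = clipped h (clipped t z x) (time_shift t x)"
proof -
  have xp: "x \<in> paths S" and inf: "tau (snd z) x = \<infinity>" using x by (auto simp: immortal_def)
  have "tau (age (snd z) x t) (time_shift t x) = \<infinity>"
    using tau_infinity_time_shift[OF xp t, of "snd z"] inf by simp
  then show ?thesis
    using inf by (simp add: clipped_def Xhat_eq age_time_shift[OF t h] time_shift_apply)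
qed

text \<open>Applying the Markov property to the future on its own immortality event produces the
  conditioned kernel times \<open>eternal_prob\<close> of the present state;
  \<open>conditioning_identity\<close> reabsorbs exactly this factor into the immortality of the
  whole path.\<close>

lemma conditioned_markov_identity:
  assumes z: "z \<in> Shat S" and t: "0 \<le> t" and h: "0 \<le> h" and A: "A \<in> sets (past S t)"
    and g: "g \<in> borel_measurable (Shat_algebra S)"
  shows "(\<integral>\<^sup>+x. g (clipped (t + h) z x) * indicator (A \<inter> immortal (snd z)) x \<partial>path_law (fst z)) =
    (\<integral>\<^sup>+x. (\<integral>\<^sup>+y. g y \<partial>cond_kernel h (clipped t z x)) * indicator (A \<inter> immortal (snd z)) x \<partial>path_law (fst z))"
proof -
  let ?f = "\<lambda>w y. g (clipped h w y) * indicator (immortal (snd w)) y"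
  have "(\<lambda>p. g (clipped h (fst p) (snd p)) * indicator (immortal (snd (fst p))) (snd p)) \<in>
      borel_measurable (Shat_algebra S \<Otimes>\<^sub>M path_algebra S)"
    by (intro borel_measurable_times_ennreal joint_indicator_measurable measurable_compose[OF measurable_clipped[OF h] g])
  then have f: "(\<lambda>(w, y). ?f w y) \<in> borel_measurable (Shat_algebra S \<Otimes>\<^sub>M path_algebra S)"
    by (simp add: case_prod_beta)
  have "(\<integral>\<^sup>+x. g (clipped (t + h) z x) * indicator (A \<inter> immortal (snd z)) x \<partial>path_law (fst z)) =
      (\<integral>\<^sup>+x. ?f (clipped t z x) (time_shift t x) * indicator (A \<inter> alive t z) x \<partial>path_law (fst z))"
  proof (rule nn_integral_cong)
    fix x assume "x \<in> space (path_law (fst z))"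
    then have x: "x \<in> paths S" by simp
    show "g (clipped (t + h) z x) * indicator (A \<inter> immortal (snd z)) x =
        ?f (clipped t z x) (time_shift t x) * indicator (A \<inter> alive t z) x"
    proof (cases "x \<in> immortal (snd z)")
      case True
      then have "x \<in> alive t z" "time_shift t x \<in> immortal (snd (clipped t z x))"
        using immortal_time_shift[OF x t, of z] by (auto simp: clipped_alive)
      then show ?thesis using True clipped_time_shift[OF True t h] by (simp add: indicator_def)
    next
      case False
      then show ?thesis
        using immortal_time_shift[OF x t, of z] by (cases "x \<in> alive t z") (auto simp: clipped_alive)
    qed
  qed
  also have "\<dots> = (\<integral>\<^sup>+x. (\<integral>\<^sup>+y. ?f (clipped t z x) y \<partial>path_law (fst (clipped t z x))) *
      indicator (A \<inter> alive t z) x \<partial>path_law (fst z))"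
    by (rule markov_hat[OF z t A f])
  also have "\<dots> = (\<integral>\<^sup>+x. (\<integral>\<^sup>+y. g y \<partial>cond_kernel h (clipped t z x)) *
      ennreal (eternal_prob (clipped t z x)) * indicator (A \<inter> alive t z) x \<partial>path_law (fst z))"
  proof (rule nn_integral_cong)
    fix x assume "x \<in> space (path_law (fst z))"
    then have w: "clipped t z x \<in> Shat S" using z t by (intro clipped_Shat) auto
    have "(\<integral>\<^sup>+y. g y \<partial>cond_kernel h (clipped t z x)) * ennreal (eternal_prob (clipped t z x)) =
        (\<integral>\<^sup>+y. ?f (clipped t z x) y \<partial>path_law (fst (clipped t z x))) *
        (ennreal (eternal_prob (clipped t z x)) * ennreal (1 / eternal_prob (clipped t z x)))"
      unfolding nn_integral_cond_kernel[OF w h g] by (simp only: ac_simps)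
    then show "(\<integral>\<^sup>+y. ?f (clipped t z x) y \<partial>path_law (fst (clipped t z x))) * indicator (A \<inter> alive t z) x =
        (\<integral>\<^sup>+y. g y \<partial>cond_kernel h (clipped t z x)) * ennreal (eternal_prob (clipped t z x)) *
        indicator (A \<inter> alive t z) x"
      by (simp only: eternal_prob_cancel[OF w] mult_1_right)
  qed
  also have "\<dots> = (\<integral>\<^sup>+x. (\<integral>\<^sup>+y. g y \<partial>cond_kernel h (clipped t z x)) *
      indicator (A \<inter> immortal (snd z)) x \<partial>path_law (fst z))"
    by (rule conditioning_identity[OF z t A measurable_cond_kernel_integral[OF h g], symmetric])
  finally show ?thesis .
qed

lemma cond_kernel_0:
  assumes z: "z \<in> Shat S" shows "cond_kernel 0 z = return (Shat_algebra S) z"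
proof (rule measure_eqI)
  fix B assume "B \<in> sets (cond_kernel 0 z)"
  then have B: "B \<in> sets (Shat_algebra S)" by simp
  have "(\<integral>\<^sup>+x. indicator B (clipped 0 z x) * indicator (immortal (snd z)) x \<partial>path_law (fst z)) =
      (\<integral>\<^sup>+x. indicator B z * indicator (immortal (snd z)) x \<partial>path_law (fst z))"
  proof (rule nn_integral_cong_AE)
    show "AE x in path_law (fst z). indicator B (clipped 0 z x) * indicator (immortal (snd z)) x =
        indicator B z * (indicator (immortal (snd z)) x :: ennreal)"
      using AE_path_law_start[OF Shat_fst[OF z]]
    proof eventually_elim
      case (elim x)
      then show ?case using clipped_start[of z x, OF z elim] by (cases "x \<in> immortal (snd z)") auto
    qed
  qed
  also have "\<dots> = indicator B z * ennreal (eternal_prob z)"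
    using sets_immortal by (subst nn_integral_cmult) (simp_all add: eternal_prob_nn_integral[OF z, symmetric])
  finally have "emeasure (cond_kernel 0 z) B = indicator B z * (ennreal (eternal_prob z) * ennreal (1 / eternal_prob z))"
    unfolding emeasure_cond_kernel[OF z order_refl B] by (simp only: mult.assoc)
  then show "emeasure (cond_kernel 0 z) B = emeasure (return (Shat_algebra S) z) B"
    using B by (simp only: eternal_prob_cancel[OF z] emeasure_return mult_1_right)
qed simp

text \<open>The Chapman-Kolmogorov equation is the Markov identity of the conditioned paths with the
  trivial past event.\<close>

lemma cond_kernel_add:
  assumes z: "z \<in> Shat S" and s: "0 \<le> s" and t: "0 \<le> t"
  shows "cond_kernel (s + t) z = cond_kernel s z \<bind> cond_kernel t"
proof (rule measure_eqI)
  have K: "cond_kernel t \<in> cond_kernel s z \<rightarrow>\<^sub>M subprob_algebra (Shat_algebra S)"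
    using measurable_prob_algebraD[OF measurable_cond_kernel[OF t]] by (simp cong: measurable_cong_sets)
  have ne: "space (cond_kernel s z) \<noteq> {}" using z by auto
  show "sets (cond_kernel (s + t) z) = sets (cond_kernel s z \<bind> cond_kernel t)"
    using ne by (subst sets_bind[where N="Shat_algebra S"]) auto
  fix B assume "B \<in> sets (cond_kernel (s + t) z)"
  then have B: "B \<in> sets (Shat_algebra S)" by simp
  have top: "paths S \<in> sets (past S s)" using sets.top[of "past S s"] by simp
  have int: "paths S \<inter> immortal (snd z) = immortal (snd z)" by (auto simp: immortal_def)
  have IB: "indicator B \<in> borel_measurable (Shat_algebra S)" using B by simp
  have "emeasure (cond_kernel s z \<bind> cond_kernel t) B = (\<integral>\<^sup>+y. emeasure (cond_kernel t y) B \<partial>cond_kernel s z)"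
    by (rule emeasure_bind[OF ne K B])
  also have "\<dots> = (\<integral>\<^sup>+y. (\<integral>\<^sup>+w. indicator B w \<partial>cond_kernel t y) \<partial>cond_kernel s z)"
    using B by simp
  also have "\<dots> = (\<integral>\<^sup>+x. (\<integral>\<^sup>+w. indicator B w \<partial>cond_kernel t (clipped s z x)) *
      indicator (immortal (snd z)) x \<partial>path_law (fst z)) * ennreal (1 / eternal_prob z)"
    by (rule nn_integral_cond_kernel[OF z s measurable_cond_kernel_integral[OF t IB]])
  also have "(\<integral>\<^sup>+x. (\<integral>\<^sup>+w. indicator B w \<partial>cond_kernel t (clipped s z x)) *
      indicator (immortal (snd z)) x \<partial>path_law (fst z)) =
      (\<integral>\<^sup>+x. indicator B (clipped (s + t) z x) * indicator (immortal (snd z)) x \<partial>path_law (fst z))"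
    using conditioned_markov_identity[OF z s t top IB] unfolding int by simp
  also have "\<dots> * ennreal (1 / eternal_prob z) = emeasure (cond_kernel (s + t) z) B"
    using s t by (intro emeasure_cond_kernel[OF z _ B, symmetric]) simp
  finally show "emeasure (cond_kernel (s + t) z) B = emeasure (cond_kernel s z \<bind> cond_kernel t) B" ..
qed

section \<open>The conditioned law and its Markov property\<close>

lemma conditioned_event:
  assumes z: "z \<in> Shat S"
  shows "{\<omega>\<in>space (P (fst z)). tau (snd z) (\<lambda>s. X s \<omega>) = \<infinity>} =
    sample_path -` immortal (snd z) \<inter> space (P (fst z))"
  using sample_path_paths Shat_fst[OF z] by (auto simp: space_P immortal_def sample_path_def)

lemma space_conditioned_law:
  assumes z: "z \<in> Shat S"
  shows "space (conditioned_law P X z) = sample_path -` immortal (snd z) \<inter> space (P (fst z))"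
  unfolding conditioned_law_def Let_def conditioned_event[OF z]
  by (auto simp: space_restrict_space)

lemma sets_conditioned_event:
  assumes z: "z \<in> Shat S"
  shows "sample_path -` immortal (snd z) \<inter> space (P (fst z)) \<in> sets (P (fst z))"
  by (rule measurable_sets[OF measurable_sample_path[OF Shat_fst[OF z]] sets_immortal])

lemma measurable_conditioned_law:
  assumes z: "z \<in> Shat S" and f: "f \<in> P (fst z) \<rightarrow>\<^sub>M N"
  shows "f \<in> conditioned_law P X z \<rightarrow>\<^sub>M N"
  unfolding conditioned_law_def Let_def
  by (rule measurable_restrict_space1) (use f in \<open>simp cong: measurable_cong_sets\<close>)

lemma nn_integral_conditioned_law:
  assumes z: "z \<in> Shat S" and g: "g \<in> borel_measurable (path_algebra S)"
  shows "(\<integral>\<^sup>+\<omega>. g (sample_path \<omega>) \<partial>conditioned_law P X z) =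
    (\<integral>\<^sup>+x. g x * indicator (immortal (snd z)) x \<partial>path_law (fst z)) * ennreal (1 / eternal_prob z)"
proof -
  let ?i = "fst z"
  have i: "?i \<in> S" by (rule Shat_fst[OF z])
  let ?E = "sample_path -` immortal (snd z) \<inter> space (P ?i)"
  have E: "?E \<in> sets (P ?i)" by (rule sets_conditioned_event[OF z])
  have gP: "(\<lambda>\<omega>. g (sample_path \<omega>)) \<in> borel_measurable (P ?i)"
    by (rule measurable_compose[OF measurable_sample_path[OF i] g])
  have "emeasure (P ?i) ?E = emeasure (path_law ?i) (immortal (snd z))"
    using emeasure_path_law[OF i sets_immortal, of "snd z"]
    by (simp add: vimage_def Int_def conj_commute)
  also have "\<dots> = ennreal (eternal_prob z)"
    using finite_measure.emeasure_eq_measure[OF finite_measure_path_law[OF i]] by (simp add: eternal_prob_def)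
  finally have em: "emeasure (P ?i) ?E = ennreal (eternal_prob z)" .
  have "(\<integral>\<^sup>+\<omega>. g (sample_path \<omega>) \<partial>conditioned_law P X z) =
      (\<integral>\<^sup>+\<omega>. g (sample_path \<omega>) * indicator ?E \<omega> \<partial>uniform_measure (P ?i) ?E)"
    unfolding conditioned_law_def Let_def conditioned_event[OF z]
    using E by (intro nn_integral_restrict_space) simp
  \<comment> \<open>One indicator comes from restricting the space to the event, the other from
    \<open>uniform_measure\<close>; they collapse to a single one below.\<close>
  also have "\<dots> = (\<integral>\<^sup>+\<omega>. g (sample_path \<omega>) * indicator ?E \<omega> * indicator ?E \<omega> \<partial>P ?i) / emeasure (P ?i) ?E"
    using gP E by (intro nn_integral_uniform_measure) auto
  also have "(\<integral>\<^sup>+\<omega>. g (sample_path \<omega>) * indicator ?E \<omega> * indicator ?E \<omega> \<partial>P ?i) =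
      (\<integral>\<^sup>+\<omega>. g (sample_path \<omega>) * indicator (immortal (snd z)) (sample_path \<omega>) \<partial>P ?i)"
    by (intro nn_integral_cong) (simp add: indicator_def)
  also have "\<dots> = (\<integral>\<^sup>+x. g x * indicator (immortal (snd z)) x \<partial>path_law ?i)"
    unfolding path_law_def using g sets_immortal
    by (subst nn_integral_distr[OF measurable_sample_path[OF i]]) simp_all
  also have "\<dots> / emeasure (P ?i) ?E = \<dots> * ennreal (1 / eternal_prob z)"
    unfolding em using eternal_prob_pos[OF z]
    by (simp add: divide_ennreal_def inverse_ennreal inverse_eq_divide)
  finally show ?thesis .
qed

lemma emeasure_conditioned_law:
  assumes z: "z \<in> Shat S" and A: "A \<in> sets (path_algebra S)"
  shows "emeasure (conditioned_law P X z) {\<omega>\<in>space (conditioned_law P X z). sample_path \<omega> \<in> A} =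
    emeasure (path_law (fst z)) (A \<inter> immortal (snd z)) * ennreal (1 / eternal_prob z)"
proof -
  have meas: "sample_path \<in> conditioned_law P X z \<rightarrow>\<^sub>M path_algebra S"
    by (rule measurable_conditioned_law[OF z measurable_sample_path[OF Shat_fst[OF z]]])
  have eq: "{\<omega>\<in>space (conditioned_law P X z). sample_path \<omega> \<in> A} =
      sample_path -` A \<inter> space (conditioned_law P X z)" by auto
  have "emeasure (conditioned_law P X z) {\<omega>\<in>space (conditioned_law P X z). sample_path \<omega> \<in> A} =
      (\<integral>\<^sup>+\<omega>. indicator {\<omega>\<in>space (conditioned_law P X z). sample_path \<omega> \<in> A} \<omega> \<partial>conditioned_law P X z)"
    unfolding eq using measurable_sets[OF meas A] by simp
  also have "\<dots> = (\<integral>\<^sup>+\<omega>. indicator A (sample_path \<omega>) \<partial>conditioned_law P X z)"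
    by (intro nn_integral_cong) (simp add: indicator_def)
  also have "\<dots> = (\<integral>\<^sup>+x. indicator A x * indicator (immortal (snd z)) x \<partial>path_law (fst z)) *
      ennreal (1 / eternal_prob z)"
    using A by (intro nn_integral_conditioned_law z) simp
  also have "(\<integral>\<^sup>+x. indicator A x * indicator (immortal (snd z)) x \<partial>path_law (fst z)) =
      (\<integral>\<^sup>+x. indicator (A \<inter> immortal (snd z)) x \<partial>path_law (fst z))"
    by (simp add: indicator_inter_arith)
  also have "\<dots> = emeasure (path_law (fst z)) (A \<inter> immortal (snd z))"
    using A sets_immortal by (intro nn_integral_indicator) auto
  finally show ?thesis .
qed

lemma markov_conditioned_law:
  assumes z: "z \<in> Shat S"
  shows "markov_from (conditioned_law P X z) (Shat_algebra S)
    (\<lambda>t \<omega>. Xhat (snd z) (\<lambda>s. X s \<omega>) t) cond_kernel z"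
proof -
  let ?N = "conditioned_law P X z" and ?Z = "\<lambda>t \<omega>. Xhat (snd z) (\<lambda>s. X s \<omega>) t"
  have i: "fst z \<in> S" by (rule Shat_fst[OF z])
  \<comment> \<open>On the conditioned space nothing is ever killed, so the process coincides with
    the clipped one, which is measurable on all of path space.\<close>
  have Zc: "?Z t \<omega> = clipped t z (sample_path \<omega>)" if "\<omega> \<in> space ?N" for t \<omega>
    using that by (simp add: space_conditioned_law[OF z] immortal_def clipped_def sample_path_def)
  have pth: "sample_path \<in> ?N \<rightarrow>\<^sub>M path_algebra S"
    by (rule measurable_conditioned_law[OF z measurable_sample_path[OF i]])
  have Zm: "?Z t \<in> ?N \<rightarrow>\<^sub>M Shat_algebra S" if t: "0 \<le> t" for t
  proof -
    have "(\<lambda>\<omega>. clipped t z (sample_path \<omega>)) \<in> ?N \<rightarrow>\<^sub>M Shat_algebra S"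
      by (rule measurable_compose[OF pth measurable_clipped_path[OF z t]])
    also have "?this \<longleftrightarrow> ?thesis" by (rule measurable_cong) (simp add: Zc)
    finally show ?thesis .
  qed
  have prob: "prob_space ?N"
  proof
    have "{\<omega>\<in>space ?N. sample_path \<omega> \<in> paths S} = space ?N"
      using measurable_space[OF pth] by auto
    then show "emeasure ?N (space ?N) = 1"
      using emeasure_conditioned_law[OF z path_sets_top] eternal_prob_cancel[OF z]
        eternal_prob_nn_integral[OF z] sets_immortal
      by (simp add: Int_absorb1 immortal_def)
  qed
  have start: "AE \<omega> in ?N. ?Z 0 \<omega> = z"
  proof -
    interpret prob_space ?N by (rule prob)
    have zB: "{z} \<in> sets (Shat_algebra S)" by (rule sets_Shat_singleton[OF z])
    have c0: "clipped 0 z -` {z} \<inter> paths S \<in> sets (path_algebra S)"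
      using measurable_sets[OF measurable_clipped_path[OF z order_refl] zB] by simp
    have "emeasure (path_law (fst z)) ((clipped 0 z -` {z} \<inter> paths S) \<inter> immortal (snd z)) =
        emeasure (path_law (fst z)) (immortal (snd z))"
    proof (rule emeasure_eq_AE)
      show "AE x in path_law (fst z). x \<in> (clipped 0 z -` {z} \<inter> paths S) \<inter> immortal (snd z) \<longleftrightarrow>
          x \<in> immortal (snd z)"
        using AE_path_law_start[OF i]
      proof eventually_elim
        case (elim x)
        then show ?case using clipped_start[of z x, OF z elim] by (auto simp: immortal_def)
      qed
    qed (use c0 sets_immortal in auto)
    then have "emeasure ?N {\<omega>\<in>space ?N. sample_path \<omega> \<in> clipped 0 z -` {z} \<inter> paths S} = 1"
      using emeasure_conditioned_law[OF z c0] eternal_prob_cancel[OF z]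
        eternal_prob_nn_integral[OF z] sets_immortal[of "snd z"] by simp
    moreover have "{\<omega>\<in>space ?N. sample_path \<omega> \<in> clipped 0 z -` {z} \<inter> paths S} = {\<omega>\<in>space ?N. ?Z 0 \<omega> = z}"
      using Zc measurable_space[OF pth] by auto
    ultimately have "prob {\<omega>\<in>space ?N. ?Z 0 \<omega> = z} = 1" by (simp add: measure_def)
    moreover have "{\<omega>\<in>space ?N. ?Z 0 \<omega> = z} \<in> sets ?N"
      using measurable_sets[OF Zm[OF order_refl] zB] by (simp add: vimage_def Int_def conj_commute)
    ultimately have "AE \<omega> in ?N. \<omega> \<in> {\<omega>\<in>space ?N. ?Z 0 \<omega> = z}" by (subst AE_in_set_eq_1)
    then show ?thesis by (rule AE_mp) auto
  qed
  have "emeasure ?N {\<omega>\<in>A. ?Z (t + h) \<omega> \<in> B} = (\<integral>\<^sup>+\<omega>\<in>A. emeasure (cond_kernel h (?Z t \<omega>)) B \<partial>?N)"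
    if t: "0 \<le> t" and h: "0 \<le> h" and A: "A \<in> sets (history (space ?N) (Shat_algebra S) ?Z t)"
      and B: "B \<in> sets (Shat_algebra S)" for t h A B
  proof -
    have th: "0 \<le> t + h" using t h by simp
    have IB: "indicator B \<in> borel_measurable (Shat_algebra S)" using B by simp
    \<comment> \<open>The history is generated by \<open>Xhat\<close> under the conditioned law.
      Adaptedness of the clipped process shows each generator, hence each event of the history, to
      be the preimage of an event of \<open>past S t\<close>.\<close>
    let ?G = "\<Union>s\<in>{0..t}. {?Z s -` B \<inter> space ?N | B. B \<in> sets (Shat_algebra S)}"
    have "sample_path \<in> space ?N \<rightarrow> space (past S t)" using measurable_space[OF pth] by auto
    note V = sets_vimage_algebra2[OF this]
    have "?G \<subseteq> sets (vimage_algebra (space ?N) sample_path (past S t))"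
    proof safe
      fix s B assume s: "s \<in> {0..t}" and B: "B \<in> sets (Shat_algebra S)"
      have "clipped s z -` B \<inter> paths S \<in> sets (past S s)"
        using measurable_sets[OF measurable_clipped_past[OF z, of s] B] s by simp
      then have "clipped s z -` B \<inter> paths S \<in> sets (past S t)"
        using s by (intro sets_past_mono[of s t]) auto
      moreover have "?Z s -` B \<inter> space ?N = sample_path -` (clipped s z -` B \<inter> paths S) \<inter> space ?N"
        using Zc measurable_space[OF pth] by auto
      ultimately show "?Z s -` B \<inter> space ?N \<in> sets (vimage_algebra (space ?N) sample_path (past S t))"
        unfolding V by blast
    qed
    from sets.sigma_sets_subset[OF this]
    have "A \<in> sets (vimage_algebra (space ?N) sample_path (past S t))"
      using A unfolding history_def by (subst (asm) sets_measure_of) auto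
    then obtain A' where A': "A' \<in> sets (past S t)" "A = sample_path -` A' \<inter> space ?N"
      unfolding V by blast
    have A'': "A' \<in> sets (path_algebra S)" by (rule sets_past_path[OF t A'(1)])
    have c: "clipped (t + h) z -` B \<inter> paths S \<in> sets (path_algebra S)"
      using measurable_sets[OF measurable_clipped_path[OF z th] B] by simp
    let ?I = "immortal (snd z)"
    have "{\<omega>\<in>A. ?Z (t + h) \<omega> \<in> B} =
        {\<omega>\<in>space ?N. sample_path \<omega> \<in> A' \<inter> (clipped (t + h) z -` B \<inter> paths S)}"
      using Zc measurable_space[OF pth] by (auto simp: A'(2))
    then have "emeasure ?N {\<omega>\<in>A. ?Z (t + h) \<omega> \<in> B} =
        emeasure (path_law (fst z)) ((A' \<inter> (clipped (t + h) z -` B \<inter> paths S)) \<inter> ?I) * ennreal (1 / eternal_prob z)"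
      using emeasure_conditioned_law[OF z sets.Int[OF A'' c]] by simp
    also have "emeasure (path_law (fst z)) ((A' \<inter> (clipped (t + h) z -` B \<inter> paths S)) \<inter> ?I) =
        (\<integral>\<^sup>+x. indicator ((A' \<inter> (clipped (t + h) z -` B \<inter> paths S)) \<inter> ?I) x \<partial>path_law (fst z))"
      using A'' c sets_immortal by (intro nn_integral_indicator[symmetric]) auto
    also have "\<dots> = (\<integral>\<^sup>+x. indicator B (clipped (t + h) z x) * indicator (A' \<inter> ?I) x \<partial>path_law (fst z))"
      by (intro nn_integral_cong) (auto simp: indicator_def immortal_def)
    also have "\<dots> = (\<integral>\<^sup>+x. (\<integral>\<^sup>+y. indicator B y \<partial>cond_kernel h (clipped t z x)) * indicator (A' \<inter> ?I) x \<partial>path_law (fst z))"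
      by (rule conditioned_markov_identity[OF z t h A'(1) IB])
    also have "\<dots> = (\<integral>\<^sup>+x. (emeasure (cond_kernel h (clipped t z x)) B * indicator A' x) * indicator ?I x \<partial>path_law (fst z))"
    proof (rule nn_integral_cong)
      fix x
      have "(\<integral>\<^sup>+y. indicator B y \<partial>cond_kernel h (clipped t z x)) = emeasure (cond_kernel h (clipped t z x)) B"
        using B by simp
      then show "(\<integral>\<^sup>+y. indicator B y \<partial>cond_kernel h (clipped t z x)) * indicator (A' \<inter> ?I) x =
          (emeasure (cond_kernel h (clipped t z x)) B * indicator A' x) * indicator ?I x"
        by (simp only: indicator_inter_arith mult.assoc)
    qed
    also have "\<dots> * ennreal (1 / eternal_prob z) =
        (\<integral>\<^sup>+\<omega>. emeasure (cond_kernel h (clipped t z (sample_path \<omega>))) B * indicator A' (sample_path \<omega>) \<partial>?N)"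
    proof (rule nn_integral_conditioned_law[OF z, symmetric])
      have "(\<lambda>w. \<integral>\<^sup>+y. indicator B y \<partial>cond_kernel h w) \<in> borel_measurable (Shat_algebra S)"
        by (rule measurable_cond_kernel_integral[OF h IB])
      then have "(\<lambda>w. emeasure (cond_kernel h w) B) \<in> borel_measurable (Shat_algebra S)" using B by simp
      from measurable_compose[OF measurable_clipped_path[OF z t] this]
      show "(\<lambda>x. emeasure (cond_kernel h (clipped t z x)) B * indicator A' x) \<in> borel_measurable (path_algebra S)"
        using A'' by (intro borel_measurable_times_ennreal borel_measurable_indicator)
    qed
    also have "\<dots> = (\<integral>\<^sup>+\<omega>\<in>A. emeasure (cond_kernel h (?Z t \<omega>)) B \<partial>?N)"
      by (intro nn_integral_cong) (auto simp: A'(2) Zc indicator_def)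
    finally show ?thesis .
  qed
  then show ?thesis unfolding markov_from_def using prob Zm start by blast
qed

section \<open>The \<open>Q\<close>-matrix of the conditioned process on \<open>C\<close>\<close>

lemma measure_cond_kernel_singleton:
  assumes i: "i \<in> S" "i \<noteq> 0" and j: "j \<in> S" "j \<noteq> 0" and t: "0 \<le> t" "t < 1"
  shows "measure (cond_kernel t (i, 0)) {(j, 0)} =
    eternal_prob (j, 0) / eternal_prob (i, 0) * trans_prob i j t"
proof -
  have zi: "(i, 0) \<in> Shat S" and zj: "(j, 0) \<in> Shat S" using i j by (auto simp: Shat_def)
  let ?c = "eternal_prob (j, 0) / eternal_prob (i, 0)"
  have c: "0 \<le> ?c" by (simp add: eternal_prob_def)
  have B: "{(j, 0)} \<in> sets (Shat_algebra S)" by (rule sets_Shat_singleton[OF zj])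
  have ev: "{x\<in>paths S. x t = j} \<in> sets (path_algebra S)" by (rule sets_eval_eq[OF t(1)])
  have "emeasure (cond_kernel t (i, 0)) {(j, 0)} =
      (\<integral>\<^sup>+y. ennreal (eternal_prob y / eternal_prob (i, 0)) * indicator {(j, 0)} y \<partial>Phat S P X t (i, 0))"
    unfolding cond_kernel_def using density_measurable[OF zi] B
    by (intro emeasure_density) (simp_all cong: measurable_cong_sets)
  also have "\<dots> = (\<integral>\<^sup>+x. ennreal (eternal_prob (clipped t (i, 0) x) / eternal_prob (i, 0)) *
      indicator {(j, 0)} (clipped t (i, 0) x) * indicator (alive t (i, 0)) x \<partial>path_law i)"
    using nn_integral_Phat[OF zi t(1), of "\<lambda>y. ennreal (eternal_prob y / eternal_prob (i, 0)) * indicator {(j, 0)} y"]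
      density_measurable[OF zi] B by simp
  also have "\<dots> = (\<integral>\<^sup>+x. ennreal ?c * indicator {x\<in>paths S. x t = j} x \<partial>path_law i)"
  proof (rule nn_integral_cong_AE)
    show "AE x in path_law i. ennreal (eternal_prob (clipped t (i, 0) x) / eternal_prob (i, 0)) *
        indicator {(j, 0)} (clipped t (i, 0) x) * indicator (alive t (i, 0)) x =
        ennreal ?c * indicator {x\<in>paths S. x t = j} x"
      using AE_path_law_start[OF i(1)] AE_space
    proof eventually_elim
      case (elim x)
      then have x: "x \<in> paths S" and x0: "x 0 \<noteq> 0" using i by auto
      \<comment> \<open>Started off 0, the path cannot have an age above the elapsed time; before
        time 1 the killing is not felt, and the killed transition probability is the original
        one.\<close>
      have "x \<in> alive t (i, 0)"
      proof -
        have "age 0 x s < 1" if "s \<in> {0..t}" for s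
          using age_le[of x s 0] x0 that t by auto
        then show ?thesis using x by (simp add: alive_def less_tau_iff[OF x t(1)])
      qed
      then show ?case using x j age_nonzero[of x t 0] by (auto simp: clipped_alive indicator_def)
    qed
  qed
  also have "\<dots> = ennreal ?c * emeasure (path_law i) {x\<in>paths S. x t = j}"
    using ev by (intro nn_integral_cmult_indicator) simp
  finally show ?thesis using c by (simp add: measure_def enn2real_mult trans_prob_def)
qed

text \<open>The explicit form of the kernel is available for times below 1, which is enough for
  difference quotients close to 0.\<close>

lemma cond_kernel_derivative:
  assumes i: "i \<in> S" "i \<noteq> 0" and j: "j \<in> S" "j \<noteq> 0"
  shows "((\<lambda>t. measure (cond_kernel t (i, 0)) {(j, 0)}) has_real_derivative
    eternal_prob (j, 0) / eternal_prob (i, 0) * q i j) (at_right 0)"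
proof -
  let ?c = "eternal_prob (j, 0) / eternal_prob (i, 0)"
  have "((\<lambda>t. ?c * trans_prob i j t) has_real_derivative ?c * q i j) (at_right 0)"
    by (rule DERIV_cmult[OF trans_prob_derivative[OF i(1) j(1)]])
  then have "((\<lambda>t. (?c * trans_prob i j t - ?c * trans_prob i j 0) / (t - 0)) \<longlongrightarrow> ?c * q i j) (at_right 0)"
    by (simp only: has_field_derivative_iff)
  moreover have "eventually (\<lambda>t. (?c * trans_prob i j t - ?c * trans_prob i j 0) / (t - 0) =
      (measure (cond_kernel t (i, 0)) {(j, 0)} - measure (cond_kernel 0 (i, 0)) {(j, 0)}) / (t - 0)) (at_right 0)"
    using eventually_at_right_less[of "0::real"] eventually_at_right_real[OF zero_less_one]
    by eventually_elim (simp add: measure_cond_kernel_singleton[OF i j])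
  ultimately show ?thesis
    unfolding has_field_derivative_iff by (rule Lim_transform_eventually)
qed

end


section \<open>Holding times and jumps of the conditioned process\<close>

lemma measure_exponential_density_eq:
  assumes r: "0 < r" and A: "A \<in> sets borel"
  shows "measure (density lborel (exponential_density r)) A = (LINT t:A|lborel. exponential_density r t)"
proof -
  have nn: "0 \<le> exponential_density r t" for t using r by (rule exponential_density_nonneg)
  have "(LINT t:A|lborel. exponential_density r t) = (\<integral>t. indicator A t * exponential_density r t \<partial>lborel)"
    by (simp add: set_lebesgue_integral_def)
  also have "\<dots> = enn2real (\<integral>\<^sup>+t. ennreal (indicator A t * exponential_density r t) \<partial>lborel)"
    using A nn by (intro integral_eq_nn_integral) auto
  also have "(\<integral>\<^sup>+t. ennreal (indicator A t * exponential_density r t) \<partial>lborel) =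
      emeasure (density lborel (exponential_density r)) A"
    using A by (subst emeasure_density) (auto intro!: nn_integral_cong simp: indicator_def)
  finally show ?thesis by (simp add: measure_def)
qed

lemma integral_exp_unit_interval:
  assumes "r \<noteq> 0" shows "integral {0..1} (\<lambda>s. exp (- r * s)) = (1 - exp (- r)) / (r::real)"
proof -
  have "((\<lambda>s. exp (- r * s)) has_integral (- exp (- r * 1) / r - - exp (- r * 0) / r)) {0..1}"
    by (rule fundamental_theorem_of_calculus)
      (use assms in \<open>auto intro!: derivative_eq_intros simp: has_real_derivative_iff_has_vector_derivative[symmetric]\<close>)
  then show ?thesis using assms by (simp add: integral_unique diff_divide_distrib)
qed

text \<open>The density is that of an exponential time conditioned not to exceed 1: its normalising
  integral is \<open>(1 - exp (- r)) / r\<close>. The strict bound on the left and the closed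
  half-line on the right differ in the single point 1, a null set.\<close>

lemma set_integral_truncated_exponential:
  assumes r: "0 < r" and A: "A \<in> sets borel"
  shows "(LINT t:A|lborel. (if 0 \<le> t \<and> t < 1 then exp (- r * t) / integral {0..1} (\<lambda>s. exp (- r * s)) else 0)) =
    measure (density lborel (exponential_density r)) (A \<inter> {..1}) / (1 - exp (- r))"
proof -
  have "(LINT t:A|lborel. (if 0 \<le> t \<and> t < 1 then exp (- r * t) / integral {0..1} (\<lambda>s. exp (- r * s)) else 0)) =
      (\<integral>t. (indicator (A \<inter> {..1}) t * exponential_density r t) * (1 / (1 - exp (- r))) \<partial>lborel)"
    unfolding set_lebesgue_integral_def
  proof (rule integral_cong_AE)
    show "AE t in lborel. indicat_real A t *\<^sub>R
        (if 0 \<le> t \<and> t < 1 then exp (- r * t) / integral {0..1} (\<lambda>s. exp (- r * s)) else 0) =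
        (indicator (A \<inter> {..1}) t * exponential_density r t) * (1 / (1 - exp (- r)))"
      using AE_lborel_singleton[of 1]
    proof eventually_elim
      case (elim t)
      have "integral {0..1} (\<lambda>s. exp (- r * s)) = (1 - exp (- r)) / r"
        using r by (intro integral_exp_unit_interval) simp
      then show ?case using elim
        by (auto simp: indicator_def exponential_density_def mult.commute)
    qed
  qed (use A in measurable)
  also have "\<dots> = (\<integral>t. indicator (A \<inter> {..1}) t * exponential_density r t \<partial>lborel) * (1 / (1 - exp (- r)))"
    by (rule integral_mult_left_zero)
  also have "(\<integral>t. indicator (A \<inter> {..1}) t * exponential_density r t \<partial>lborel) =
      measure (density lborel (exponential_density r)) (A \<inter> {..1})"
    using measure_exponential_density_eq[OF r, of "A \<inter> {..1}"] A by (simp add: set_lebesgue_integral_def)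
  finally show ?thesis by simp
qed

text \<open>Since \<infinity> - \<infinity> = \<infinity>, a finite holding time forces the jump
  that ends it to be finite; the last of the \<open>n\<close> holding times already gives the
  conclusion.\<close>

lemma jump_time_finite:
  assumes "\<And>k. k < n \<Longrightarrow> holding x k \<in> ereal ` UNIV"
  shows "jump_time x n < \<infinity>"
proof (cases n)
  case (Suc m)
  have "holding x m \<in> ereal ` UNIV" using assms Suc by simp
  then show ?thesis unfolding Suc holding_def
    by (cases "jump_time x (Suc m)"; cases "jump_time x m") auto
qed simp

lemma hit_infinity_iff: "hit B x = \<infinity> \<longleftrightarrow> (\<forall>t\<ge>0. x t \<notin> B)"
proof
  assume "hit B x = \<infinity>"
  then show "\<forall>t\<ge>0. x t \<notin> B" using hit_le[of _ x B] by auto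
next
  assume "\<forall>t\<ge>0. x t \<notin> B"
  then have "{ereal s | s. 0 \<le> s \<and> x s \<in> B} = {}" by auto
  then show "hit B x = \<infinity>" unfolding hit_def by (simp only: Inf_empty top_ereal_def)
qed


context transient_ctmc
begin

section \<open>Laws of finite itineraries\<close>

definition itinerary :: "nat \<Rightarrow> (nat \<Rightarrow> nat) \<Rightarrow> (nat \<Rightarrow> real set) \<Rightarrow> (real \<Rightarrow> nat) set" where
  "itinerary n y A = {x\<in>paths S. (\<forall>k<Suc n. visited x k = y k) \<and> (\<forall>k<n. holding x k \<in> ereal ` A k)}"

lemma sets_itinerary:
  assumes "\<And>k. k < n \<Longrightarrow> A k \<in> sets borel"
  shows "itinerary n y A \<in> sets (path_algebra S)"
proof -
  have 1: "Measurable.pred (path_algebra S) (\<lambda>x. \<forall>k\<in>{..<Suc n}. visited x k = y k)"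
    by (rule pred_Ball_countable) auto
  have 2: "Measurable.pred (path_algebra S) (\<lambda>x. \<forall>k\<in>{..<n}. holding x k \<in> ereal ` A k)"
  proof (rule pred_Ball_countable)
    fix k assume "k \<in> {..<n}"
    then have "ereal ` A k \<in> sets borel" using assms by (intro sets_image_ereal) simp
    then show "Measurable.pred (path_algebra S) (\<lambda>x. holding x k \<in> ereal ` A k)" by measurable
  qed simp
  have eq: "itinerary n y A = {x\<in>space (path_algebra S). (\<forall>k\<in>{..<Suc n}. visited x k = y k) \<and>
      (\<forall>k\<in>{..<n}. holding x k \<in> ereal ` A k)}"
    by (simp add: itinerary_def Ball_def)
  show ?thesis unfolding eq using 2 1 unfolding pred_def by (rule sets.sets_Collect_conj)
qed

text \<open>In 0 only waits of length at most 1 are survived; the closed end matches the bound of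
  \<open>tau_infinity_first_jump\<close> for a wait begun at age 0.\<close>

abbreviation survived_exit_prob :: "nat \<Rightarrow> real set \<Rightarrow> real" where
  "survived_exit_prob i A \<equiv> exit_time_prob i (if i = 0 then A \<inter> {..1} else A)"

text \<open>Removes the first jump from the itinerary and from immortality at once. Survival splits
  into a bound on the first wait, merged here into its admissible set, and immortality of the rest,
  again with age 0.\<close>

lemma itinerary_Suc_iff:
  assumes x: "x \<in> paths S" and x0: "x 0 = y 0"
  shows "x \<in> immortal 0 \<inter> itinerary (Suc n) y A \<longleftrightarrow>
    x \<in> jump_event (if y 0 = 0 then A 0 \<inter> {..1} else A 0) (y 1)
      (immortal 0 \<inter> itinerary n (\<lambda>k. y (Suc k)) (\<lambda>k. A (Suc k)))"
proof (cases "jump_time x (Suc 0) \<in> ereal ` UNIV")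
  case False
  then have "holding x 0 \<notin> ereal ` A 0" unfolding holding_0 by blast
  then have "x \<notin> itinerary (Suc n) y A" by (auto simp: itinerary_def)
  moreover have "x \<notin> jump_event B l G" for B l G using False by (auto simp: jump_event_def)
  ultimately show ?thesis by blast
next
  case True
  then obtain t where t: "jump_time x (Suc 0) = ereal t" by blast
  define w where "w = time_shift t x"
  have w: "w \<in> paths S" unfolding w_def using first_jump_nonneg[OF x t] by (rule time_shift_paths[OF x])
  have hold: "holding x (Suc k) = holding w k" for k
    unfolding w_def by (rule holding_time_shift[OF x t])
  have h0: "holding x 0 \<in> ereal ` A 0 \<longleftrightarrow> t \<in> A 0" unfolding holding_0 t by auto
  have v1: "visited x (Suc 0) = w 0"
    unfolding w_def using visited_time_shift[OF x t, of 0] by simp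
  \<comment> \<open>The states of the two paths correspond only at finite jump times; the prescribed
    holding times are real numbers and so guarantee finiteness.\<close>
  have vis: "visited x (Suc k) = visited w k" if "\<forall>k<n. holding w k \<in> ereal ` A (Suc k)" "k \<le> n" for k
  proof -
    have "jump_time w k < \<infinity>"
    proof (rule jump_time_finite)
      fix j assume "j < k"
      then have "holding w j \<in> ereal ` A (Suc j)" using that by simp
      then show "holding w j \<in> ereal ` UNIV" by blast
    qed
    then show ?thesis unfolding w_def by (rule visited_time_shift[OF x t])
  qed
  have imm: "x \<in> immortal 0 \<longleftrightarrow> (y 0 = 0 \<longrightarrow> t \<le> 1) \<and> w \<in> immortal 0"
    using tau_infinity_first_jump[OF x t, of 0] x w x0 by (simp add: immortal_def w_def)
  have "x \<in> itinerary (Suc n) y A \<longleftrightarrow> t \<in> A 0 \<and>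
      (\<forall>k<Suc n. visited x (Suc k) = y (Suc k)) \<and> (\<forall>k<n. holding w k \<in> ereal ` A (Suc k))"
    unfolding itinerary_def using x x0 h0
    by (simp only: mem_Collect_eq All_less_Suc2[of "Suc n"] All_less_Suc2[of n] hold visited_0) blast
  also have "\<dots> \<longleftrightarrow> t \<in> A 0 \<and> w \<in> itinerary n (\<lambda>k. y (Suc k)) (\<lambda>k. A (Suc k))"
    using w vis by (auto simp: itinerary_def less_Suc_eq_le)
  finally have it: "x \<in> itinerary (Suc n) y A \<longleftrightarrow> t \<in> A 0 \<and> w \<in> itinerary n (\<lambda>k. y (Suc k)) (\<lambda>k. A (Suc k))" .
  have w0: "w 0 = y 1" if "w \<in> itinerary n (\<lambda>k. y (Suc k)) (\<lambda>k. A (Suc k))"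
    using that by (auto simp: itinerary_def)
  have img: "ereal t \<in> ereal ` B \<longleftrightarrow> t \<in> B" for B by auto
  have je: "x \<in> jump_event B l G \<longleftrightarrow> t \<in> B \<and> w 0 = l \<and> w \<in> G" for B l G
    unfolding jump_event_def mem_Collect_eq v1 t real_of_ereal.simps img w_def[symmetric] using x by blast
  show ?thesis
  proof (cases "y 0 = 0")
    case True
    show ?thesis unfolding je Int_iff it imm if_P[OF True] atMost_iff using w0 True by blast
  next
    case False
    show ?thesis unfolding je Int_iff it imm if_not_P[OF False] using w0 False by blast
  qed
qed

text \<open>Each jump contributes its factor from the first-jump law; the final factor is the
  probability of surviving forever after the last recorded jump, which is begun with age 0.\<close>

lemma measure_itinerary:
  assumes "\<And>k. k \<le> n \<Longrightarrow> y k \<in> S" "\<And>k. k < n \<Longrightarrow> y (Suc k) \<noteq> y k" "\<And>k. k < n \<Longrightarrow> A k \<in> sets borel"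
  shows "measure (path_law (y 0)) (immortal 0 \<inter> itinerary n y A) =
    (\<Prod>k<n. survived_exit_prob (y k) (A k) * jump_prob (y k) (y (Suc k))) * eternal_prob (y n, 0)"
  using assms
proof (induction n arbitrary: y A)
  case (0 y A)
  have i: "y 0 \<in> S" using 0 by simp
  have "measure (path_law (y 0)) (immortal 0 \<inter> itinerary 0 y A) = measure (path_law (y 0)) (immortal 0)"
  proof (rule measure_eq_AE)
    show "AE x in path_law (y 0). x \<in> immortal 0 \<inter> itinerary 0 y A \<longleftrightarrow> x \<in> immortal 0"
      using AE_path_law_start[OF i] by eventually_elim (auto simp: itinerary_def immortal_def)
  qed (use sets_immortal sets_itinerary[of 0 A y] in auto)
  then show ?case by (simp add: eternal_prob_def)
next
  case (Suc n y A)
  let ?y = "\<lambda>k. y (Suc k)" and ?A = "\<lambda>k. A (Suc k)"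
  let ?B = "if y 0 = 0 then A 0 \<inter> {..1} else A 0"
  let ?G = "immortal 0 \<inter> itinerary n ?y ?A"
  have i: "y 0 \<in> S" and l: "y 1 \<in> S" "y 1 \<noteq> y 0" using Suc.prems by auto
  have B: "?B \<in> sets borel" using Suc.prems(3)[of 0] by auto
  have G: "?G \<in> sets (path_algebra S)"
    using Suc.prems(3) by (intro sets.Int sets_immortal sets_itinerary) auto
  have I: "immortal 0 \<inter> itinerary (Suc n) y A \<in> sets (path_algebra S)"
    using Suc.prems(3) by (intro sets.Int sets_immortal sets_itinerary)
  have "measure (path_law (y 0)) (immortal 0 \<inter> itinerary (Suc n) y A) =
      measure (path_law (y 0)) (jump_event ?B (y 1) ?G)"
  proof (rule measure_eq_AE)
    show "AE x in path_law (y 0). x \<in> immortal 0 \<inter> itinerary (Suc n) y A \<longleftrightarrow> x \<in> jump_event ?B (y 1) ?G"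
      using AE_path_law_start[OF i] AE_space by eventually_elim (rule itinerary_Suc_iff; simp)
  qed (simp_all only: sets_path_law I sets_jump_event[OF B G])
  also have "\<dots> = exit_time_prob (y 0) ?B * jump_prob (y 0) (y 1) * measure (path_law (y 1)) ?G"
    using q_diag_neg[OF i] by (intro first_jump_law i l B G) simp
  also have "measure (path_law (y 1)) ?G =
      (\<Prod>k<n. survived_exit_prob (?y k) (?A k) * jump_prob (?y k) (?y (Suc k))) * eternal_prob (y (Suc n), 0)"
    using Suc.IH[of ?y ?A] Suc.prems by simp
  finally show ?case
    by (simp only: prod.lessThan_Suc_shift One_nat_def mult.assoc)
qed

lemma measure_conditioned_itinerary:
  assumes "\<And>k. k \<le> n \<Longrightarrow> y k \<in> S" "\<And>k. k < n \<Longrightarrow> y (Suc k) \<noteq> y k" "\<And>k. k < n \<Longrightarrow> A k \<in> sets borel"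
  shows "measure (conditioned_law P X (y 0, 0)) {\<omega>\<in>space (conditioned_law P X (y 0, 0)).
      (\<forall>k\<le>n. visited (\<lambda>s. X s \<omega>) k = y k) \<and> (\<forall>k<n. holding (\<lambda>s. X s \<omega>) k \<in> ereal ` A k)} =
    (\<Prod>k<n. survived_exit_prob (y k) (A k) * jump_prob (y k) (y (Suc k)) *
      (eternal_prob (y (Suc k), 0) / eternal_prob (y k, 0)))"
proof -
  let ?N = "conditioned_law P X (y 0, 0)" and ?I = "itinerary n y A"
  have Sh: "(y k, 0) \<in> Shat S" if "k \<le> n" for k using assms(1)[OF that] by (simp add: Shat_def)
  have z: "(y 0, 0) \<in> Shat S" by (rule Sh) simp
  have I: "?I \<in> sets (path_algebra S)" using assms(3) by (rule sets_itinerary)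
  have pos: "0 < eternal_prob (y k, 0)" if "k \<le> n" for k using eternal_prob_pos[OF Sh[OF that]] .
  have "{\<omega>\<in>space ?N. (\<forall>k\<le>n. visited (\<lambda>s. X s \<omega>) k = y k) \<and> (\<forall>k<n. holding (\<lambda>s. X s \<omega>) k \<in> ereal ` A k)} =
      {\<omega>\<in>space ?N. sample_path \<omega> \<in> ?I}"
    by (auto simp: space_conditioned_law[OF z] itinerary_def immortal_def less_Suc_eq_le
        sample_path_def[symmetric])
  then have "measure ?N {\<omega>\<in>space ?N. (\<forall>k\<le>n. visited (\<lambda>s. X s \<omega>) k = y k) \<and>
      (\<forall>k<n. holding (\<lambda>s. X s \<omega>) k \<in> ereal ` A k)} =
      measure (path_law (y 0)) (?I \<inter> immortal 0) / eternal_prob (y 0, 0)"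
    using emeasure_conditioned_law[OF z I] pos[of 0]
    by (simp add: measure_def enn2real_mult)
  also have "?I \<inter> immortal 0 = immortal 0 \<inter> ?I" by blast
  also have "measure (path_law (y 0)) (immortal 0 \<inter> ?I) =
    (\<Prod>k<n. survived_exit_prob (y k) (A k) * jump_prob (y k) (y (Suc k))) * eternal_prob (y n, 0)"
    by (rule measure_itinerary) (use assms in auto)
  \<comment> \<open>Conditioning leaves the quotient of final and initial survival probability,
    written as a telescoping product so that each jump from \<open>k\<close> to \<open>l\<close>
    receives its own factor \<open>p l / p k\<close>.\<close>
  also have "\<dots> / eternal_prob (y 0, 0) =
      (\<Prod>k<n. survived_exit_prob (y k) (A k) * jump_prob (y k) (y (Suc k))) *
      (\<Prod>k<n. eternal_prob (y (Suc k), 0) / eternal_prob (y k, 0))"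
  proof -
    have "(\<Prod>k<m. eternal_prob (y (Suc k), 0) / eternal_prob (y k, 0)) = eternal_prob (y m, 0) / eternal_prob (y 0, 0)"
      if "m \<le> n" for m
      using that
    proof (induction m)
      case 0
      then show ?case using pos[of 0] by simp
    next
      case (Suc m)
      then show ?case using pos[of m] by simp
    qed
    from this[of n] show ?thesis by simp
  qed
  finally show ?thesis by (simp only: prod.distrib)
qed

end


section \<open>Identification with the explicit formulas\<close>

theorem theorem1p1:
  fixes S C :: "nat set" and P :: "nat \<Rightarrow> 'w measure" and X :: "real \<Rightarrow> 'w \<Rightarrow> nat"
    and q qinf :: "nat \<Rightarrow> nat \<Rightarrow> real" and \<beta> :: "nat \<Rightarrow> real" and q0 \<Delta> p0 :: real
    and p :: "nat \<times> real \<Rightarrow> real" and d :: "real \<Rightarrow> real"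
    and Pinf :: "real \<Rightarrow> nat \<times> real \<Rightarrow> (nat \<times> real) measure"
  assumes chain: "nonexplosive_ctmc S P X q"
    and irreducible: "irreducible_chain S P X"
    and transient: "transient_chain S P X"
    and C: "C = S - {0}"
    and q0: "q0 = - q 0 0"
    and \<beta>: "\<beta> = (\<lambda>i. measure (P i) {\<omega>\<in>space (P i). \<forall>t\<ge>0. X t \<omega> \<noteq> 0})"
    and \<Delta>: "\<Delta> = (\<Sum>\<^sub>\<infinity>j\<in>C. q 0 j * \<beta> j / q0)"
    and p0: "p0 = (1 - exp (- q0)) * \<Delta> / (exp (- q0) + (1 - exp (- q0)) * \<Delta>)"
    and p: "p = (\<lambda>(i, u). if i = 0 then (1 - exp (- q0 * (1 - u))) / (1 - exp (- q0)) * p0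
                          else \<beta> i + (1 - \<beta> i) * p0)"
    and Pinf: "Pinf = (\<lambda>t z. density (Phat S P X t z) (\<lambda>y. ennreal (p y / p z)))"
    and qinf: "qinf = (\<lambda>i j. p (j, 0) / p (i, 0) * q i j)"
    and d: "d = (\<lambda>t. if 0 \<le> t \<and> t < 1 then exp (- q0 * t) / integral {0..1} (\<lambda>s. exp (- q0 * s)) else 0)"
  shows "(\<forall>z\<in>Shat S. 0 < p z \<and> ((\<lambda>t. survival P X z t) \<longlongrightarrow> p z) at_top) \<and>
    honest_semigroup (Shat_algebra S) Pinf \<and>
    (\<forall>z\<in>Shat S. markov_from (conditioned_law P X z) (Shat_algebra S)
       (\<lambda>t \<omega>. Xhat (snd z) (\<lambda>s. X s \<omega>) t) Pinf z) \<and>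
    (\<forall>i\<in>C. \<forall>j\<in>C.
       ((\<lambda>t. measure (Pinf t (i, 0)) {(j, 0)}) has_real_derivative qinf i j) (at_right 0)) \<and>
    (\<forall>i\<in>S. jump_holding_law (conditioned_law P X (i, 0)) X S
       (\<lambda>k. if k = 0 then d else exponential_density (- qinf k k))
       (\<lambda>k l. if k = 0 then (1 - exp (- q0)) * (q 0 l * p (l, 0) / (q0 * p0))
              else qinf k l / (- qinf k k)) i)"
proof -
  interpret nonexplosive_ctmc S P X q by (rule chain)
  interpret transient_ctmc S P X q by unfold_locales (rule transient)
  have q0_pos: "0 < q0" using q_diag_neg[OF zero_state] by (simp add: q0)
  have \<beta>_eq: "\<beta> i = never_0_prob i" if i: "i \<in> S" for i
  proof -
    have "{\<omega>\<in>space (P i). \<forall>t\<ge>0. X t \<omega> \<noteq> 0} =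
        {\<omega>\<in>space (P i). sample_path \<omega> \<in> {x\<in>paths S. hit {0} x = \<infinity>}}"
      using sample_path_paths by (auto simp: space_P[OF i] hit_infinity_iff sample_path_def)
    then show ?thesis
      unfolding \<beta> never_0_prob_def measure_path_law[OF i sets_never_0] by simp
  qed
  have "((\<lambda>j. q 0 j * \<beta> j / q0) has_sum escape_prob) C"
    using escape_prob_has_sum unfolding C
    by (rule has_sum_cong[THEN iffD1, rotated]) (simp add: \<beta>_eq q0)
  then have \<Delta>_eq: "\<Delta> = escape_prob" unfolding \<Delta> by (rule infsumI)
  have p0_eq: "p0 = eternal_prob (0, 0)"
    unfolding p0 \<Delta>_eq eternal_prob_0 by (simp add: q0)
  have p_eq: "p z = eternal_prob z" if z: "z \<in> Shat S" for z
  proof -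
    obtain i u where iu: "z = (i, u)" by (cases z)
    show ?thesis
    proof (cases "i = 0")
      case True
      then have "0 \<le> u" "u < 1" using z by (auto simp: iu Shat_def)
      then show ?thesis using eternal_prob_0_age[of u] True by (simp add: iu p p0_eq q0)
    next
      case False
      then have "i \<in> S" using z by (auto simp: iu Shat_def)
      then show ?thesis using eternal_prob_off_0[of i u] False by (simp add: iu p p0_eq \<beta>_eq)
    qed
  qed
  have Shat0: "(i, 0) \<in> Shat S" if "i \<in> S" for i using that by (simp add: Shat_def)
  \<comment> \<open>Only values on \<open>Shat S\<close> matter for the density, since
    \<open>Phat\<close> is a measure on that space; there the explicit \<open>p\<close> is
    \<open>eternal_prob\<close>.\<close>
  have Pinf_eq: "Pinf t z = cond_kernel t z" if z: "z \<in> Shat S" for t z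
    unfolding Pinf cond_kernel_def
  proof (rule density_cong)
    show "(\<lambda>y. ennreal (eternal_prob y / eternal_prob z)) \<in> borel_measurable (Phat S P X t z)"
      using density_measurable[OF z] by (simp cong: measurable_cong_sets)
    then show "(\<lambda>y. ennreal (p y / p z)) \<in> borel_measurable (Phat S P X t z)"
      by (rule measurable_cong[THEN iffD1, rotated]) (simp add: p_eq z)
    show "AE y in Phat S P X t z. ennreal (p y / p z) = ennreal (eternal_prob y / eternal_prob z)"
      by (rule AE_I2) (simp add: p_eq z)
  qed
  have "0 < p z \<and> ((\<lambda>t. survival P X z t) \<longlongrightarrow> p z) at_top" if z: "z \<in> Shat S" for z
    using eternal_prob_pos[OF z] survival_tendsto[OF Shat_fst[OF z]] by (simp add: p_eq[OF z])
  moreover have "honest_semigroup (Shat_algebra S) Pinf"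
    unfolding honest_semigroup_def
  proof (intro conjI allI ballI impI)
    fix t :: real assume t: "0 \<le> t"
    show "Pinf t \<in> Shat_algebra S \<rightarrow>\<^sub>M prob_algebra (Shat_algebra S)"
      using measurable_cond_kernel[OF t]
      by (rule measurable_cong[THEN iffD1, rotated]) (simp add: Pinf_eq)
  next
    fix z assume "z \<in> space (Shat_algebra S)"
    then show "Pinf 0 z = return (Shat_algebra S) z" by (simp add: Pinf_eq cond_kernel_0)
  next
    fix s t :: real and z assume st: "0 \<le> s" "0 \<le> t" and "z \<in> space (Shat_algebra S)"
    then have z: "z \<in> Shat S" by simp
    have "cond_kernel s z \<bind> Pinf t = cond_kernel s z \<bind> cond_kernel t"
    proof (rule bind_cong)
      show "Pinf t y = cond_kernel t y" if "y \<in> space (cond_kernel s z)" for y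
        using that by (simp add: Pinf_eq)
    qed simp
    then show "Pinf (s + t) z = Pinf s z \<bind> Pinf t"
      using cond_kernel_add[OF z st] by (simp add: Pinf_eq[OF z])
  qed
  moreover have "markov_from (conditioned_law P X z) (Shat_algebra S)
      (\<lambda>t \<omega>. Xhat (snd z) (\<lambda>s. X s \<omega>) t) Pinf z" if z: "z \<in> Shat S" for z
  proof -
    note M = markov_conditioned_law[OF z, unfolded markov_from_def]
    let ?N = "conditioned_law P X z" and ?Z = "\<lambda>t \<omega>. Xhat (snd z) (\<lambda>s. X s \<omega>) t"
    have eq: "(\<integral>\<^sup>+\<omega>\<in>A. emeasure (Pinf h (?Z t \<omega>)) B \<partial>?N) = (\<integral>\<^sup>+\<omega>\<in>A. emeasure (cond_kernel h (?Z t \<omega>)) B \<partial>?N)"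
      if "0 \<le> t" for t h A B
    proof (rule nn_integral_cong)
      fix \<omega> assume \<omega>: "\<omega> \<in> space ?N"
      have "?Z t \<in> ?N \<rightarrow>\<^sub>M Shat_algebra S" using M that by blast
      from measurable_space[OF this \<omega>] have "?Z t \<omega> \<in> Shat S" by simp
      then show "emeasure (Pinf h (?Z t \<omega>)) B * indicator A \<omega> = emeasure (cond_kernel h (?Z t \<omega>)) B * indicator A \<omega>"
        by (simp add: Pinf_eq)
    qed
    show ?thesis
      unfolding markov_from_def
    proof (intro conjI allI ballI impI)
      fix t h :: real and A B assume t: "0 \<le> t"
      assume "0 \<le> h" "A \<in> sets (history (space ?N) (Shat_algebra S) ?Z t)" "B \<in> sets (Shat_algebra S)"
      then show "emeasure ?N {\<omega>\<in>A. ?Z (t + h) \<omega> \<in> B} = (\<integral>\<^sup>+\<omega>\<in>A. emeasure (Pinf h (?Z t \<omega>)) B \<partial>?N)"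
        unfolding eq[OF t] using M t by blast
    qed (use M in blast)+
  qed
  moreover have "((\<lambda>t. measure (Pinf t (i, 0)) {(j, 0)}) has_real_derivative qinf i j) (at_right 0)"
    if "i \<in> C" "j \<in> C" for i j
    using that cond_kernel_derivative[of i j]
    by (simp add: C Pinf_eq[OF Shat0] qinf p_eq[OF Shat0])
  moreover have "jump_holding_law (conditioned_law P X (i, 0)) X S
       (\<lambda>k. if k = 0 then d else exponential_density (- qinf k k))
       (\<lambda>k l. if k = 0 then (1 - exp (- q0)) * (q 0 l * p (l, 0) / (q0 * p0))
              else qinf k l / (- qinf k k)) i" if i: "i \<in> S" for i
  proof -
    let ?f = "\<lambda>k. if k = 0 then d else exponential_density (- qinf k k)"
    let ?r = "\<lambda>k l. if k = 0 then (1 - exp (- q0)) * (q 0 l * p (l, 0) / (q0 * p0))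
              else qinf k l / (- qinf k k)"
    \<comment> \<open>Density and jump weight are compared as a product: in 0 the conditioned
      holding density carries \<open>1 / (1 - exp (- q0))\<close>, which the normalising factor of
      the jump weights cancels.\<close>
    have factor: "(LINT t:A|lborel. ?f k t) * ?r k l =
        survived_exit_prob k A * jump_prob k l * (eternal_prob (l, 0) / eternal_prob (k, 0))"
      if k: "k \<in> S" and l: "l \<in> S" and A: "A \<in> sets borel" for k l A
    proof (cases "k = 0")
      case True
      have e: "1 - exp (- q0) \<noteq> 0" using q0_pos by simp
      have "(LINT t:A|lborel. ?f k t) = survived_exit_prob k A / (1 - exp (- q0))"
        using set_integral_truncated_exponential[OF q0_pos A] True by (simp add: d q0)
      then show ?thesis
        using True e by (simp add: p_eq[OF Shat0[OF l]] p0_eq q0)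
    next
      case False
      have pk: "eternal_prob (k, 0) \<noteq> 0" using eternal_prob_pos[OF Shat0[OF k]] by simp
      \<comment> \<open>On the diagonal the ratio of survival probabilities is 1, so off 0 the exit
        rate is unchanged and the conditioning acts on the jump probabilities alone.\<close>
      have kk: "- qinf k k = - q k k" using pk by (simp add: qinf p_eq[OF Shat0[OF k]])
      have "(LINT t:A|lborel. ?f k t) = survived_exit_prob k A"
        using measure_exponential_density_eq[OF _ A, of "- q k k"] q_diag_neg[OF k] False
        by (simp only: kk if_False)
      moreover have "?r k l = jump_prob k l * (eternal_prob (l, 0) / eternal_prob (k, 0))"
        using False unfolding kk by (simp add: mult.commute qinf p_eq[OF Shat0[OF k]] p_eq[OF Shat0[OF l]])
      ultimately show ?thesis by (simp only: mult.assoc)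
    qed
    show ?thesis
      unfolding jump_holding_law_def
    proof (intro allI impI)
      fix n :: nat and y :: "nat \<Rightarrow> nat" and A :: "nat \<Rightarrow> real set"
      assume y0: "y 0 = i" and yS: "\<forall>k\<le>n. y k \<in> S" and yA: "\<forall>k<n. y (Suc k) \<noteq> y k \<and> A k \<in> sets borel"
      have "(\<Prod>k<n. (LINT t:A k|lborel. ?f (y k) t) * ?r (y k) (y (Suc k))) =
          (\<Prod>k<n. survived_exit_prob (y k) (A k) * jump_prob (y k) (y (Suc k)) *
            (eternal_prob (y (Suc k), 0) / eternal_prob (y k, 0)))"
      proof (rule prod.cong[OF refl])
        fix k assume "k \<in> {..<n}"
        then show "(LINT t:A k|lborel. ?f (y k) t) * ?r (y k) (y (Suc k)) =
            survived_exit_prob (y k) (A k) * jump_prob (y k) (y (Suc k)) *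
            (eternal_prob (y (Suc k), 0) / eternal_prob (y k, 0))"
          using yS yA by (intro factor) auto
      qed
      moreover have "measure (conditioned_law P X (y 0, 0)) {\<omega>\<in>space (conditioned_law P X (y 0, 0)).
          (\<forall>k\<le>n. visited (\<lambda>s. X s \<omega>) k = y k) \<and> (\<forall>k<n. holding (\<lambda>s. X s \<omega>) k \<in> ereal ` A k)} =
        (\<Prod>k<n. survived_exit_prob (y k) (A k) * jump_prob (y k) (y (Suc k)) *
          (eternal_prob (y (Suc k), 0) / eternal_prob (y k, 0)))"
        by (rule measure_conditioned_itinerary) (use yS yA in auto)
      ultimately show "measure (conditioned_law P X (i, 0)) {\<omega>\<in>space (conditioned_law P X (i, 0)).
          (\<forall>k\<le>n. visited (\<lambda>s. X s \<omega>) k = y k) \<and> (\<forall>k<n. holding (\<lambda>s. X s \<omega>) k \<in> ereal ` A k)} =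
        (\<Prod>k<n. (LINT t:A k|lborel. ?f (y k) t) * ?r (y k) (y (Suc k)))"
        unfolding y0 by (rule trans[OF _ sym, rotated])
    qed
  qed
  ultimately show ?thesis by blast
qed

end
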